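(* For $s\in\mathbb{R}\setminus[0,1)$ define the distribution function $F_s$ on $[0,1]$ by $F_s(0)=0$ and, for $0<x\le1$, $$F_s(x)=\begin{cases}\Big(1+\dfrac{x^{1-s}-1}{s-1}\Big)^{-1/s}, & 1<s<\infty,\\[4pt] (1+\log(1/x))^{-1}, & s=1,\\[2pt] (1-s(x^{s-1}-1))^{1/s}, & s<0.\end{cases}$$ Let $\mathbb{N}$ be a standard (rate one) Poisson process on $[0,\infty)$ and $U\sim$ Uniform$(0,1)$. (i) Fix $s\ge1$ and let $X_1,X_2,\ldots$ be i.i.d. with distribution function $F_s$. Then, as $n\to\infty$, $$S_n(s)\ \xrightarrow{d}\ \frac1s\Big(\sup_{t>0}\frac{\mathbb{N}(t)}{t}\Big)^s\ \stackrel{d}{=}\ \frac{1}{sU^s}.$$ (ii) Fix $s<0$ and let $X_1,X_2,\ldots$ be i.i.d. with distribution function $F_s$. Then, as $n\to\infty$, $$S_n(s)\ \xrightarrow{d}\ \frac{1}{1-s}\Big(\sup_{t\ge S_1}\frac{t}{\mathbb{N}(t)}\Big)^{-s},$$ where $S_1$ is the first jump point of $\mathbb{N}$.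
   Context: $\mathbb{F}_n(x)=n^{-1}\sum_{i=1}^n1\{X_i\le x\}$ is the empirical distribution function and $X_{(1)}\le\cdots\le X_{(n)}$ are the order statistics of $X_1,\ldots,X_n$. For $s\ne0,1$, $$K_s(u,v)=\frac{1}{s(1-s)}\{1-u^sv^{1-s}-(1-u)^s(1-v)^{1-s}\},$$ and $K_1(u,v)=u\log(u/v)+(1-u)\log\frac{1-u}{1-v}$, for $u,v\in(0,1)$; for $s\geq 1$ the same formulas are used for $u\in\{0,1\}$, $v\in(0,1)$, with $0^s=0$ and $0\log0=0$. The statistic is $$S_n(s)=\begin{cases}\sup_{0<x<1}K_s(\mathbb{F}_n(x),x), & s\ge1,\\ \sup_{X_{(1)}\le x<X_{(n)}}K_s(\mathbb{F}_n(x),x), & s<1.\end{cases}$$ *)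

theory Defs
  imports "HOL-Probability.Probability"
begin

(* 0 powr a = 0 and ln 0 = 0 realise the conventions 0^s = 0 and 0 log 0 = 0.
   The value at s = 0 is a dummy (division by zero). *)
definition K :: "real \<Rightarrow> real \<Rightarrow> real \<Rightarrow> real" where
  "K s u v =
    (if s = 1 then u * ln (u / v) + (1 - u) * ln ((1 - u) / (1 - v))
     else 1 / (s * (1 - s)) *
       (1 - u powr s * v powr (1 - s) - (1 - u) powr s * (1 - v) powr (1 - s)))"

text \<open>Samples are indexed from 1: the first \<open>n\<close> observations are \<open>X 1, \<dots>, X n\<close>.\<close>

definition emp_cdf :: "(nat \<Rightarrow> 'a \<Rightarrow> real) \<Rightarrow> nat \<Rightarrow> 'a \<Rightarrow> real \<Rightarrow> real" where
  "emp_cdf X n \<omega> x = (\<Sum>i = 1..n. indicator {..x} (X i \<omega>)) / real n"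

(* k ranges over 1..n *)
definition order_stat :: "(nat \<Rightarrow> 'a \<Rightarrow> real) \<Rightarrow> nat \<Rightarrow> nat \<Rightarrow> 'a \<Rightarrow> real" where
  "order_stat X n k \<omega> = sort (map (\<lambda>i. X i \<omega>) [1..<Suc n]) ! (k - 1)"

(* The suprema here and in the limits below are taken in the reals.
   Almost surely the set is bounded, and nonempty unless s < 1 and n \<le> 1; elsewhere
   Sup returns some fixed real number, which affects neither laws nor limits. *)
definition S_stat :: "real \<Rightarrow> (nat \<Rightarrow> 'a \<Rightarrow> real) \<Rightarrow> nat \<Rightarrow> 'a \<Rightarrow> real" where
  "S_stat s X n \<omega> =
    (if s \<ge> 1 then (SUP x\<in>{0<..<1}. K s (emp_cdf X n \<omega> x) x)
     else (SUP x\<in>{order_stat X n 1 \<omega>..<order_stat X n n \<omega>}. K s (emp_cdf X n \<omega> x) x))"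

(* Extended from [0,1] to the real line by 0 and 1; intended for s outside [0,1) only. *)
definition F_dist :: "real \<Rightarrow> real \<Rightarrow> real" where
  "F_dist s x =
    (if x \<le> 0 then 0
     else if x > 1 then 1
     else if s > 1 then (1 + (x powr (1 - s) - 1) / (s - 1)) powr (- 1 / s)
     else if s = 1 then inverse (1 + ln (1 / x))
     else (1 - s * (x powr (s - 1) - 1)) powr (1 / s))"

definition iid_with_cdf :: "'a measure \<Rightarrow> (nat \<Rightarrow> 'a \<Rightarrow> real) \<Rightarrow> (real \<Rightarrow> real) \<Rightarrow> bool" where
  "iid_with_cdf M X F \<longleftrightarrow>
    prob_space.indep_vars M (\<lambda>_. borel) X {1..} \<and> (\<forall>i\<ge>1. cdf (distr M borel (X i)) = F)"

(* Measurability is demanded explicitly because distr of a non-measurable function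
   is the null measure, for which weak convergence would be meaningless. *)
definition converges_in_dist ::
  "'a measure \<Rightarrow> (nat \<Rightarrow> 'a \<Rightarrow> real) \<Rightarrow> 'b measure \<Rightarrow> ('b \<Rightarrow> real) \<Rightarrow> bool" where
  "converges_in_dist M Y P Z \<longleftrightarrow>
    (\<forall>n. Y n \<in> borel_measurable M) \<and> Z \<in> borel_measurable P \<and>
    weak_conv_m (\<lambda>n. distr M borel (Y n)) (distr P borel Z)"

definition eq_in_dist :: "'a measure \<Rightarrow> ('a \<Rightarrow> real) \<Rightarrow> 'b measure \<Rightarrow> ('b \<Rightarrow> real) \<Rightarrow> bool" where
  "eq_in_dist M Y P Z \<longleftrightarrow>
    Y \<in> borel_measurable M \<and> Z \<in> borel_measurable P \<and> distr M borel Y = distr P borel Z"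

(* Only the values at times t \<ge> 0 matter. Paths are nondecreasing, so the
   natural-number subtractions do not truncate. *)
definition standard_poisson_process :: "'b measure \<Rightarrow> (real \<Rightarrow> 'b \<Rightarrow> nat) \<Rightarrow> bool" where
  "standard_poisson_process P N \<longleftrightarrow>
    (\<forall>t\<ge>0. N t \<in> measurable P (count_space UNIV)) \<and>
    (\<forall>\<omega>\<in>space P. N 0 \<omega> = 0 \<and> mono_on {0..} (\<lambda>t. N t \<omega>) \<and>
       (\<forall>t\<ge>0. continuous (at_right t) (\<lambda>u. real (N u \<omega>)))) \<and>
    (\<forall>(t :: nat \<Rightarrow> real) n. 0 \<le> t 0 \<and> (\<forall>i<n. t i \<le> t (Suc i)) \<longrightarrow>
       prob_space.indep_vars P (\<lambda>_. count_space UNIV)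
         (\<lambda>i \<omega>. N (t (Suc i)) \<omega> - N (t i) \<omega>) {..<n}) \<and>
    (\<forall>a b. 0 \<le> a \<and> a < b \<longrightarrow>
       distr P (count_space UNIV) (\<lambda>\<omega>. N b \<omega> - N a \<omega>) = measure_pmf (poisson_pmf (b - a)))"

(* The value 0 for a path without jumps (a null event) keeps first_jump in the index set [0,\<infinity>). *)
definition first_jump :: "(real \<Rightarrow> 'b \<Rightarrow> nat) \<Rightarrow> 'b \<Rightarrow> real" where
  "first_jump N \<omega> =
    (let J = {t. 0 < t \<and> \<not> isCont (\<lambda>u. real (N u \<omega>)) t}
     in if J = {} then 0 else Inf J)"

end

theory Submission
  imports Defs "HOL-Real_Asymp.Real_Asymp"
begin

text \<open>
  Put \<open>Y\<^sub>i = F\<^sub>s(X\<^sub>i)\<close>, a uniform sample with empirical distribution function \<open>G\<^sub>n\<close>, and write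
  \<open>y = F\<^sub>s(x)\<close>, \<open>u = G\<^sub>n(y)\<close>. The distribution \<open>F\<^sub>s\<close> is chosen so that \<open>K\<^sub>s(u, x)\<close> equals
  \<open>(u / y)\<^sup>s / s\<close> (for \<open>s \<ge> 1\<close>) or \<open>(y / u)\<^sup>-\<^sup>s / (1 - s)\<close> (for \<open>s < 0\<close>) up to a correction which
  vanishes as \<open>y \<rightarrow> 0\<close> and which, in the bulk and near 1, never lifts the supremum above the values
  \<open>1 / s\<close> and \<open>1 / (1 - s)\<close> that the limits exceed anyway.

  Since counting paths are monotone and integer valued, \<open>sup N(t) / t \<le> \<lambda>\<close> is, up to an
  arbitrarily small change of \<open>\<lambda>\<close>, the event that \<open>N(k / \<lambda>) < k\<close> for all \<open>k \<ge> 1\<close>, and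
  \<open>sup t / N(t) \<le> \<lambda>\<close> from the first jump on is the event that \<open>N(k \<lambda>) > k\<close> for all \<open>k \<ge> 1\<close>;
  the same holds for \<open>t \<mapsto> n G\<^sub>n(t / n)\<close>. For finitely many \<open>k\<close> the multinomial
  probabilities converge to the Poisson ones, and a Chernoff bound that is geometric in \<open>k\<close>,
  uniformly in \<open>n\<close>, takes care of the remaining \<open>k\<close>. The right end of the sample is controlled by
  applying the same bounds to \<open>1 - Y\<^sub>i\<close>. The law of \<open>sup N(t) / t\<close> follows from the ballot formula
  \<open>P(N(k \<tau>) < k for 1 \<le> k \<le> m, N(m \<tau>) = q) = (1 - q / m) P(N(m \<tau>) = q)\<close>.
\<close>

section \<open>The divergence \<open>K\<^sub>s\<close> and the distribution functions \<open>F\<^sub>s\<close>\<close>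

text \<open>Three obstacles shape the proof. (1) Convergence on a finite grid only sees the points
  of order 1/n at the left end, while no slope close to 1 for the empirical distribution holds
  uniformly up to an end of the sample. Where the correction to the leading term matters, two slopes
  are therefore combined: one close to 1, valid beyond the m-th grid point, and a crude one, valid
  everywhere. Within m grid steps of the right end a weight 1 - u or 1 - x of order m/n outweighs
  the crude ratio; at the left end, for s < 0, a small x cancels the correction altogether. (2) A
  bound on a real supremum says nothing until the set is known to be bounded, so boundedness is
  established for paths and statistics alike. (3) For s < 0 a bound on t/N(t) yields more than one
  point by time l only if the first jump is simple, and the sample behaves likewise; hence double
  first jumps and ties are shown to be null events. The limits exceed 1/s and 1/(1-s) because N(t)/t
  tends to 1, which enters here only through the exponential tail bounds.\<close>

lemma powr_minus_one_le:
  fixes a p :: real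
  assumes "a \<ge> 1" "p > 0"
  shows "a powr p - 1 \<le> p * (a powr (p + 1) - 1)"
proof -
  \<comment> \<open>Two tangent-line bounds: 1 - v <= exp (-v) at v = p ln a bounds
    \<open>a powr p - 1\<close> by p a^p ln a, and ln a <= a - 1 then removes the logarithm.\<close>
  have "1 - p * ln a \<le> exp (- (p * ln a))"
    using exp_ge_add_one_self[of "- (p * ln a)"] by simp
  also have "\<dots> = inverse (a powr p)" using assms by (simp add: powr_def exp_minus)
  finally have "(1 - p * ln a) * a powr p \<le> 1"
    using assms by (simp add: field_simps)
  then have 1: "a powr p - 1 \<le> p * (ln a * a powr p)" by (simp add: algebra_simps)
  have "ln a * a powr p \<le> (a - 1) * a powr p"
    using assms ln_le_minus_one[of a] by (intro mult_right_mono) auto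
  also have "\<dots> = a powr (p + 1) - a powr p"
    using assms by (simp add: powr_add algebra_simps)
  also have "\<dots> \<le> a powr (p + 1) - 1"
    using assms ge_one_powr_ge_zero[of a p] by simp
  finally show ?thesis using 1 assms by (smt (verit) mult_left_mono)
qed

section \<open>The functions \<open>F_dist\<close>: inversion, monotonicity, comparison with the
  identity\<close>

lemma F_dist_powr_gt1:
  assumes "s > 1" "0 < x" "x \<le> 1"
  shows "F_dist s x powr (- s) = 1 + (x powr (1 - s) - 1) / (s - 1)"
    "F_dist s x = (1 + (x powr (1 - s) - 1) / (s - 1)) powr (- 1 / s)"
    "x powr (1 - s) \<ge> 1"
proof -
  show 1: "x powr (1 - s) \<ge> 1"
    using assms powr_mono'[of "1 - s" 0 x] by simp
  show 2: "F_dist s x = (1 + (x powr (1 - s) - 1) / (s - 1)) powr (- 1 / s)"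
    using assms by (simp add: F_dist_def)
  have "1 + (x powr (1 - s) - 1) / (s - 1) > 0" using 1 assms by (smt (verit) divide_nonneg_pos)
  then show "F_dist s x powr (- s) = 1 + (x powr (1 - s) - 1) / (s - 1)"
    unfolding 2 using assms by (simp add: powr_powr)
qed

lemma F_dist_powr_neg:
  assumes "s < 0" "0 < x" "x \<le> 1"
  shows "F_dist s x powr s = 1 - s * (x powr (s - 1) - 1)"
    "F_dist s x = (1 - s * (x powr (s - 1) - 1)) powr (1 / s)"
    "x powr (s - 1) \<ge> 1"
proof -
  show 1: "x powr (s - 1) \<ge> 1"
    using assms powr_mono'[of "s - 1" 0 x] by simp
  show 2: "F_dist s x = (1 - s * (x powr (s - 1) - 1)) powr (1 / s)"
    using assms by (simp add: F_dist_def)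
  have "s * (x powr (s - 1) - 1) \<le> 0" using 1 assms by (simp add: mult_nonpos_nonneg)
  then have "1 - s * (x powr (s - 1) - 1) > 0" by simp
  then show "F_dist s x powr s = 1 - s * (x powr (s - 1) - 1)"
    unfolding 2 using assms by (simp add: powr_powr)
qed

lemma F_dist_inverse_1:
  assumes "0 < x" "x \<le> 1"
  shows "F_dist 1 x = 1 / (1 - ln x)" "ln x \<le> 0"
  using assms by (auto simp: F_dist_def ln_div divide_simps)

lemma F_dist_pos:
  assumes "s \<ge> 1 \<or> s < 0" "0 < x" shows "F_dist s x > 0"
proof (cases "x \<le> 1")
  case True
  consider "s > 1" | "s = 1" | "s < 0" using assms by force
  then show ?thesis
  proof cases
    case 1
    have "1 + (x powr (1 - s) - 1) / (s - 1) > 0"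
      using F_dist_powr_gt1(3)[OF 1 assms(2) True] 1 by (smt (verit) divide_nonneg_pos)
    then show ?thesis unfolding F_dist_powr_gt1(2)[OF 1 assms(2) True] by simp
  next
    case 2 then show ?thesis using F_dist_inverse_1[OF assms(2) True] by simp
  next
    case 3
    have "s * (x powr (s - 1) - 1) \<le> 0"
      using F_dist_powr_neg(3)[OF 3 assms(2) True] 3 by (simp add: mult_nonpos_nonneg)
    then show ?thesis unfolding F_dist_powr_neg(2)[OF 3 assms(2) True] by simp
  qed
qed (auto simp: F_dist_def)

lemma F_dist_1 [simp]: "F_dist s 1 = 1" by (auto simp: F_dist_def)

lemma F_dist_strict_mono:
  assumes "s \<ge> 1 \<or> s < 0" "0 < x" "x < x'" "x' \<le> 1"
  shows "F_dist s x < F_dist s x'"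
proof -
  have x: "0 < x" "x \<le> 1" "0 < x'" "x' \<le> 1" using assms by auto
  consider "s > 1" | "s = 1" | "s < 0" using assms by force
  then show ?thesis
  proof cases
    case 1
    have "x' powr (1 - s) < x powr (1 - s)" using assms 1 by (intro powr_less_mono2_neg) auto
    then have *: "1 + (x' powr (1 - s) - 1) / (s - 1) < 1 + (x powr (1 - s) - 1) / (s - 1)"
      using 1 by (simp add: divide_strict_right_mono)
    have "1 + (x' powr (1 - s) - 1) / (s - 1) > 0"
      using F_dist_powr_gt1(3)[OF 1 x(3,4)] 1 by (smt (verit) divide_nonneg_pos)
    then show ?thesis unfolding F_dist_powr_gt1(2)[OF 1 x(1,2)] F_dist_powr_gt1(2)[OF 1 x(3,4)]
      using * 1 by (intro powr_less_mono2_neg) auto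
  next
    case 2
    have "ln x < ln x'" using assms by simp
    then show ?thesis unfolding 2 F_dist_inverse_1(1)[OF x(1,2)] F_dist_inverse_1(1)[OF x(3,4)]
      using F_dist_inverse_1(2)[OF x(3,4)] by (intro divide_strict_left_mono) auto
  next
    case 3
    have "x' powr (s - 1) < x powr (s - 1)" using assms 3 by (intro powr_less_mono2_neg) auto
    then have *: "1 - s * (x' powr (s - 1) - 1) < 1 - s * (x powr (s - 1) - 1)"
      using 3 by (simp add: )
    have "s * (x' powr (s - 1) - 1) \<le> 0"
      using F_dist_powr_neg(3)[OF 3 x(3,4)] 3 by (simp add: mult_nonpos_nonneg)
    then show ?thesis unfolding F_dist_powr_neg(2)[OF 3 x(1,2)] F_dist_powr_neg(2)[OF 3 x(3,4)]
      using * 3 by (intro powr_less_mono2_neg) (auto simp: divide_simps)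
  qed
qed

lemma F_dist_less_1:
  assumes "s \<ge> 1 \<or> s < 0" "x < 1" shows "F_dist s x < 1"
  using F_dist_strict_mono[OF assms(1), of x 1] assms(2) by (cases "x \<le> 0") (auto simp: F_dist_def)

lemma F_dist_range:
  assumes "s \<ge> 1 \<or> s < 0" shows "0 \<le> F_dist s x" "F_dist s x \<le> 1"
proof -
  show "0 \<le> F_dist s x" using F_dist_pos[OF assms, of x] by (cases "x \<le> 0") (auto simp: F_dist_def)
  show "F_dist s x \<le> 1" using F_dist_less_1[OF assms, of x] by (cases "x < 1") (auto simp: F_dist_def)
qed

lemma F_dist_mono: assumes "s \<ge> 1 \<or> s < 0" shows "mono (F_dist s)"
proof (rule monoI)
  fix x y :: real assume xy: "x \<le> y"
  consider "x \<le> 0" | "y \<ge> 1" | "x = y" | "0 < x" "x < y" "y \<le> 1" using xy by linarith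
  then show "F_dist s x \<le> F_dist s y"
  proof cases
    case 1 then show ?thesis using F_dist_range[OF assms] by (simp add: F_dist_def)
  next
    case 2 then have "F_dist s y = 1" by (cases "y = 1") (auto simp: F_dist_def)
    then show ?thesis using F_dist_range[OF assms] by simp
  next
    case 4 then show ?thesis using F_dist_strict_mono[OF assms] by (simp add: less_imp_le)
  qed simp
qed

lemma F_dist_le_iff:
  assumes "s \<ge> 1 \<or> s < 0" "0 < x" "x < 1"
  shows "F_dist s z \<le> F_dist s x \<longleftrightarrow> z \<le> x"
proof
  assume *: "F_dist s z \<le> F_dist s x"
  show "z \<le> x"
  proof (rule ccontr)
    assume "\<not> z \<le> x"
    \<comment> \<open>From 1 on the function is constant, so strict monotonicity is applied at
      \<open>min z 1\<close>, which still lies to the right of \<open>x\<close>.\<close>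
    then have "F_dist s x < F_dist s (min z 1)" using assms by (intro F_dist_strict_mono) auto
    also have "\<dots> \<le> F_dist s z" using F_dist_mono[OF assms(1)] by (simp add: mono_def)
    finally show False using * by simp
  qed
qed (use F_dist_mono[OF assms(1)] in \<open>simp add: mono_def\<close>)

lemma F_dist_surj:
  assumes "s \<ge> 1 \<or> s < 0" "0 < y" "y < 1"
  obtains x where "0 < x" "x < 1" "F_dist s x = y"
proof -
  consider "s > 1" | "s = 1" | "s < 0" using assms by force
  then have "\<exists>x. 0 < x \<and> x < 1 \<and> F_dist s x = y"
  proof cases
    case 1
    \<comment> \<open>The value of \<open>x powr (1 - s)\<close> forced by
      \<open>F_dist s x = y\<close>; being above 1, it places the solution in (0,1).\<close>
    define b where "b = 1 + (s - 1) * (y powr (- s) - 1)"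
    have "y powr (- s) > 1" using assms 1 powr_less_mono2_neg[of "- s" y 1] by simp
    then have b: "b > 1" using 1 unfolding b_def by simp
    define x where "x = b powr (1 / (1 - s))"
    have x: "x > 0" "x < 1" using b 1 powr_less_mono2_neg[of "1 / (1 - s)" 1 b]
      by (auto simp: x_def divide_simps)
    have "x powr (1 - s) = b" using b 1 by (simp add: x_def powr_powr)
    then have "1 + (x powr (1 - s) - 1) / (s - 1) = y powr (- s)" using 1 by (simp add: b_def)
    then have "F_dist s x = y" using 1 x assms F_dist_powr_gt1(2)[of s x] by (simp add: powr_powr)
    then show ?thesis using x by blast
  next
    case 2
    define x where "x = exp (1 - 1 / y)"
    have x: "x > 0" "x < 1" using assms by (auto simp: x_def)
    moreover have "F_dist 1 x = y" using F_dist_inverse_1[of x] x by (simp add: x_def)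
    ultimately show ?thesis using 2 by blast
  next
    case 3
    define b where "b = 1 + (y powr s - 1) / (- s)"
    have "y powr s > 1" using assms 3 powr_less_mono2_neg[of s y 1] by simp
    then have b: "b > 1" using 3 unfolding b_def by (smt (verit) divide_pos_pos)
    define x where "x = b powr (1 / (s - 1))"
    have x: "x > 0" "x < 1" using b 3 powr_less_mono2_neg[of "1 / (s - 1)" 1 b]
      by (auto simp: x_def divide_simps)
    have "x powr (s - 1) = b" using b 3 by (simp add: x_def powr_powr)
    then have "1 - s * (x powr (s - 1) - 1) = y powr s" using 3 by (simp add: b_def)
    then have "F_dist s x = y" using 3 x assms F_dist_powr_neg(2)[of s x] by (simp add: powr_powr)
    then show ?thesis using x by blast
  qed
  then show thesis using that by blast
qed

text \<open>Gives 1 - F(x) <= 1 - x, so that bounds on the transformed sample near 1 carry over to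
  the original scale. For s > 1 it is \<open>powr_minus_one_le\<close> at a = 1/x and p = s -
  1.\<close>

lemma F_dist_ge:
  assumes "s \<ge> 1" "0 < x" "x < 1" shows "x \<le> F_dist s x"
proof (cases "s = 1")
  case True
  have "1 - ln x \<le> 1 / x" using ln_le_minus_one[of "1/x"] assms by (simp add: ln_div)
  then have "x * (1 - ln x) \<le> 1" using assms by (simp add: field_simps)
  moreover have "1 - ln x > 0" using assms ln_less_zero[of x] by linarith
  ultimately have "x \<le> 1 / (1 - ln x)" by (simp add: le_divide_eq)
  then show ?thesis using F_dist_inverse_1(1)[of x] assms True by simp
next
  case False
  then have s: "s > 1" using assms by simp
  have "(1 / x) powr (s - 1) - 1 \<le> (s - 1) * ((1 / x) powr s - 1)"
    using powr_minus_one_le[of "1 / x" "s - 1"] assms s by simp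
  moreover have "(1 / x) powr (s - 1) = x powr (1 - s)" "(1 / x) powr s = x powr (- s)"
    using powr_minus_divide[of x s] powr_minus_divide[of x "s - 1"] by (simp_all add: powr_divide)
  moreover have "(s - 1) * (F_dist s x powr (- s) - 1) = x powr (1 - s) - 1"
    using F_dist_powr_gt1(1)[of s x] assms s by simp
  ultimately have "(s - 1) * (F_dist s x powr (- s) - 1) \<le> (s - 1) * (x powr (- s) - 1)" by simp
  then have "F_dist s x powr (- s) \<le> x powr (- s)" using s by simp
  then show ?thesis using s assms F_dist_pos[of s x]
    by (smt (verit) powr_less_mono2_neg)
qed

text \<open>Opposite direction to the orders at least 1, and the one in which the right-end
  estimates for negative order run: 1 - x <= 1 - F(x). Here \<open>powr_minus_one_le\<close> is used
  with p = -s.\<close>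

lemma F_dist_le:
  assumes "s < 0" "0 < x" "x < 1" shows "F_dist s x \<le> x"
proof -
  have "(1 / x) powr (- s) - 1 \<le> (- s) * ((1 / x) powr (1 - s) - 1)"
    using powr_minus_one_le[of "1 / x" "- s"] assms by simp
  moreover have "(1 / x) powr (- s) = x powr s" "(1 / x) powr (1 - s) = x powr (s - 1)"
    using powr_minus_divide[of x "- s"] powr_minus_divide[of x "1 - s"] by (simp_all add: powr_divide)
  ultimately have "x powr s \<le> F_dist s x powr s"
    using F_dist_powr_neg(1)[of s x] assms by (simp add: field_simps)
  then show ?thesis using assms F_dist_pos[of s x]
    by (smt (verit) powr_less_mono2_neg)
qed

section \<open>The divergence of order at least 1\<close>

lemma powr_split_ratio:
  fixes a b p :: real
  assumes "a \<ge> 0" "b > 0"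
  shows "a powr (1 + p) * b powr (- p) = a * (a / b) powr p"
  using assms by (cases "a = 0") (simp_all add: powr_add powr_divide powr_minus divide_simps)

text \<open>The defining relation of \<open>F_dist\<close> reads x^(1-s) = (s-1) F^(-s) + 2 - s.
  Inserted into \<open>K\<close>, it makes (u/F)^s / s the exact leading term, and the numerator of
  the remainder tends to 0 as u and x do.\<close>

lemma K_gt1_eq:
  assumes "s > 1" "0 < x" "x < 1" "0 \<le> u"
  shows "K s u x = 1 / s * (u / F_dist s x) powr s +
    ((2 - s) * u powr s + (1 - u) powr s * (1 - x) powr (1 - s) - 1) / (s * (s - 1))"
proof -
  define y where "y = F_dist s x"
  have y: "y > 0" using F_dist_pos assms by (simp add: y_def)
  define W where "W = (1 - u) powr s * (1 - x) powr (1 - s)"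
  have "x powr (1 - s) = (s - 1) * y powr (- s) + 2 - s"
    using F_dist_powr_gt1(1)[of s x] assms by (simp add: y_def field_simps)
  then have "u powr s * x powr (1 - s) = (s - 1) * (u powr s * y powr (- s)) + (2 - s) * u powr s"
    by (simp only:) (simp add: algebra_simps)
  also have "u powr s * y powr (- s) = (u / y) powr s"
    by (simp add: powr_divide powr_minus_divide)
  finally have *: "u powr s * x powr (1 - s) = (s - 1) * (u / y) powr s + (2 - s) * u powr s" .
  have "K s u x = (u powr s * x powr (1 - s) + W - 1) / (s * (s - 1))"
    using assms by (simp add: K_def W_def divide_simps) (simp add: algebra_simps)
  also have "\<dots> = 1 / s * (u / y) powr s + ((2 - s) * u powr s + W - 1) / (s * (s - 1))"
    using assms unfolding * by (simp add: divide_simps)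
  finally show ?thesis by (simp add: y_def W_def)
qed

lemma K_gt1_eq':
  assumes "s > 1"
  shows "K s u x = (u powr s * x powr (1 - s) + (1 - u) powr s * (1 - x) powr (1 - s) - 1) / (s * (s - 1))"
  using assms by (simp add: K_def divide_simps) (simp add: algebra_simps)

text \<open>At order 1 the relation is 1 - ln x = 1/F, which leaves u/F as the leading term.\<close>

lemma K_1_eq:
  assumes "0 < x" "x < 1" "0 \<le> u" "u \<le> 1"
  shows "K 1 u x = u / F_dist 1 x - u + u * ln u + (1 - u) * ln (1 - u) - (1 - u) * ln (1 - x)"
proof -
  have "u * ln (u / x) = u * ln u - u * ln x"
    using assms by (cases "u = 0") (simp_all add: ln_div algebra_simps)
  moreover have "(1 - u) * ln ((1 - u) / (1 - x)) = (1 - u) * ln (1 - u) - (1 - u) * ln (1 - x)"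
    using assms by (cases "u = 1") (simp_all add: ln_div algebra_simps)
  ultimately show ?thesis
    using F_dist_inverse_1(1)[of x] assms by (simp add: K_def algebra_simps)
qed

text \<open>For x <= u the remainder is nonpositive: the ratio (1-u)/(1-x) is at most 1, so its term
  contributes at most 1 - u, while (2-s) u^s <= u. Thus the leading term is an upper bound all the
  way to the right end.\<close>

lemma K_upper_right:
  assumes s: "s \<ge> 1" and x: "0 < x" "x < 1" and u: "x \<le> u" "u \<le> 1"
  shows "K s u x \<le> 1 / s * (u / F_dist s x) powr s"
proof (cases "s = 1")
  case True
  have "u * ln u \<le> 0" using u x by (simp add: mult_nonneg_nonpos)
  moreover have "(1 - u) * ln (1 - u) \<le> (1 - u) * ln (1 - x)"
    using u x by (cases "u = 1") (auto intro!: mult_left_mono)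
  ultimately have "K s u x \<le> u / F_dist s x"
    using K_1_eq[of x u] assms True by simp
  then show ?thesis using True F_dist_pos[of s x] assms by simp
next
  case False
  then have s: "s > 1" using s by simp
  have "(1 - u) powr s * (1 - x) powr (1 - s) = (1 - u) * ((1 - u) / (1 - x)) powr (s - 1)"
    using powr_split_ratio[of "1 - u" "1 - x" "s - 1"] u x by simp
  also have "\<dots> \<le> (1 - u) * 1"
    using u x s by (intro mult_left_mono powr_le1) auto
  finally have 1: "(1 - u) powr s * (1 - x) powr (1 - s) \<le> 1 - u" by simp
  have "u powr s \<le> u" using u x s by (intro powr_le_one_le) auto
  then have "(2 - s) * u powr s \<le> u"
    using s mult_right_mono[of "2 - s" 1 "u powr s"] by simp
  with 1 have "(2 - s) * u powr s + (1 - u) powr s * (1 - x) powr (1 - s) - 1 \<le> 0" by simp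
  then have "((2 - s) * u powr s + (1 - u) powr s * (1 - x) powr (1 - s) - 1) / (s * (s - 1)) \<le> 0"
    using s by (intro divide_nonpos_pos) auto
  then show ?thesis using K_gt1_eq[of s x u] s x u by simp
qed

text \<open>For u < x the left term contributes at most u (at order 1, at most 0), so only the
  excess of (1-u)/(1-x) over 1 counts. The prefactor 1 - u is kept because near the right end it is
  small while the ratio is merely bounded.\<close>

lemma K_upper_left:
  assumes s: "s \<ge> 1"
  shows "\<exists>C>0. \<forall>x u. 0 < x \<and> x < 1 \<and> 0 \<le> u \<and> u < x \<longrightarrow>
    K s u x \<le> C * ((1 - u) * (((1 - u) / (1 - x)) powr s - 1))"
proof (cases "s = 1")
  case True
  have "K s u x \<le> 1 * ((1 - u) * (((1 - u) / (1 - x)) powr s - 1))"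
    if "0 < x" "x < 1" "0 \<le> u" "u < x" for x u
  proof -
    have "u * ln (u / x) \<le> 0" using that by (cases "u = 0") (auto intro!: mult_nonneg_nonpos)
    moreover have "(1 - u) * ln ((1 - u) / (1 - x)) \<le> (1 - u) * ((1 - u) / (1 - x) - 1)"
      using that by (intro mult_left_mono ln_le_minus_one) auto
    moreover have "K s u x = u * ln (u / x) + (1 - u) * ln ((1 - u) / (1 - x))"
      using True by (simp add: K_def)
    moreover have "s = 1" "((1 - u) / (1 - x)) powr 1 = (1 - u) / (1 - x)" using that True by auto
    ultimately show ?thesis by (simp only:)
  qed
  then show ?thesis by (intro exI[of _ 1]) auto
next
  case False
  then have s: "s > 1" using s by simp
  have "K s u x \<le> 1 / (s * (s - 1)) * ((1 - u) * (((1 - u) / (1 - x)) powr s - 1))"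
    if that: "0 < x" "x < 1" "0 \<le> u" "u < x" for x u
  proof -
    have "u powr s * x powr (1 - s) = u * (u / x) powr (s - 1)"
      using powr_split_ratio[of u x "s - 1"] that by simp
    also have "\<dots> \<le> u * 1" using that s by (intro mult_left_mono powr_le1) auto
    finally have 1: "u powr s * x powr (1 - s) \<le> u" by simp
    have "(1 - u) powr s * (1 - x) powr (1 - s) = (1 - u) * ((1 - u) / (1 - x)) powr (s - 1)"
      using powr_split_ratio[of "1 - u" "1 - x" "s - 1"] that by simp
    also have "\<dots> \<le> (1 - u) * ((1 - u) / (1 - x)) powr s"
      using that by (intro mult_left_mono powr_mono) auto
    finally have "u powr s * x powr (1 - s) + (1 - u) powr s * (1 - x) powr (1 - s) - 1
       \<le> (1 - u) * (((1 - u) / (1 - x)) powr s - 1)" using 1 by (simp add: algebra_simps)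
    then show ?thesis unfolding K_gt1_eq'[OF s] using s by (simp add: divide_right_mono)
  qed
  then show ?thesis using s by (intro exI[of _ "1 / (s * (s - 1))"]) auto
qed

lemma tendsto_x_ln_x_0: "((\<lambda>u::real. u * ln u) \<longlongrightarrow> 0) (at_right 0)"
  by real_asymp

text \<open>The remainder is bounded below by a function of u alone that vanishes at 0, and the gap
  between l and l' absorbs it. Used contrapositively: a small statistic forbids
  \<open>l' * F_dist s x \<le> u\<close> for small u.\<close>

lemma K_lower:
  assumes s: "s \<ge> 1" and l: "0 < l" "l < l'"
  shows "\<exists>\<delta>>0. \<delta> < 1 \<and> (\<forall>x u. 0 < x \<and> x < 1 \<and> u \<le> \<delta> \<and> l' * F_dist s x \<le> u \<longrightarrow>
    1 / s * l powr s < K s u x)"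
proof -
  \<comment> \<open>The remainder with its x-dependent part bounded below: (1-x)^(1-s) >= 1, and at
    order 1 the term -(1-u) ln (1-x) is nonnegative.\<close>
  define h where "h u = (if s = 1 then - u + u * ln u + (1 - u) * ln (1 - u)
    else ((2 - s) * u powr s + (1 - u) powr s - 1) / (s * (s - 1)))" for u :: real
  have "((\<lambda>u. 1 / s * l' powr s + h u) \<longlongrightarrow> 1 / s * l' powr s + 0) (at_right 0)"
  proof (rule tendsto_add[OF tendsto_const])
    show "(h \<longlongrightarrow> 0) (at_right 0)"
    proof (cases "s = 1")
      case True
      have "((\<lambda>u::real. - u + u * ln u + (1 - u) * ln (1 - u)) \<longlongrightarrow> - 0 + 0 + (1 - 0) * ln (1 - 0)) (at_right 0)"
        by (intro tendsto_intros tendsto_x_ln_x_0) auto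
      then show ?thesis using True by (simp add: h_def[abs_def])
    next
      case False
      have "((\<lambda>u. ((2 - s) * u powr s + (1 - u) powr s - 1) / (s * (s - 1))) \<longlongrightarrow>
         ((2 - s) * 0 powr s + (1 - 0) powr s - 1) / (s * (s - 1))) (at_right 0)"
        using s False by (intro tendsto_intros) (auto simp: eventually_at_right_less intro: eventually_mono[OF eventually_at_right_less])
      then show ?thesis using False by (simp add: h_def[abs_def])
    qed
  qed
  moreover have "1 / s * l powr s < 1 / s * l' powr s + 0"
    using s l by (simp add: divide_strict_right_mono powr_less_mono2)
  ultimately have "\<forall>\<^sub>F u in at_right 0. 1 / s * l powr s < 1 / s * l' powr s + h u"
    by (rule order_tendstoD)
  then obtain b where b: "b > 0" "\<And>u. 0 < u \<Longrightarrow> u < b \<Longrightarrow> 1 / s * l powr s < 1 / s * l' powr s + h u"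
    unfolding eventually_at_right_field by blast
  define \<delta> where "\<delta> = min (b / 2) (1 / 2)"
  have \<delta>: "0 < \<delta>" "\<delta> < 1" "\<delta> < b" using b by (auto simp: \<delta>_def)
  have "1 / s * l powr s < K s u x"
    if x: "0 < x" "x < 1" and u: "u \<le> \<delta>" and lu: "l' * F_dist s x \<le> u" for x u
  proof -
    have F: "F_dist s x > 0" using F_dist_pos s x by simp
    then have u0: "u > 0" using lu l by (smt (verit) mult_pos_pos)
    have r: "l' \<le> u / F_dist s x" using lu F by (simp add: field_simps)
    have "1 / s * l' powr s + h u \<le> K s u x"
    proof (cases "s = 1")
      case True
      have "(1 - u) * ln (1 - x) \<le> 0" using x u \<delta> by (simp add: mult_nonneg_nonpos)
      then show ?thesis using K_1_eq[of x u] x u u0 \<delta> True r l by (simp add: h_def)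
    next
      case False
      then have s1: "s > 1" using s by simp
      have "1 \<le> (1 - x) powr (1 - s)" using powr_mono'[of "1 - s" 0 "1 - x"] s1 x by simp
      then have "(1 - u) powr s \<le> (1 - u) powr s * (1 - x) powr (1 - s)"
        using mult_left_mono[of 1 "(1 - x) powr (1 - s)" "(1 - u) powr s"] by simp
      then have "h u \<le> ((2 - s) * u powr s + (1 - u) powr s * (1 - x) powr (1 - s) - 1) / (s * (s - 1))"
        using s1 by (auto simp: h_def intro!: divide_right_mono)
      moreover have "1 / s * l' powr s \<le> 1 / s * (u / F_dist s x) powr s"
        using r s1 l by (intro mult_left_mono powr_mono2) auto
      ultimately show ?thesis using K_gt1_eq[OF s1 x, of u] u0 by simp
    qed
    then show ?thesis using b(2)[of u] u0 u \<delta> by simp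
  qed
  then show ?thesis using \<delta> by blast
qed

section \<open>The divergence of negative order s = -r\<close>

lemma K_neg_eq:
  assumes "r > 0"
  shows "K (- r) u x = (x powr (1 + r) * u powr (- r) + (1 - x) powr (1 + r) * (1 - u) powr (- r) - 1) / (r * (1 + r))"
  using assms by (simp add: K_def divide_simps)

text \<open>From F^(-r) = 1 + r (x^(-1-r) - 1) the product x^(1+r) F^(-r) equals r + (1-r) x^(1+r).
  The coefficient of (F/u)^r in \<open>K\<close> therefore tends to r / (r (1+r)) = 1/(1+r) as x
  tends to 0.\<close>

lemma K_neg_eq':
  assumes "r > 0" "0 < x" "x < 1" "0 < u"
  shows "K (- r) u x = ((F_dist (- r) x / u) powr r * (r + (1 - r) * x powr (1 + r))
     + (1 - x) powr (1 + r) * (1 - u) powr (- r) - 1) / (r * (1 + r))"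
proof -
  define y where "y = F_dist (- r) x"
  have y: "y > 0" using F_dist_pos assms by (simp add: y_def)
  have "y powr (- r) = 1 + r * (x powr (- (1 + r)) - 1)"
    using F_dist_powr_neg(1)[of "- r" x] assms by (simp add: y_def minus_diff_commute)
  then have "x powr (1 + r) * y powr (- r) = x powr (1 + r) * (1 - r) + r * (x powr (1 + r) * x powr (- (1 + r)))"
    by (simp only:) (simp add: algebra_simps)
  also have "x powr (1 + r) * x powr (- (1 + r)) = 1"
    using assms by (simp add: powr_add[symmetric])
  finally have *: "x powr (1 + r) * y powr (- r) = r + (1 - r) * x powr (1 + r)" by simp
  have "u powr (- r) = (y / u) powr r * y powr (- r)"
    using y assms by (simp add: powr_divide powr_minus divide_simps)
  then have "x powr (1 + r) * u powr (- r) = (y / u) powr r * (x powr (1 + r) * y powr (- r))" by simp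
  then show ?thesis unfolding K_neg_eq[OF assms(1)] * by (simp add: y_def)
qed

text \<open>With rho = F/u, the term (1-r) x^(1+r) rho^r is at most x (x rho)^r and the right term
  at most 1 - x. Hence a correction appears only where x rho exceeds 1: a bounded rho excludes this
  near 0, and in the bulk rho is close to 1.\<close>

lemma K_neg_upper_left:
  assumes r: "r > 0" and x: "0 < x" "x < 1" and u: "0 < u" "u \<le> x"
  shows "K (- r) u x \<le> 1 / (1 + r) * (F_dist (- r) x / u) powr r
    + 1 / (r * (1 + r)) * max 0 ((x * F_dist (- r) x / u) powr r - 1)"
proof -
  define \<rho> where "\<rho> = F_dist (- r) x / u"
  have \<rho>: "\<rho> > 0" using F_dist_pos assms by (simp add: \<rho>_def)
  have "(1 - x) powr (1 + r) * (1 - u) powr (- r) = (1 - x) * ((1 - x) / (1 - u)) powr r"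
    using powr_split_ratio[of "1 - x" "1 - u" r] u x by simp
  also have "\<dots> \<le> (1 - x) * 1" using u x r by (intro mult_left_mono powr_le1) auto
  finally have 1: "(1 - x) powr (1 + r) * (1 - u) powr (- r) \<le> 1 - x" by simp
  have "\<rho> powr r * ((1 - r) * x powr (1 + r)) \<le> \<rho> powr r * (1 * x powr (1 + r))"
    using r by (intro mult_left_mono mult_right_mono) auto
  also have "\<dots> = x * (x * \<rho>) powr r" using x \<rho> by (simp add: powr_mult powr_add)
  finally have "\<rho> powr r * (r + (1 - r) * x powr (1 + r))
     + (1 - x) powr (1 + r) * (1 - u) powr (- r) - 1 \<le> r * \<rho> powr r + x * ((x * \<rho>) powr r - 1)"
    using 1 by (simp add: algebra_simps)
  also have "x * ((x * \<rho>) powr r - 1) \<le> x * max 0 ((x * \<rho>) powr r - 1)"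
    using x by (intro mult_left_mono) auto
  also have "\<dots> \<le> 1 * max 0 ((x * \<rho>) powr r - 1)"
    using x by (intro mult_right_mono) auto
  finally have "K (- r) u x \<le> (r * \<rho> powr r + max 0 ((x * \<rho>) powr r - 1)) / (r * (1 + r))"
    unfolding K_neg_eq'[OF r x u(1)] \<rho>_def using r by (intro divide_right_mono) auto
  also have "\<dots> = 1 / (1 + r) * \<rho> powr r + 1 / (r * (1 + r)) * max 0 ((x * \<rho>) powr r - 1)"
    using r by (simp add: add_divide_distrib)
  finally show ?thesis by (simp add: \<rho>_def)
qed

text \<open>Mirror image of \<open>K_upper_left\<close> with x and u exchanged; the prefactor that
  becomes small at the right end is now 1 - x.\<close>

lemma K_neg_upper_right:
  assumes r: "r > 0" and x: "0 < x" "x < u" "u < 1"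
  shows "K (- r) u x \<le> 1 / (r * (1 + r)) * ((1 - x) * (((1 - x) / (1 - u)) powr r - 1))"
proof -
  have "x powr (1 + r) * u powr (- r) = x * (x / u) powr r"
    using powr_split_ratio[of x u r] x by simp
  also have "\<dots> \<le> x * 1" using x r by (intro mult_left_mono powr_le1) auto
  finally have 1: "x powr (1 + r) * u powr (- r) \<le> x" by simp
  have "(1 - x) powr (1 + r) * (1 - u) powr (- r) = (1 - x) * ((1 - x) / (1 - u)) powr r"
    using powr_split_ratio[of "1 - x" "1 - u" r] x by simp
  then have "x powr (1 + r) * u powr (- r) + (1 - x) powr (1 + r) * (1 - u) powr (- r) - 1
     \<le> (1 - x) * (((1 - x) / (1 - u)) powr r - 1)" using 1 by (simp add: algebra_simps)
  then show ?thesis unfolding K_neg_eq[OF r] using r by (simp add: divide_right_mono)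
qed

lemma K_neg_lower:
  assumes r: "r > 0" and l: "0 < l" "l < l'"
  shows "\<exists>\<delta>>0. \<delta> < 1 \<and> (\<forall>x u. 0 < x \<and> x \<le> \<delta> \<and> 0 < u \<and> u < 1 \<and> l' * u \<le> F_dist (- r) x \<longrightarrow>
    1 / (1 + r) * l powr r < K (- r) u x)"
proof -
  \<comment> \<open>The absolute value makes \<open>h\<close> a lower bound of the coefficient r +
    (1-r) x^(1+r) for either sign of 1 - r. Positivity of \<open>h\<close> then allows (F/u)^r to be
    replaced by the smaller l'^r.\<close>
  define h where "h x = r - \<bar>1 - r\<bar> * x powr (1 + r)" for x :: real
  have z: "((\<lambda>x::real. x powr (1 + r)) \<longlongrightarrow> 0 powr (1 + r)) (at_right 0)"
    using r by (intro tendsto_intros) (auto intro: eventually_mono[OF eventually_at_right_less])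
  then have h: "(h \<longlongrightarrow> r) (at_right 0)" unfolding h_def[abs_def]
    by (rule tendsto_eq_rhs[OF tendsto_diff[OF tendsto_const tendsto_mult[OF tendsto_const]]]) simp
  then have 1: "\<forall>\<^sub>F x in at_right 0. 0 < h x" using r by (simp add: order_tendstoD)
  have "((\<lambda>x::real. (1 - x) powr (1 + r)) \<longlongrightarrow> (1 - 0) powr (1 + r)) (at_right 0)"
    by (intro tendsto_intros) auto
  then have "((\<lambda>x. l' powr r * h x + (1 - x) powr (1 + r) - 1) \<longlongrightarrow> l' powr r * r + 1 - 1) (at_right 0)"
    by (intro tendsto_intros h) simp
  moreover have "r * l powr r < l' powr r * r + 1 - 1"
    using r l by (simp add: powr_less_mono2)
  ultimately have "\<forall>\<^sub>F x in at_right 0. r * l powr r < l' powr r * h x + (1 - x) powr (1 + r) - 1"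
    by (rule order_tendstoD)
  from eventually_conj[OF 1 this]
  obtain b where b: "b > 0" "\<And>x. 0 < x \<Longrightarrow> x < b \<Longrightarrow> 0 < h x \<and>
     r * l powr r < l' powr r * h x + (1 - x) powr (1 + r) - 1"
    unfolding eventually_at_right_field by blast
  define \<delta> where "\<delta> = min (b / 2) (1 / 2)"
  have \<delta>: "0 < \<delta>" "\<delta> < 1" "\<delta> < b" using b by (auto simp: \<delta>_def)
  have "1 / (1 + r) * l powr r < K (- r) u x"
    if x: "0 < x" "x \<le> \<delta>" and u: "0 < u" "u < 1" and lu: "l' * u \<le> F_dist (- r) x" for x u
  proof -
    define \<rho> where "\<rho> = F_dist (- r) x / u"
    have \<rho>: "l' \<le> \<rho>" using lu u by (simp add: field_simps \<rho>_def)
    have hx: "0 < h x" "r * l powr r < l' powr r * h x + (1 - x) powr (1 + r) - 1"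
      using b(2)[of x] x \<delta> by auto
    have "l' powr r * h x \<le> \<rho> powr r * h x"
      using hx \<rho> r l by (intro mult_right_mono powr_mono2) auto
    also have "\<dots> \<le> \<rho> powr r * (r + (1 - r) * x powr (1 + r))"
    proof (intro mult_left_mono)
      have "- (\<bar>1 - r\<bar> * x powr (1 + r)) \<le> (1 - r) * x powr (1 + r)"
        by (metis abs_ge_minus_self minus_le_iff mult_minus_left mult_right_mono powr_ge_zero)
      then show "h x \<le> r + (1 - r) * x powr (1 + r)" by (simp add: h_def)
    qed simp
    finally have 2: "l' powr r * h x \<le> \<rho> powr r * (r + (1 - r) * x powr (1 + r))" .
    have "1 \<le> (1 - u) powr (- r)" using powr_mono'[of "- r" 0 "1 - u"] r u by simp
    then have "(1 - x) powr (1 + r) \<le> (1 - x) powr (1 + r) * (1 - u) powr (- r)"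
      using mult_left_mono[of 1 "(1 - u) powr (- r)" "(1 - x) powr (1 + r)"] by simp
    with 2 hx have "r * l powr r < \<rho> powr r * (r + (1 - r) * x powr (1 + r))
       + (1 - x) powr (1 + r) * (1 - u) powr (- r) - 1" by simp
    then have "r * l powr r / (r * (1 + r)) < (\<rho> powr r * (r + (1 - r) * x powr (1 + r))
       + (1 - x) powr (1 + r) * (1 - u) powr (- r) - 1) / (r * (1 + r))"
      using r by (intro divide_strict_right_mono) auto
    also have "\<dots> = K (- r) u x"
      using K_neg_eq'[OF r x(1) _ u(1)] x \<delta> by (simp add: \<rho>_def)
    finally have "r * l powr r / (r * (1 + r)) < K (- r) u x" .
    then show ?thesis using r by simp
  qed
  then show ?thesis using \<delta> by blast
qed

section \<open>Suprema of random families and convergence in distribution\<close>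

text \<open>The real supremum is defined from the set of upper bounds alone. This also covers empty
  and unbounded sets, where both sides are the same junk value.\<close>

lemma real_Sup_cong:
  fixes A B :: "real set"
  assumes "\<And>b. (\<forall>x\<in>A. x \<le> b) \<longleftrightarrow> (\<forall>x\<in>B. x \<le> b)"
  shows "Sup A = Sup B"
  unfolding Sup_real_def assms ..

text \<open>For unbounded or empty index sets the real supremum is a fixed junk constant, hence the
  case distinction; it keeps the supremum measurable everywhere, not just almost everywhere.\<close>
lemma borel_measurable_SUP_countable_dense:
  fixes f :: "'a \<Rightarrow> 'i \<Rightarrow> real"
  assumes R: "countable R"
    and D: "\<And>q. q \<in> R \<Longrightarrow> {\<omega>\<in>space M. D \<omega> q} \<in> sets M"
    and f: "\<And>q. q \<in> R \<Longrightarrow> (\<lambda>\<omega>. f \<omega> q) \<in> borel_measurable M"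
    and dense: "\<And>\<omega> x b. \<omega> \<in> space M \<Longrightarrow> D \<omega> x \<Longrightarrow> b < f \<omega> x \<Longrightarrow> \<exists>q\<in>R. D \<omega> q \<and> b < f \<omega> q"
  shows "(\<lambda>\<omega>. SUP x\<in>{x. D \<omega> x}. f \<omega> x) \<in> borel_measurable M"
proof -
  \<comment> \<open>The values of the supremum of an unbounded set, which has no upper bound, and of
    the empty set, of which every number is an upper bound.\<close>
  define c1 where "c1 = (LEAST z::real. False)"
  define c2 where "c2 = (LEAST z::real. True)"
  have le: "{\<omega>\<in>space M. \<forall>q\<in>R. D \<omega> q \<longrightarrow> f \<omega> q \<le> b} \<in> sets M" for b
  proof (rule sets.sets_Collect_countable_All'[OF _ R])
    fix q assume q: "q \<in> R"
    have "{\<omega>\<in>space M. f \<omega> q \<le> b} \<in> sets M"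
      using f[OF q] by (simp add: borel_measurable_iff_le)
    then show "{\<omega>\<in>space M. D \<omega> q \<longrightarrow> f \<omega> q \<le> b} \<in> sets M"
      using D[OF q] by (intro sets.sets_Collect_imp)
  qed
  define E where "E = {\<omega>\<in>space M. \<exists>k::nat. \<forall>q\<in>R. D \<omega> q \<longrightarrow> f \<omega> q \<le> real k}"
  define NE where "NE = {\<omega>\<in>space M. \<exists>q\<in>R. D \<omega> q}"
  have E: "E \<in> sets M" unfolding E_def by (intro sets.sets_Collect_countable_Ex le)
  have NE: "NE \<in> sets M" unfolding NE_def by (rule sets.sets_Collect_countable_Ex'[OF D R])
  have sub: "E \<subseteq> space M" "NE \<subseteq> space M" by (auto simp: E_def NE_def)
  have S: "(SUP x\<in>{x. D \<omega> x}. f \<omega> x) \<le> a \<longleftrightarrow>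
    (if \<omega> \<in> E then if \<omega> \<in> NE then (\<forall>q\<in>R. D \<omega> q \<longrightarrow> f \<omega> q \<le> a) else c2 \<le> a else c1 \<le> a)"
    if \<omega>: "\<omega> \<in> space M" for \<omega> a
  proof -
    let ?B = "f \<omega> ` {q\<in>R. D \<omega> q}"
    have "(SUP x\<in>{x. D \<omega> x}. f \<omega> x) = Sup ?B"
    proof (rule real_Sup_cong)
      fix b show "(\<forall>x\<in>f \<omega> ` {x. D \<omega> x}. x \<le> b) \<longleftrightarrow> (\<forall>x\<in>?B. x \<le> b)"
        using dense[OF \<omega>, of _ b] by (force simp: not_le[symmetric])
    qed
    also have "Sup ?B \<le> a \<longleftrightarrow>
      (if \<omega> \<in> E then if \<omega> \<in> NE then (\<forall>q\<in>R. D \<omega> q \<longrightarrow> f \<omega> q \<le> a) else c2 \<le> a else c1 \<le> a)"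
    proof (cases "\<omega> \<in> E")
      case True
      then obtain k where k: "\<forall>q\<in>R. D \<omega> q \<longrightarrow> f \<omega> q \<le> real k" by (auto simp: E_def)
      show ?thesis
      proof (cases "\<omega> \<in> NE")
        case ne: True
        have "?B \<noteq> {}" "bdd_above ?B" using ne k by (auto simp: NE_def bdd_above_def)
        then have "Sup ?B \<le> a \<longleftrightarrow> (\<forall>x\<in>?B. x \<le> a)" by (rule cSup_le_iff)
        then show ?thesis using True ne by auto
      next
        case False
        then have "?B = {}" using \<omega> by (auto simp: NE_def)
        then have "Sup ?B = c2" by (simp only: Sup_real_def c2_def) simp
        then show ?thesis using True False by simp
      qed
    next
      case False
      have "\<not> (\<forall>x\<in>?B. x \<le> z)" for z
      proof
        assume *: "\<forall>x\<in>?B. x \<le> z"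
        obtain k :: nat where "z \<le> real k" using real_arch_simple by blast
        then have "\<forall>q\<in>R. D \<omega> q \<longrightarrow> f \<omega> q \<le> real k" using * by fastforce
        then have "\<omega> \<in> E" using \<omega> by (auto simp: E_def)
        then show False using False by simp
      qed
      then have "Sup ?B = c1" by (simp only: Sup_real_def c1_def)
      then show ?thesis using False by simp
    qed
    finally show ?thesis .
  qed
  show ?thesis
  proof (rule borel_measurableI_le)
    fix a
    have "{\<omega>\<in>space M. (SUP x\<in>{x. D \<omega> x}. f \<omega> x) \<le> a} =
      (E \<inter> NE \<inter> {\<omega>\<in>space M. \<forall>q\<in>R. D \<omega> q \<longrightarrow> f \<omega> q \<le> a}) \<union>
      (if c2 \<le> a then E - NE else {}) \<union> (if c1 \<le> a then space M - E else {})"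
    proof (rule set_eqI)
      fix \<omega> show "\<omega> \<in> {\<omega>\<in>space M. (SUP x\<in>{x. D \<omega> x}. f \<omega> x) \<le> a} \<longleftrightarrow> \<omega> \<in> (E \<inter> NE \<inter> {\<omega>\<in>space M. \<forall>q\<in>R. D \<omega> q \<longrightarrow> f \<omega> q \<le> a}) \<union>
        (if c2 \<le> a then E - NE else {}) \<union> (if c1 \<le> a then space M - E else {})"
      proof (cases "\<omega> \<in> space M")
        case True
        then show ?thesis using S[of \<omega> a] by (cases "\<omega> \<in> E"; cases "\<omega> \<in> NE") simp_all
      qed (use sub in auto)
    qed
    also have "\<dots> \<in> sets M" using E NE le[of a] by (auto intro!: sets.Un sets.Int sets.Diff)
    finally show "{\<omega>\<in>space M. (SUP x\<in>{x. D \<omega> x}. f \<omega> x) \<le> a} \<in> sets M" .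
  qed
qed

section \<open>Convergence in distribution from probabilities of approximating events\<close>

lemma (in prob_space) prob_le_right_cont:
  assumes V: "V \<in> borel_measurable M" and e: "e > 0"
  shows "\<exists>x'>x. prob {\<omega>\<in>space M. V \<omega> \<le> x'} \<le> prob {\<omega>\<in>space M. V \<omega> \<le> (x::real)} + e"
proof -
  interpret D: real_distribution "distr M borel V" using V by (rule real_distribution_distr)
  have c: "cdf (distr M borel V) y = prob {\<omega>\<in>space M. V \<omega> \<le> y}" for y
    unfolding cdf_def using V by (subst measure_distr) (auto intro!: arg_cong[where f = prob])
  have "(cdf (distr M borel V) \<longlongrightarrow> cdf (distr M borel V) x) (at_right x)"
    using D.cdf_is_right_cont[of x] by (simp add: continuous_within)
  from order_tendstoD(2)[OF this, of "cdf (distr M borel V) x + e"] e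
  obtain b where "b > x" "\<And>y. x < y \<Longrightarrow> y < b \<Longrightarrow> cdf (distr M borel V) y < cdf (distr M borel V) x + e"
    by (auto simp: eventually_at_right_field)
  then have "x < (x + b) / 2" "cdf (distr M borel V) ((x + b) / 2) < cdf (distr M borel V) x + e" by auto
  then show ?thesis unfolding c by (blast intro: less_imp_le)
qed

lemma (in prob_space) prob_less_left_limit:
  assumes V: "V \<in> borel_measurable M" and e: "e > 0"
  shows "\<exists>x'<x. prob {\<omega>\<in>space M. V \<omega> < (x::real)} - e \<le> prob {\<omega>\<in>space M. V \<omega> \<le> x'}"
proof -
  interpret D: real_distribution "distr M borel V" using V by (rule real_distribution_distr)
  have c: "cdf (distr M borel V) y = prob {\<omega>\<in>space M. V \<omega> \<le> y}" for y
    unfolding cdf_def using V by (subst measure_distr) (auto intro!: arg_cong[where f = prob])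
  have l: "measure (distr M borel V) {..<x} = prob {\<omega>\<in>space M. V \<omega> < x}"
    using V by (subst measure_distr) (auto intro!: arg_cong[where f = prob])
  have "(cdf (distr M borel V) \<longlongrightarrow> prob {\<omega>\<in>space M. V \<omega> < x}) (at_left x)"
    using D.cdf_at_left[of x] by (simp add: l)
  from order_tendstoD(1)[OF this, of "prob {\<omega>\<in>space M. V \<omega> < x} - e"] e
  obtain b where "b < x" "\<And>y. b < y \<Longrightarrow> y < x \<Longrightarrow> prob {\<omega>\<in>space M. V \<omega> < x} - e < cdf (distr M borel V) y"
    by (auto simp: eventually_at_left_field)
  then have "(x + b) / 2 < x" "prob {\<omega>\<in>space M. V \<omega> < x} - e < cdf (distr M borel V) ((x + b) / 2)" by auto
  then show ?thesis unfolding c by (blast intro: less_imp_le)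
qed

text \<open>The lower estimate only reaches the strict event V < l; at a continuity point of the
  limit law the event V = l is null, so both bounds meet. For l <= 1 the strict event is null as
  well, so \<open>lower\<close> is asked for only above 1, exactly where values of the statistic up
  to \<open>c\<close> are harmless.\<close>

lemma converges_in_dist_powr:
  fixes Y :: "nat \<Rightarrow> 'a \<Rightarrow> real" and V :: "'b \<Rightarrow> real"
  assumes M: "prob_space M" and P: "prob_space P"
    and Y: "\<And>n. Y n \<in> borel_measurable M" and V: "V \<in> borel_measurable P"
    and c: "c > 0" and \<alpha>: "\<alpha> > 0"
    and upper: "\<And>l e. 0 < l \<Longrightarrow> 0 < e \<Longrightarrow> \<forall>\<^sub>F n in sequentially.
      measure M {\<omega>\<in>space M. Y n \<omega> \<le> c * l powr \<alpha>} \<le> measure P {\<omega>\<in>space P. V \<omega> \<le> l} + e"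
    and lower: "\<And>l e. 1 < l \<Longrightarrow> 0 < e \<Longrightarrow> \<forall>\<^sub>F n in sequentially.
      measure P {\<omega>\<in>space P. V \<omega> < l} - e \<le> measure M {\<omega>\<in>space M. Y n \<omega> \<le> c * l powr \<alpha>}"
    and V1: "measure P {\<omega>\<in>space P. V \<omega> < 1} = 0"
  shows "converges_in_dist M Y P (\<lambda>\<omega>. c * V \<omega> powr \<alpha>)"
proof -
  interpret M: prob_space M by fact
  interpret P: prob_space P by fact
  let ?Z = "\<lambda>\<omega>. c * V \<omega> powr \<alpha>"
  have Z: "?Z \<in> borel_measurable P" using V by measurable
  note [measurable] = Y V Z
  have AEV: "AE \<omega> in P. V \<omega> \<ge> 1"
  proof -
    have "AE \<omega> in P. \<omega> \<notin> {\<omega>\<in>space P. V \<omega> < 1}"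
      using V1 by (intro AE_not_in) (auto simp: null_sets_def P.emeasure_eq_measure)
    then show ?thesis using AE_space by eventually_elim auto
  qed
  have cY: "cdf (distr M borel (Y n)) z = measure M {\<omega>\<in>space M. Y n \<omega> \<le> z}" for n z
    unfolding cdf_def by (subst measure_distr) (auto intro!: arg_cong[where f = "measure M"])
  have cZ: "cdf (distr P borel ?Z) z = measure P {\<omega>\<in>space P. ?Z \<omega> \<le> z}" for z
    unfolding cdf_def by (subst measure_distr) (auto intro!: arg_cong[where f = "measure P"])
  have "(\<lambda>n. measure M {\<omega>\<in>space M. Y n \<omega> \<le> z}) \<longlonglongrightarrow> measure P {\<omega>\<in>space P. ?Z \<omega> \<le> z}"
    if cont: "isCont (cdf (distr P borel ?Z)) z" for z
  proof (cases "z \<le> 0")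
    case True
    have "measure P {\<omega>\<in>space P. ?Z \<omega> \<le> z} = measure P {}"
    proof (rule P.finite_measure_eq_AE)
      show "AE \<omega> in P. \<omega> \<in> {\<omega>\<in>space P. ?Z \<omega> \<le> z} \<longleftrightarrow> \<omega> \<in> {}"
        using AEV
      proof eventually_elim
        case (elim \<omega>)
        have "?Z \<omega> > 0" using elim c by simp
        then show ?case using True by simp
      qed
    qed auto
    moreover have "(\<lambda>n. measure M {\<omega>\<in>space M. Y n \<omega> \<le> z}) \<longlonglongrightarrow> 0"
    proof (rule tendstoI)
      fix e :: real assume e: "e > 0"
      \<comment> \<open>A nonpositive z is not of the form \<open>c * l powr \<alpha>\<close> with l
        > 0; a fixed level below 1, here 1/2, bounds the probability from above.\<close>
      have "measure P {\<omega>\<in>space P. V \<omega> \<le> 1 / 2} \<le> measure P {\<omega>\<in>space P. V \<omega> < 1}"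
        by (intro P.finite_measure_mono) auto
      then have "measure P {\<omega>\<in>space P. V \<omega> \<le> 1 / 2} = 0" using V1 by (simp add: measure_le_0_iff)
      with upper[of "1 / 2" "e / 2"] e
      have "\<forall>\<^sub>F n in sequentially. measure M {\<omega>\<in>space M. Y n \<omega> \<le> c * (1 / 2) powr \<alpha>} \<le> e / 2" by simp
      then show "\<forall>\<^sub>F n in sequentially. dist (measure M {\<omega>\<in>space M. Y n \<omega> \<le> z}) 0 < e"
      proof eventually_elim
        case (elim n)
        have "0 \<le> c * (1 / 2) powr \<alpha>" using c by simp
        then have "measure M {\<omega>\<in>space M. Y n \<omega> \<le> z} \<le> measure M {\<omega>\<in>space M. Y n \<omega> \<le> c * (1 / 2) powr \<alpha>}"
          using True by (intro M.finite_measure_mono) auto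
        then show ?case using elim e by simp
      qed
    qed
    ultimately show ?thesis by simp
  next
    case False
    define l where "l = (z / c) powr (1 / \<alpha>)"
    have l: "l > 0" and gl: "c * l powr \<alpha> = z" using False c \<alpha> by (auto simp: l_def powr_powr)
    have *: "?Z \<omega> \<le> z \<longleftrightarrow> V \<omega> \<le> l" "?Z \<omega> = z \<longleftrightarrow> V \<omega> = l" if "V \<omega> \<ge> 1" for \<omega>
    proof -
      have "V \<omega> powr \<alpha> \<le> l powr \<alpha> \<longleftrightarrow> V \<omega> \<le> l" "V \<omega> powr \<alpha> = l powr \<alpha> \<longleftrightarrow> V \<omega> = l"
        using that l \<alpha> powr_less_mono2[of \<alpha> l "V \<omega>"] powr_less_mono2[of \<alpha> "V \<omega>" l]
        by (smt (verit))+
      then show "?Z \<omega> \<le> z \<longleftrightarrow> V \<omega> \<le> l" "?Z \<omega> = z \<longleftrightarrow> V \<omega> = l" using c unfolding gl[symmetric] by auto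
    qed
    have Zl: "measure P {\<omega>\<in>space P. ?Z \<omega> \<le> z} = measure P {\<omega>\<in>space P. V \<omega> \<le> l}"
    proof (rule P.finite_measure_eq_AE)
      show "AE \<omega> in P. \<omega> \<in> {\<omega>\<in>space P. ?Z \<omega> \<le> z} \<longleftrightarrow> \<omega> \<in> {\<omega>\<in>space P. V \<omega> \<le> l}"
        using AEV by eventually_elim (auto simp: *)
    qed measurable
    interpret D: real_distribution "distr P borel ?Z" using Z by (rule P.real_distribution_distr)
    have "measure (distr P borel ?Z) {z} = 0" using cont D.isCont_cdf by simp
    then have "measure P {\<omega>\<in>space P. ?Z \<omega> = z} = 0"
      by (subst (asm) measure_distr) (auto simp: vimage_def Int_def conj_commute)
    also have "measure P {\<omega>\<in>space P. ?Z \<omega> = z} = measure P {\<omega>\<in>space P. V \<omega> = l}"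
    proof (rule P.finite_measure_eq_AE)
      show "AE \<omega> in P. \<omega> \<in> {\<omega>\<in>space P. ?Z \<omega> = z} \<longleftrightarrow> \<omega> \<in> {\<omega>\<in>space P. V \<omega> = l}"
        using AEV by eventually_elim (auto simp: *)
    qed measurable
    finally have eq0: "measure P {\<omega>\<in>space P. V \<omega> = l} = 0" .
    have "measure P {\<omega>\<in>space P. V \<omega> \<le> l} = measure P ({\<omega>\<in>space P. V \<omega> < l} \<union> {\<omega>\<in>space P. V \<omega> = l})"
      by (auto intro!: arg_cong[where f = "measure P"])
    also have "\<dots> = measure P {\<omega>\<in>space P. V \<omega> < l} + measure P {\<omega>\<in>space P. V \<omega> = l}"
      by (intro P.finite_measure_Union) (measurable, auto)
    finally have less: "measure P {\<omega>\<in>space P. V \<omega> \<le> l} = measure P {\<omega>\<in>space P. V \<omega> < l}" using eq0 by simp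
    have lo: "\<forall>\<^sub>F n in sequentially. measure P {\<omega>\<in>space P. V \<omega> < l} - e \<le> measure M {\<omega>\<in>space M. Y n \<omega> \<le> z}"
      if e: "e > 0" for e
    proof (cases "l > 1")
      case True then show ?thesis using lower[OF True e] gl by simp
    next
      case False
      have "measure P {\<omega>\<in>space P. V \<omega> < l} \<le> measure P {\<omega>\<in>space P. V \<omega> < 1}"
        using False by (intro P.finite_measure_mono) auto
      then have "measure P {\<omega>\<in>space P. V \<omega> < l} - e \<le> measure M {\<omega>\<in>space M. Y n \<omega> \<le> z}" for n
        using V1 e measure_nonneg[of M "{\<omega>\<in>space M. Y n \<omega> \<le> z}"] by linarith
      then show ?thesis by simp
    qed
    show ?thesis unfolding Zl
    proof (rule tendstoI)
      fix e :: real assume e: "e > 0"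
      then have e2: "e / 2 > 0" by simp
      show "\<forall>\<^sub>F n in sequentially. dist (measure M {\<omega>\<in>space M. Y n \<omega> \<le> z}) (measure P {\<omega>\<in>space P. V \<omega> \<le> l}) < e"
        using upper[OF l e2, unfolded gl] lo[OF e2]
      proof eventually_elim
        case (elim n)
        then show ?case using e less unfolding dist_real_def by linarith
      qed
    qed
  qed
  then show ?thesis unfolding converges_in_dist_def weak_conv_m_def weak_conv_def cY cZ
    using Y Z by auto
qed

text \<open>Sandwich: up to a null set, V < l implies all the events \<open>E l m\<close>, and these
  together imply V <= l. In \<open>upper\<close> the index m is arbitrary, since a small statistic
  implies every finite part of the grid event; in \<open>lower\<close> it depends on e, since the
  part beyond m is discarded at a cost in probability. The gaps between l and l' are paid for by
  one-sided continuity of the law of V.\<close>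

lemma converges_in_dist_of_events:
  fixes Y :: "nat \<Rightarrow> 'a \<Rightarrow> real" and V :: "'b \<Rightarrow> real"
  assumes M: "prob_space M" and P: "prob_space P"
    and Y: "\<And>n. Y n \<in> borel_measurable M" and V: "V \<in> borel_measurable P"
    and c: "c > 0" and \<alpha>: "\<alpha> > 0"
    and E: "\<And>l m. l > 0 \<Longrightarrow> E l m \<in> sets P" and dec: "\<And>l m. E l (Suc m) \<subseteq> E l m"
    and sub: "\<And>l \<omega>. l > 0 \<Longrightarrow> \<omega> \<in> space P \<Longrightarrow> (\<And>m. \<omega> \<in> E l m) \<Longrightarrow> V \<omega> \<le> l"
    and sup: "AE \<omega> in P. \<forall>l l' m. 0 < l \<longrightarrow> l < l' \<longrightarrow> V \<omega> \<le> l \<longrightarrow> \<omega> \<in> E l' m"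
    and lim: "\<And>l m. l > 0 \<Longrightarrow> (\<lambda>n. measure M (En l m n)) \<longlonglongrightarrow> measure P (E l m)"
    and upper: "\<And>l l' m e. 0 < l \<Longrightarrow> l < l' \<Longrightarrow> 0 < e \<Longrightarrow> \<forall>\<^sub>F n in sequentially.
      measure M {\<omega>\<in>space M. Y n \<omega> \<le> c * l powr \<alpha>} \<le> measure M (En l' m n) + e"
    and lower: "\<And>l l' e. 1 < l' \<Longrightarrow> l' < l \<Longrightarrow> 0 < e \<Longrightarrow> \<exists>m. \<forall>\<^sub>F n in sequentially.
      measure M (En l' m n) - e \<le> measure M {\<omega>\<in>space M. Y n \<omega> \<le> c * l powr \<alpha>}"
    and null: "\<And>l. 0 < l \<Longrightarrow> l < 1 \<Longrightarrow> measure P (\<Inter>m. E l m) = 0"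
  shows "converges_in_dist M Y P (\<lambda>\<omega>. c * V \<omega> powr \<alpha>)"
proof (rule converges_in_dist_powr[OF M P Y V c \<alpha>])
  interpret M: prob_space M by fact
  interpret P: prob_space P by fact
  note [measurable] = V
  \<comment> \<open>\<open>null\<close> speaks of one level at a time; countably many levels
    increasing to 1 yield a single null set.\<close>
  define L where "L j = 1 - 1 / (real j + 2)" for j :: nat
  have L: "1 / 2 \<le> L j" "L j < 1" for j by (auto simp: L_def field_simps)
  have "AE \<omega> in P. \<omega> \<notin> (\<Inter>m. E (L j) m)" for j
    using null[of "L j"] L[of j] E[of "L j"]
    by (intro AE_not_in) (auto simp: null_sets_def P.emeasure_eq_measure intro!: sets.countable_INT)
  then have "AE \<omega> in P. \<forall>j. \<omega> \<notin> (\<Inter>m. E (L j) m)" by (simp add: AE_all_countable)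
  then have "AE \<omega> in P. \<omega> \<notin> {\<omega>\<in>space P. V \<omega> < 1}"
    using sup
  proof eventually_elim
    case (elim \<omega>)
    show ?case
    proof
      assume "\<omega> \<in> {\<omega>\<in>space P. V \<omega> < 1}"
      then have V: "V \<omega> < 1" by simp
      have "L \<longlonglongrightarrow> 1" unfolding L_def by real_asymp
      from order_tendstoD(1)[OF this V] obtain j where "V \<omega> < L j" by (auto simp: eventually_sequentially)
      \<comment> \<open>\<open>sup\<close> asks for a positive level, whereas V may be nonpositive
        here; 1/4 lies below every \<open>L j\<close>.\<close>
      then have "0 < max (V \<omega>) (1 / 4)" "max (V \<omega>) (1 / 4) < L j" "V \<omega> \<le> max (V \<omega>) (1 / 4)"
        using L[of j] by auto
      then have "\<omega> \<in> E (L j) m" for m using elim(2) by blast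
      then show False using elim(1) by blast
    qed
  qed
  then show "measure P {\<omega>\<in>space P. V \<omega> < 1} = 0"
    by (subst (asm) AE_iff_measurable[where N = "{\<omega>\<in>space P. V \<omega> < 1}"]) (auto simp: measure_def)
next
  interpret M: prob_space M by fact
  interpret P: prob_space P by fact
  note [measurable] = V
  fix l e :: real assume e: "0 < e"
  { assume l: "0 < l"
    obtain l' where l': "l' > l" "measure P {\<omega>\<in>space P. V \<omega> \<le> l'} \<le> measure P {\<omega>\<in>space P. V \<omega> \<le> l} + e / 4"
      using P.prob_le_right_cont[OF V, of "e / 4" l] e by auto
    have l'0: "l' > 0" using l l' by simp
    have "(\<lambda>m. measure P (E l' m)) \<longlonglongrightarrow> measure P (\<Inter>m. E l' m)"
      using E[OF l'0] dec by (intro P.finite_Lim_measure_decseq decseq_SucI) auto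
    from order_tendstoD(2)[OF this, of "measure P (\<Inter>m. E l' m) + e / 4"] e
    obtain m where m: "measure P (E l' m) < measure P (\<Inter>m. E l' m) + e / 4"
      by (auto simp: eventually_sequentially)
    have "\<omega> \<in> {\<omega>\<in>space P. V \<omega> \<le> l'}" if *: "\<omega> \<in> (\<Inter>m. E l' m)" for \<omega>
    proof -
      have "\<omega> \<in> space P" using * sets.sets_into_space[OF E[OF l'0, of 0]] by auto
      then show ?thesis using sub[OF l'0, of \<omega>] * by auto
    qed
    then have "measure P (\<Inter>m. E l' m) \<le> measure P {\<omega>\<in>space P. V \<omega> \<le> l'}"
      by (intro P.finite_measure_mono subsetI) (blast, measurable)
    then have mm: "measure P (E l' m) < measure P {\<omega>\<in>space P. V \<omega> \<le> l} + e / 2" using m l' by simp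
    have "\<forall>\<^sub>F n in sequentially. measure M (En l' m n) < measure P {\<omega>\<in>space P. V \<omega> \<le> l} + e / 2"
      by (rule order_tendstoD(2)[OF lim[OF l'0] mm])
    moreover have "\<forall>\<^sub>F n in sequentially.
      measure M {\<omega>\<in>space M. Y n \<omega> \<le> c * l powr \<alpha>} \<le> measure M (En l' m n) + e / 2"
      using upper[OF l l'(1), of "e / 2"] e by simp
    ultimately show "\<forall>\<^sub>F n in sequentially.
      measure M {\<omega>\<in>space M. Y n \<omega> \<le> c * l powr \<alpha>} \<le> measure P {\<omega>\<in>space P. V \<omega> \<le> l} + e"
      by eventually_elim simp }
  { assume l: "1 < l"
    obtain x where x: "x < l" "measure P {\<omega>\<in>space P. V \<omega> < l} - e / 3 \<le> measure P {\<omega>\<in>space P. V \<omega> \<le> x}"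
      using P.prob_less_left_limit[OF V, of "e / 3" l] e by auto
    \<comment> \<open>\<open>lower\<close> concerns levels above 1 only, so l' is placed strictly
      between this maximum and l.\<close>
    define x' where "x' = max 1 x"
    define l' where "l' = (x' + l) / 2"
    have l': "0 < x'" "x' < l'" "1 < l'" "l' < l" using l x by (auto simp: x'_def l'_def)
    obtain m where m: "\<forall>\<^sub>F n in sequentially.
      measure M (En l' m n) - e / 3 \<le> measure M {\<omega>\<in>space M. Y n \<omega> \<le> c * l powr \<alpha>}"
      using lower[OF l'(3,4), of "e / 3"] e by auto
    have "measure P {\<omega>\<in>space P. V \<omega> \<le> x} \<le> measure P (E l' m)"
    proof (rule P.finite_measure_mono_AE)
      show "AE \<omega> in P. \<omega> \<in> {\<omega>\<in>space P. V \<omega> \<le> x} \<longrightarrow> \<omega> \<in> E l' m"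
        using sup
      proof eventually_elim
        case (elim \<omega>)
        then show ?case using l' by (auto simp: x'_def)
      qed
    qed (use E l' in auto)
    then have "measure P {\<omega>\<in>space P. V \<omega> < l} - 2 * e / 3 < measure P (E l' m)" using x e by simp
    then have "\<forall>\<^sub>F n in sequentially. measure P {\<omega>\<in>space P. V \<omega> < l} - 2 * e / 3 < measure M (En l' m n)"
      using l' by (intro order_tendstoD(1)[OF lim]) auto
    then show "\<forall>\<^sub>F n in sequentially.
      measure P {\<omega>\<in>space P. V \<omega> < l} - e \<le> measure M {\<omega>\<in>space M. Y n \<omega> \<le> c * l powr \<alpha>}"
      using m by eventually_elim simp }
qed

section \<open>Empirical counts of a uniform sample\<close>

text \<open>Kept as a natural number and for arbitrary sets: vectors of cell counts then take
  countably many values, and counts compare directly with grid indices.\<close>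

definition cnt :: "(nat \<Rightarrow> 'a \<Rightarrow> real) \<Rightarrow> nat \<Rightarrow> real set \<Rightarrow> 'a \<Rightarrow> nat" where
  "cnt Y n A \<omega> = card {i \<in> {1..n}. Y i \<omega> \<in> A}"

lemma cnt_mono: "A \<subseteq> B \<Longrightarrow> cnt Y n A \<omega> \<le> cnt Y n B \<omega>"
  unfolding cnt_def by (intro card_mono) auto

lemma cnt_le: "cnt Y n A \<omega> \<le> n"
proof -
  have "card {i \<in> {1..n}. Y i \<omega> \<in> A} \<le> card {1..n}" by (intro card_mono) auto
  then show ?thesis by (simp add: cnt_def)
qed

lemma cnt_eq_n: "(\<And>i. 1 \<le> i \<Longrightarrow> i \<le> n \<Longrightarrow> Y i \<omega> \<in> A) \<Longrightarrow> cnt Y n A \<omega> = n"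
proof -
  assume "\<And>i. 1 \<le> i \<Longrightarrow> i \<le> n \<Longrightarrow> Y i \<omega> \<in> A"
  then have "{i \<in> {1..n}. Y i \<omega> \<in> A} = {1..n}" by auto
  then show ?thesis by (simp add: cnt_def)
qed

lemma cnt_Suc: "cnt Y (Suc n) A \<omega> = cnt Y n A \<omega> + (if Y (Suc n) \<omega> \<in> A then 1 else 0)"
proof -
  have "{i \<in> {1..Suc n}. Y i \<omega> \<in> A} =
     (if Y (Suc n) \<omega> \<in> A then insert (Suc n) {i \<in> {1..n}. Y i \<omega> \<in> A} else {i \<in> {1..n}. Y i \<omega> \<in> A})"
    by (auto simp: le_Suc_eq)
  then show ?thesis by (auto simp: cnt_def)
qed

lemma cnt_0 [simp]: "cnt Y 0 A \<omega> = 0" by (simp add: cnt_def)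

lemma cnt_Un: "A \<inter> B = {} \<Longrightarrow> cnt Y n (A \<union> B) \<omega> = cnt Y n A \<omega> + cnt Y n B \<omega>"
  by (induction n) (auto simp: cnt_Suc)

lemma cnt_UN:
  "finite L \<Longrightarrow> disjoint_family_on I L \<Longrightarrow> cnt Y n (\<Union>l\<in>L. I l) \<omega> = (\<Sum>l\<in>L. cnt Y n (I l) \<omega>)"
proof (induction L rule: finite_induct)
  case (insert l L)
  have "I l \<inter> (\<Union>l\<in>L. I l) = {}" using insert by (auto simp: disjoint_family_on_def)
  moreover have "disjoint_family_on I L"
    using insert.prems by (rule disjoint_family_on_mono[rotated]) auto
  ultimately show ?case using insert.hyps insert.IH cnt_Un[of "I l" "\<Union>l\<in>L. I l" Y n \<omega>] by simp
qed (simp add: cnt_def)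

lemma measurable_cnt:
  assumes "\<And>i. i \<in> {1..n} \<Longrightarrow> Y i \<in> borel_measurable M" "A \<in> sets borel"
  shows "cnt Y n A \<in> measurable M (count_space UNIV)"
  using assms(1)
proof (induction n)
  case 0
  have "cnt Y 0 A = (\<lambda>_. 0)" by (rule ext) simp
  then show ?case by (simp only:) simp
next
  case (Suc n)
  have eq: "cnt Y (Suc n) A = (\<lambda>\<omega>. if Y (Suc n) \<omega> \<in> A then Suc (cnt Y n A \<omega>) else cnt Y n A \<omega>)"
    by (rule ext) (simp add: cnt_Suc)
  have c: "cnt Y n A \<in> measurable M (count_space UNIV)"
    by (rule Suc.IH) (rule Suc.prems, simp)
  have y: "Y (Suc n) \<in> borel_measurable M" by (rule Suc.prems) simp
  show ?case unfolding eq
  proof (intro measurable_If c)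
    show "(\<lambda>\<omega>. Suc (cnt Y n A \<omega>)) \<in> measurable M (count_space UNIV)"
      by (rule measurable_compose[OF c]) simp
    show "{\<omega> \<in> space M. Y (Suc n) \<omega> \<in> A} \<in> sets M"
      using measurable_sets[OF y assms(2)] by (simp add: vimage_def Int_def conj_commute)
  qed
qed

lemma prod_power_cnt: "(\<Prod>i\<in>{1..n}. if Y i \<omega> \<in> A then z else 1) = (z::real) ^ cnt Y n A \<omega>"
  by (induction n) (auto simp: cnt_Suc)

text \<open>\<open>chernoff_rate q ^ k\<close> is the Chernoff bound for a count with mean \<open>k q\<close> to reach \<open>k\<close>,
  at the optimal parameter \<open>1 / q\<close>; it serves both tails, \<open>q < 1\<close> and \<open>q > 1\<close>.\<close>
definition chernoff_rate :: "real \<Rightarrow> real" where "chernoff_rate q = q * exp (1 - q)"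

lemma chernoff_rate_pos: "q > 0 \<Longrightarrow> chernoff_rate q > 0"
  by (simp add: chernoff_rate_def)

lemma chernoff_rate_less_1:
  assumes "q > 0" "q \<noteq> 1" shows "chernoff_rate q < 1"
proof -
  have "ln q < q - 1" using ln_le_minus_one[of q] ln_eq_minus_one[of q] assms by force
  then have "exp (ln q + (1 - q)) < exp 0" unfolding exp_less_cancel_iff by simp
  then show ?thesis using assms by (simp add: chernoff_rate_def exp_add)
qed

section \<open>Exponential tail bounds for a uniform sample\<close>

lemma (in prob_space) prob_ex_le_geometric:
  assumes r: "0 \<le> r" "r < 1"
    and E: "\<And>k. k \<ge> m \<Longrightarrow> {\<omega>\<in>space M. E k \<omega>} \<in> events"
    and le: "\<And>k. k \<ge> m \<Longrightarrow> prob {\<omega>\<in>space M. E k \<omega>} \<le> r ^ k"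
  shows "prob {\<omega>\<in>space M. \<exists>k\<ge>m. E k \<omega>} \<le> r ^ m / (1 - r)"
proof -
  have s: "(\<lambda>k. r ^ (k + m)) sums (r ^ m / (1 - r))"
    using sums_mult[OF geometric_sums[of r], of "r ^ m"] r by (simp add: power_add mult.commute)
  have le': "prob {\<omega>\<in>space M. E (k + m) \<omega>} \<le> r ^ (k + m)" for k by (rule le) simp
  have sm: "summable (\<lambda>k. prob {\<omega>\<in>space M. E (k + m) \<omega>})"
    by (rule summable_comparison_test'[OF sums_summable[OF s], of 0]) (use le' in auto)
  have "{\<omega>\<in>space M. \<exists>k\<ge>m. E k \<omega>} = (\<Union>k. {\<omega>\<in>space M. E (k + m) \<omega>})"
    by (auto, metis le_add_diff_inverse2, metis le_add2)
  then have "prob {\<omega>\<in>space M. \<exists>k\<ge>m. E k \<omega>} = prob (\<Union>k. {\<omega>\<in>space M. E (k + m) \<omega>})" by simp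
  also have "\<dots> \<le> (\<Sum>k. prob {\<omega>\<in>space M. E (k + m) \<omega>})"
    using sm E by (intro finite_measure_subadditive_countably) auto
  also have "\<dots> \<le> (\<Sum>k. r ^ (k + m))" using sm s le' by (intro suminf_le) (auto dest: sums_summable)
  finally show ?thesis using sums_unique[OF s] by simp
qed

text \<open>\<open>range\<close> is a pointwise condition, which \<open>F_dist\<close> grants
  everywhere. All n observations are then counted at every level from 1 on, and cells exhausting
  \<open>{..1}\<close> contain each of them.\<close>

locale uniform_sample = prob_space M for M :: "'a measure" +
  fixes Y :: "nat \<Rightarrow> 'a \<Rightarrow> real"
  assumes indep: "indep_vars (\<lambda>_. borel) Y {1..}"
    and unif: "\<And>i y. 1 \<le> i \<Longrightarrow> 0 \<le> y \<Longrightarrow> y \<le> 1 \<Longrightarrow> prob {\<omega>\<in>space M. Y i \<omega> \<le> y} = y"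
    and range: "\<And>i \<omega>. 1 \<le> i \<Longrightarrow> \<omega> \<in> space M \<Longrightarrow> Y i \<omega> \<in> {0..1}"
begin

lemma meas [measurable]: "1 \<le> i \<Longrightarrow> Y i \<in> borel_measurable M"
  using indep by (auto simp: indep_vars_def)

lemma meas_cnt: "A \<in> sets borel \<Longrightarrow> cnt Y n A \<in> measurable M (count_space UNIV)"
  by (intro measurable_cnt) auto

lemma meas_cnt' [measurable]: "cnt Y n {..a} \<in> measurable M (count_space UNIV)"
  by (intro meas_cnt) auto

text \<open>Generating function of the binomial law: the power is a product of independent factors,
  each equal to z with probability y and to 1 otherwise.\<close>

lemma expectation_power_cnt:
  assumes y: "0 \<le> y" "y \<le> 1" and z: "z > 0"
  shows "integrable M (\<lambda>\<omega>. z ^ cnt Y n {..y} \<omega>)"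
    "expectation (\<lambda>\<omega>. z ^ cnt Y n {..y} \<omega>) = (1 + y * (z - 1)) ^ n"
proof -
  define X where "X i \<omega> = (if Y i \<omega> \<in> {..y} then z else 1)" for i \<omega>
  have ind: "indep_vars (\<lambda>_. borel) X {1..n}"
  proof -
    have "indep_vars (\<lambda>_. borel) Y {1..n}" by (rule indep_vars_subset[OF indep]) auto
    then show ?thesis unfolding X_def[abs_def]
      by (rule indep_vars_compose2[where Y = "\<lambda>_ v. if v \<in> {..y} then z else 1" and N = "\<lambda>_. borel"]) measurable
  qed
  have X: "has_bochner_integral M (X i) (1 + y * (z - 1))" if "i \<in> {1..n}" for i
  proof -
    have [measurable]: "Y i \<in> borel_measurable M" using that by simp
    have m: "{\<omega>\<in>space M. Y i \<omega> \<le> y} \<in> events" by measurable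
    have "integrable M (indicator {\<omega>\<in>space M. Y i \<omega> \<le> y} :: 'a \<Rightarrow> real)"
      using m by (intro integrable_real_indicator) (auto simp: emeasure_eq_measure)
    then have "has_bochner_integral M (\<lambda>\<omega>. 1 + indicator {\<omega>\<in>space M. Y i \<omega> \<le> y} \<omega> * (z - 1))
       (1 + y * (z - 1))"
      using unif[of i y] y that m by (simp add: has_bochner_integral_iff prob_space)
    moreover have "has_bochner_integral M (X i) (1 + y * (z - 1)) \<longleftrightarrow>
      has_bochner_integral M (\<lambda>\<omega>. 1 + indicator {\<omega>\<in>space M. Y i \<omega> \<le> y} \<omega> * (z - 1)) (1 + y * (z - 1))"
      by (intro has_bochner_integral_cong) (auto simp: X_def)
    ultimately show ?thesis by simp
  qed
  have *: "(\<Prod>i\<in>{1..n}. X i \<omega>) = z ^ cnt Y n {..y} \<omega>" for \<omega>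
    unfolding X_def by (rule prod_power_cnt)
  show "integrable M (\<lambda>\<omega>. z ^ cnt Y n {..y} \<omega>)"
    using indep_vars_integrable[OF _ ind] X unfolding * by (auto simp: has_bochner_integral_iff)
  have "expectation (\<lambda>\<omega>. z ^ cnt Y n {..y} \<omega>) = (\<Prod>i\<in>{1..n}. expectation (X i))"
    using indep_vars_lebesgue_integral[OF _ ind] X unfolding * by (auto simp: has_bochner_integral_iff)
  also have "\<dots> = (\<Prod>i\<in>{1..n}. 1 + y * (z - 1))"
    using X by (intro prod.cong refl) (auto simp: has_bochner_integral_iff)
  finally show "expectation (\<lambda>\<omega>. z ^ cnt Y n {..y} \<omega>) = (1 + y * (z - 1)) ^ n" by simp
qed

text \<open>Markov's inequality for (1/q)^count, with 1 + v <= exp v making the bound uniform in n.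
  The event is stated with powers so that it means count >= k for q < 1 and count <= k for q >
  1.\<close>

lemma chernoff:
  assumes q: "q > 0" and n: "n \<ge> 1" and k: "real k * q \<le> real n"
  shows "prob {\<omega>\<in>space M. (1 / q) ^ k \<le> (1 / q) ^ cnt Y n {..real k * q / n} \<omega>} \<le> chernoff_rate q ^ k"
proof -
  define y where "y = real k * q / n"
  have y: "0 \<le> y" "y \<le> 1" using assms by (auto simp: y_def divide_simps)
  have "prob {\<omega>\<in>space M. (1 / q) ^ k \<le> (1 / q) ^ cnt Y n {..y} \<omega>} \<le>
     expectation (\<lambda>\<omega>. (1 / q) ^ cnt Y n {..y} \<omega>) / (1 / q) ^ k"
    using q y by (intro integral_Markov_inequality_measure[where A = "{}"] expectation_power_cnt) auto
  also have "\<dots> = (1 + y * (1 / q - 1)) ^ n * q ^ k"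
    using q y by (subst expectation_power_cnt) (auto simp: power_divide)
  also have "\<dots> \<le> exp (y * (1 / q - 1)) ^ n * q ^ k"
  proof (intro mult_right_mono power_mono)
    have "1 + y * (1 / q - 1) = (1 - y) + y / q" by (simp add: algebra_simps)
    moreover have "0 \<le> y / q" using y q by simp
    ultimately show "0 \<le> 1 + y * (1 / q - 1)" using y by linarith
  qed (use q exp_ge_add_one_self in auto)
  also have "exp (y * (1 / q - 1)) ^ n = exp (real n * (y * (1 / q - 1)))"
    by (simp add: exp_of_nat_mult)
  also have "real n * (y * (1 / q - 1)) = real k * (1 - q)"
    using n q by (simp add: y_def field_simps)
  also have "exp (real k * (1 - q)) * q ^ k = chernoff_rate q ^ k"
    by (simp add: chernoff_rate_def power_mult_distrib exp_of_nat_mult)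
  finally show ?thesis by (simp add: y_def)
qed

lemma prob_cnt_ge:
  assumes q: "0 < q" "q < 1" and n: "n \<ge> 1"
  shows "prob {\<omega>\<in>space M. k \<le> cnt Y n {..real k * q / n} \<omega>} \<le> chernoff_rate q ^ k"
proof (cases "real k * q \<le> real n")
  case True
  have "prob {\<omega>\<in>space M. k \<le> cnt Y n {..real k * q / n} \<omega>} \<le>
      prob {\<omega>\<in>space M. (1 / q) ^ k \<le> (1 / q) ^ cnt Y n {..real k * q / n} \<omega>}"
    using q by (intro finite_measure_mono) (auto intro!: power_increasing)
  with chernoff[OF q(1) n True] show ?thesis by simp
next
  case False
  then have "k > n" using q n mult_left_le[of q "real k"] by linarith
  then have "\<not> k \<le> cnt Y n {..real k * q / n} \<omega>" for \<omega>
    using cnt_le[of Y n "{..real k * q / n}" \<omega>] by linarith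
  then have *: "{\<omega>\<in>space M. k \<le> cnt Y n {..real k * q / n} \<omega>} = {}" by simp
  show ?thesis unfolding * using q chernoff_rate_pos[of q] by simp
qed

lemma prob_cnt_le:
  assumes q: "1 < q" and n: "k < n"
  shows "prob {\<omega>\<in>space M. cnt Y n {..real k * q / n} \<omega> \<le> k} \<le> chernoff_rate q ^ k"
proof (cases "real k * q \<le> real n")
  case True
  have "prob {\<omega>\<in>space M. cnt Y n {..real k * q / n} \<omega> \<le> k} \<le>
      prob {\<omega>\<in>space M. (1 / q) ^ k \<le> (1 / q) ^ cnt Y n {..real k * q / n} \<omega>}"
    using q by (intro finite_measure_mono) (auto intro!: power_decreasing)
  also have "\<dots> \<le> chernoff_rate q ^ k" using chernoff[of q n k] True n q by simp
  finally show ?thesis .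
next
  case False
  \<comment> \<open>At a level of at least 1 every observation is counted, and \<open>k < n\<close>
    makes the event empty.\<close>
  then have "1 \<le> real k * q / n" using n by (simp add: field_simps)
  then have "cnt Y n {..real k * q / n} \<omega> = n" if "\<omega> \<in> space M" for \<omega>
    using range[OF _ that] by (intro cnt_eq_n) (meson atLeastAtMost_iff atMost_iff order_trans)
  then have *: "{\<omega>\<in>space M. cnt Y n {..real k * q / n} \<omega> \<le> k} = {}" using n by auto
  show ?thesis unfolding * using q chernoff_rate_pos[of q] by simp
qed

lemma prob_upper_tail:
  assumes q: "0 < q" "q < 1" and n: "n \<ge> 1"
  shows "prob {\<omega>\<in>space M. \<exists>k\<ge>m. k \<le> cnt Y n {..real k * q / n} \<omega>}
    \<le> chernoff_rate q ^ m / (1 - chernoff_rate q)"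
  using q n chernoff_rate_pos[of q] chernoff_rate_less_1[of q] prob_cnt_ge[OF q n]
  by (intro prob_ex_le_geometric) auto

lemma prob_lower_tail:
  assumes q: "1 < q"
  shows "prob {\<omega>\<in>space M. \<exists>k\<ge>m. k < n \<and> cnt Y n {..real k * q / n} \<omega> \<le> k}
    \<le> chernoff_rate q ^ m / (1 - chernoff_rate q)"
proof (rule prob_ex_le_geometric)
  show "prob {\<omega>\<in>space M. k < n \<and> cnt Y n {..real k * q / n} \<omega> \<le> k} \<le> chernoff_rate q ^ k" for k
    using prob_cnt_le[OF q, of k n] chernoff_rate_pos[of q] q by (cases "k < n") auto
qed (use q chernoff_rate_pos[of q] chernoff_rate_less_1[of q] in auto)

lemma prob_less:
  assumes "1 \<le> i" "0 \<le> y" "y \<le> 1"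
  shows "prob {\<omega>\<in>space M. Y i \<omega> < y} = y"
proof (rule antisym)
  have [measurable]: "Y i \<in> borel_measurable M" using assms by simp
  have "prob {\<omega>\<in>space M. Y i \<omega> < y} \<le> prob {\<omega>\<in>space M. Y i \<omega> \<le> y}"
    by (intro finite_measure_mono) auto
  then show "prob {\<omega>\<in>space M. Y i \<omega> < y} \<le> y" using unif[of i y] assms by simp
  show "y \<le> prob {\<omega>\<in>space M. Y i \<omega> < y}"
  proof (rule dense_le)
    fix z assume z: "z < y"
    show "z \<le> prob {\<omega>\<in>space M. Y i \<omega> < y}"
    proof (cases "0 \<le> z")
      case True
      have "z = prob {\<omega>\<in>space M. Y i \<omega> \<le> z}" using unif[of i z] assms z True by simp
      also have "\<dots> \<le> prob {\<omega>\<in>space M. Y i \<omega> < y}"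
        using z by (intro finite_measure_mono) auto
      finally show ?thesis .
    next
      case False
      then show ?thesis using measure_nonneg[of M "{\<omega>\<in>space M. Y i \<omega> < y}"] by linarith
    qed
  qed
qed

text \<open>Transfers every estimate at the left end of the sample to the right end. Complementation
  produces a strict event, which \<open>prob_less\<close> evaluates.\<close>

lemma reflect: "uniform_sample M (\<lambda>i \<omega>. 1 - Y i \<omega>)"
proof
  show "indep_vars (\<lambda>_. borel) (\<lambda>i \<omega>. 1 - Y i \<omega>) {1..}"
    by (rule indep_vars_compose2[OF indep, where Y = "\<lambda>_ v. 1 - v" and N = "\<lambda>_. borel"]) measurable
  show "1 - Y i \<omega> \<in> {0..1}" if "1 \<le> i" "\<omega> \<in> space M" for i \<omega>
    using range[OF that] by auto
  show "prob {\<omega>\<in>space M. 1 - Y i \<omega> \<le> y} = y" if "1 \<le> i" "0 \<le> y" "y \<le> 1" for i y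
  proof -
    have [measurable]: "Y i \<in> borel_measurable M" using that by simp
    have "{\<omega>\<in>space M. 1 - Y i \<omega> \<le> y} = space M - {\<omega>\<in>space M. Y i \<omega> < 1 - y}" by auto
    then show ?thesis using prob_compl[of "{\<omega>\<in>space M. Y i \<omega> < 1 - y}"] prob_less[of i "1 - y"] that by simp
  qed
qed

lemma prob_interval:
  assumes "1 \<le> i" "0 \<le> a" "a \<le> b" "b \<le> 1"
  shows "prob {\<omega>\<in>space M. Y i \<omega> \<in> {a<..b}} = b - a"
proof -
  have [measurable]: "Y i \<in> borel_measurable M" using assms by simp
  have eq: "{\<omega>\<in>space M. Y i \<omega> \<in> {a<..b}} = {\<omega>\<in>space M. Y i \<omega> \<le> b} - {\<omega>\<in>space M. Y i \<omega> \<le> a}"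
    by auto
  have "prob {\<omega>\<in>space M. Y i \<omega> \<in> {a<..b}} = prob {\<omega>\<in>space M. Y i \<omega> \<le> b} - prob {\<omega>\<in>space M. Y i \<omega> \<le> a}"
    unfolding eq by (rule finite_measure_Diff) (use assms in auto)
  then show ?thesis using unif[of i] assms by simp
qed

lemma AE_in_open: "AE \<omega> in M. \<forall>i\<ge>1. 0 < Y i \<omega> \<and> Y i \<omega> < 1"
proof -
  have "AE \<omega> in M. i \<ge> 1 \<longrightarrow> 0 < Y i \<omega> \<and> Y i \<omega> < 1" for i
  proof (cases "i \<ge> 1")
    case True
    have [measurable]: "Y i \<in> borel_measurable M" using True by simp
    have "AE \<omega> in M. \<omega> \<in> {\<omega>\<in>space M. Y i \<omega> < 1}"
      by (intro AE_prob_1) (use prob_less[of i 1] True in simp)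
    moreover have "AE \<omega> in M. \<omega> \<notin> {\<omega>\<in>space M. Y i \<omega> \<le> 0}"
      using unif[of i 0] True by (intro AE_not_in) (auto simp: null_sets_def emeasure_eq_measure)
    ultimately show ?thesis by eventually_elim auto
  qed simp
  then have "AE \<omega> in M. \<forall>i. i \<ge> 1 \<longrightarrow> 0 < Y i \<omega> \<and> Y i \<omega> < 1" by (simp add: AE_all_countable)
  then show ?thesis by eventually_elim auto
qed

end

text \<open>Simplification with the measurability simproc diverges on the counting events below.\<close>
declare [[simproc del: measurable]]

section \<open>Laws of integer vectors and their convergence\<close>

lemma sets_Collect_coordinates:
  fixes D :: "'a \<Rightarrow> nat \<Rightarrow> nat"
  assumes D: "\<And>l. l < m \<Longrightarrow> (\<lambda>\<omega>. D \<omega> l) \<in> measurable M (count_space UNIV)"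
    and Phi: "\<forall>f g. (\<forall>l<m. f l = g l) \<longrightarrow> Phi f = Phi g"
  shows "{\<omega>\<in>space M. Phi (D \<omega>)} \<in> sets M"
proof -
  have 1: "{\<omega>\<in>space M. \<forall>l<m. D \<omega> l = j l} \<in> sets M" for j
  proof -
    have "{\<omega>\<in>space M. D \<omega> l = j l} \<in> sets M" if "l < m" for l
      using measurable_sets[OF D[OF that], of "{j l}"] by (simp add: vimage_def Int_def conj_commute)
    then have "{\<omega>\<in>space M. \<forall>l\<in>{..<m}. D \<omega> l = j l} \<in> sets M"
      by (intro sets.sets_Collect_finite_All) auto
    then show ?thesis unfolding Ball_def lessThan_iff .
  qed
  \<comment> \<open>Functions that are undefined outside \<open>{..<m}\<close> are countable in
    number, and \<open>Phi\<close> does not distinguish a vector from its restriction.\<close>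
  define J where "J = {j \<in> PiE {..<m} (\<lambda>_. UNIV). Phi j}"
  have "countable J" unfolding J_def
    by (rule countable_subset[OF Collect_restrict]) (rule countable_PiE, simp, simp)
  moreover have "{\<omega>\<in>space M. Phi (D \<omega>)} = (\<Union>j\<in>J. {\<omega>\<in>space M. \<forall>l<m. D \<omega> l = j l})"
  proof (intro equalityI subsetI)
    fix \<omega> assume \<omega>: "\<omega> \<in> {\<omega>\<in>space M. Phi (D \<omega>)}"
    then have "Phi (restrict (D \<omega>) {..<m})" using Phi[rule_format, of "D \<omega>" "restrict (D \<omega>) {..<m}"] by simp
    then have "restrict (D \<omega>) {..<m} \<in> J" unfolding J_def using \<omega> by (simp add: PiE_iff)
    then show "\<omega> \<in> (\<Union>j\<in>J. {\<omega>\<in>space M. \<forall>l<m. D \<omega> l = j l})"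
      by (rule UN_I) (use \<omega> in simp)
  next
    fix \<omega> assume "\<omega> \<in> (\<Union>j\<in>J. {\<omega>\<in>space M. \<forall>l<m. D \<omega> l = j l})"
    then obtain j where "j \<in> J" "\<omega> \<in> space M" "\<forall>l<m. D \<omega> l = j l" by auto
    moreover have "Phi (D \<omega>)"
      using Phi[rule_format, of j "D \<omega>"] \<open>j \<in> J\<close> \<open>\<forall>l<m. D \<omega> l = j l\<close> by (simp add: J_def)
    ultimately show "\<omega> \<in> {\<omega>\<in>space M. Phi (D \<omega>)}" by simp
  qed
  ultimately show ?thesis using sets.countable_UN''[of J "\<lambda>j. {\<omega>\<in>space M. \<forall>l<m. D \<omega> l = j l}" M, OF _ 1] by simp
qed

lemma (in prob_space) prob_Collect_box:
  fixes D :: "'a \<Rightarrow> nat \<Rightarrow> nat"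
  assumes D: "\<And>l. l < m \<Longrightarrow> (\<lambda>\<omega>. D \<omega> l) \<in> measurable M (count_space UNIV)"
    and Phi: "\<forall>f g. (\<forall>l<m. f l = g l) \<longrightarrow> Phi f = Phi g"
  shows "prob {\<omega>\<in>space M. Phi (D \<omega>) \<and> (\<forall>l<m. D \<omega> l \<le> b)} =
    (\<Sum>j\<in>{j \<in> PiE {..<m} (\<lambda>_. {..b}). Phi j}. prob {\<omega>\<in>space M. \<forall>l<m. D \<omega> l = j l})"
proof -
  define J where "J = {j \<in> PiE {..<m} (\<lambda>_. {..b}). Phi j}"
  have fin: "finite J" unfolding J_def
    by (rule finite_subset[OF Collect_restrict]) (rule finite_PiE, simp, simp)
  have "{\<omega>\<in>space M. Phi (D \<omega>) \<and> (\<forall>l<m. D \<omega> l \<le> b)} = (\<Union>j\<in>J. {\<omega>\<in>space M. \<forall>l<m. D \<omega> l = j l})"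
  proof (intro equalityI subsetI)
    fix \<omega> assume \<omega>: "\<omega> \<in> {\<omega>\<in>space M. Phi (D \<omega>) \<and> (\<forall>l<m. D \<omega> l \<le> b)}"
    then have "Phi (restrict (D \<omega>) {..<m})" using Phi[rule_format, of "D \<omega>" "restrict (D \<omega>) {..<m}"] by simp
    then have "restrict (D \<omega>) {..<m} \<in> J" unfolding J_def using \<omega> by (simp add: PiE_iff)
    then show "\<omega> \<in> (\<Union>j\<in>J. {\<omega>\<in>space M. \<forall>l<m. D \<omega> l = j l})"
      by (rule UN_I) (use \<omega> in simp)
  next
    fix \<omega> assume "\<omega> \<in> (\<Union>j\<in>J. {\<omega>\<in>space M. \<forall>l<m. D \<omega> l = j l})"
    then obtain j where j: "j \<in> J" "\<omega> \<in> space M" "\<forall>l<m. D \<omega> l = j l" by auto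
    have "Phi (D \<omega>)" using Phi[rule_format, of j "D \<omega>"] j by (simp add: J_def)
    moreover have "D \<omega> l \<le> b" if "l < m" for l using j that PiE_mem[of j "{..<m}" "\<lambda>_. {..b}" l] by (simp add: J_def)
    ultimately show "\<omega> \<in> {\<omega>\<in>space M. Phi (D \<omega>) \<and> (\<forall>l<m. D \<omega> l \<le> b)}" using j by simp
  qed
  moreover have disj: "disjoint_family_on (\<lambda>j. {\<omega>\<in>space M. \<forall>l<m. D \<omega> l = j l}) J"
  proof -
    have "j = j'" if "j \<in> J" "j' \<in> J" "\<forall>l<m. D \<omega> l = j l" "\<forall>l<m. D \<omega> l = j' l" for j j' \<omega>
      using that unfolding J_def by (intro PiE_ext[of j "{..<m}" "\<lambda>_. {..b}" j']) auto
    then show ?thesis by (auto simp: disjoint_family_on_def)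
  qed
  moreover have "{\<omega>\<in>space M. \<forall>l<m. D \<omega> l = j l} \<in> events" for j
    by (rule sets_Collect_coordinates[where D = D and Phi = "\<lambda>f. \<forall>l<m. f l = j l", OF D]) auto
  then have "(\<lambda>j. {\<omega>\<in>space M. \<forall>l<m. D \<omega> l = j l}) ` J \<subseteq> events" by auto
  from finite_measure_finite_Union[OF fin this disj] calculation(1) show ?thesis
    by (simp add: J_def)
qed

text \<open>No mass escapes: a finite box carries almost all of the limit law, and convergence
  inside it shows that it eventually carries almost all of the approximating laws too. Within the
  box any event is a finite sum of point probabilities.\<close>

lemma coordinates_convergence:
  fixes D :: "nat \<Rightarrow> 'a \<Rightarrow> nat \<Rightarrow> nat" and E :: "'b \<Rightarrow> nat \<Rightarrow> nat"
  assumes M: "prob_space M" and P: "prob_space P"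
    and D: "\<And>n l. l < m \<Longrightarrow> (\<lambda>\<omega>. D n \<omega> l) \<in> measurable M (count_space UNIV)"
    and E: "\<And>l. l < m \<Longrightarrow> (\<lambda>\<omega>. E \<omega> l) \<in> measurable P (count_space UNIV)"
    and lim: "\<And>j. (\<lambda>n. measure M {\<omega>\<in>space M. \<forall>l<m. D n \<omega> l = j l}) \<longlonglongrightarrow>
      measure P {\<omega>\<in>space P. \<forall>l<m. E \<omega> l = j l}"
    and Phi: "\<forall>f g. (\<forall>l<m. f l = g l) \<longrightarrow> Phi f = Phi g"
  shows "(\<lambda>n. measure M {\<omega>\<in>space M. Phi (D n \<omega>)}) \<longlonglongrightarrow> measure P {\<omega>\<in>space P. Phi (E \<omega>)}"
proof -
  interpret M: prob_space M by fact
  interpret P: prob_space P by fact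
  have box: "(\<lambda>n. measure M {\<omega>\<in>space M. Q (D n \<omega>) \<and> (\<forall>l<m. D n \<omega> l \<le> b)}) \<longlonglongrightarrow>
      measure P {\<omega>\<in>space P. Q (E \<omega>) \<and> (\<forall>l<m. E \<omega> l \<le> b)}"
    if Q: "\<forall>f g. (\<forall>l<m. f l = g l) \<longrightarrow> Q f = Q g" for Q b
  proof -
    have 1: "measure M {\<omega>\<in>space M. Q (D n \<omega>) \<and> (\<forall>l<m. D n \<omega> l \<le> b)} =
      (\<Sum>j\<in>{j \<in> PiE {..<m} (\<lambda>_. {..b}). Q j}. measure M {\<omega>\<in>space M. \<forall>l<m. D n \<omega> l = j l})" for n
      by (rule M.prob_Collect_box[where D = "D n" and Phi = Q, OF D Q])
    have 2: "measure P {\<omega>\<in>space P. Q (E \<omega>) \<and> (\<forall>l<m. E \<omega> l \<le> b)} =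
      (\<Sum>j\<in>{j \<in> PiE {..<m} (\<lambda>_. {..b}). Q j}. measure P {\<omega>\<in>space P. \<forall>l<m. E \<omega> l = j l})"
      by (rule P.prob_Collect_box[where D = E and Phi = Q, OF E Q])
    show ?thesis unfolding 1 2 by (intro tendsto_sum lim)
  qed
  have top: "(\<lambda>b. measure P {\<omega>\<in>space P. \<forall>l<m. E \<omega> l \<le> b}) \<longlonglongrightarrow> 1"
  proof -
    have "(\<lambda>b. measure P {\<omega>\<in>space P. \<forall>l<m. E \<omega> l \<le> b}) \<longlonglongrightarrow>
        measure P (\<Union>b. {\<omega>\<in>space P. \<forall>l<m. E \<omega> l \<le> b})"
    proof (rule P.finite_Lim_measure_incseq)
      have "{\<omega>\<in>space P. \<forall>l<m. E \<omega> l \<le> b} \<in> P.events" for b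
        by (rule sets_Collect_coordinates[where D = E and Phi = "\<lambda>f. \<forall>l<m. f l \<le> b", OF E]) auto
      then show "range (\<lambda>b. {\<omega>\<in>space P. \<forall>l<m. E \<omega> l \<le> b}) \<subseteq> P.events" by auto
      show "incseq (\<lambda>b. {\<omega>\<in>space P. \<forall>l<m. E \<omega> l \<le> b})"
        by (auto simp: incseq_def intro: order_trans)
    qed
    also have "(\<Union>b. {\<omega>\<in>space P. \<forall>l<m. E \<omega> l \<le> b}) = space P"
    proof -
      have "\<exists>b. \<forall>l<m. E \<omega> l \<le> b" for \<omega>
        by (rule exI[of _ "\<Sum>l<m. E \<omega> l"]) (auto intro: member_le_sum)
      then show ?thesis by auto
    qed
    finally show ?thesis by (simp add: P.prob_space)
  qed
  show ?thesis
  proof (rule LIMSEQ_I)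
    fix e :: real assume e: "e > 0"
    from order_tendstoD(1)[OF top, of "1 - e / 3"] e
    obtain b where b: "measure P {\<omega>\<in>space P. \<forall>l<m. E \<omega> l \<le> b} > 1 - e / 3"
      by (auto simp: eventually_sequentially)
    let ?BM = "\<lambda>n. {\<omega>\<in>space M. \<forall>l<m. D n \<omega> l \<le> b}" and ?BP = "{\<omega>\<in>space P. \<forall>l<m. E \<omega> l \<le> b}"
    let ?A = "\<lambda>n. {\<omega>\<in>space M. Phi (D n \<omega>)}" and ?A' = "{\<omega>\<in>space P. Phi (E \<omega>)}"
    let ?C = "\<lambda>n. {\<omega>\<in>space M. Phi (D n \<omega>) \<and> (\<forall>l<m. D n \<omega> l \<le> b)}"
    let ?C' = "{\<omega>\<in>space P. Phi (E \<omega>) \<and> (\<forall>l<m. E \<omega> l \<le> b)}"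
    have "(\<lambda>n. measure M (?BM n)) \<longlonglongrightarrow> measure P ?BP"
      using box[of "\<lambda>_. True" b] by simp
    then have 1: "\<forall>\<^sub>F n in sequentially. measure M (?BM n) > 1 - e / 3"
      using b by (rule order_tendstoD)
    have 2: "\<forall>\<^sub>F n in sequentially. dist (measure M (?C n)) (measure P ?C') < e / 3"
      using tendstoD[OF box[of Phi b, OF Phi], of "e / 3"] e by simp
    have Phi': "\<forall>f g. (\<forall>l<m. f l = g l) \<longrightarrow> (Phi f \<and> (\<forall>l<m. f l \<le> b)) = (Phi g \<and> (\<forall>l<m. g l \<le> b))"
    proof (intro allI impI)
      fix f g :: "nat \<Rightarrow> nat" assume "\<forall>l<m. f l = g l"
      then show "(Phi f \<and> (\<forall>l<m. f l \<le> b)) = (Phi g \<and> (\<forall>l<m. g l \<le> b))"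
        using Phi[rule_format, of f g] by auto
    qed
    have Q': "\<forall>f g. (\<forall>l<m. f l = g l) \<longrightarrow> (\<forall>l<m. f l \<le> b) = (\<forall>l<m. g l \<le> b)" by auto
    note ev = sets_Collect_coordinates[where D = "D n" and Phi = "\<lambda>f. \<forall>l<m. f l \<le> b" for n, OF D Q']
        sets_Collect_coordinates[where D = "D n" and Phi = Phi for n, OF D Phi]
        sets_Collect_coordinates[where D = "D n" and Phi = "\<lambda>f. Phi f \<and> (\<forall>l<m. f l \<le> b)" for n, OF D Phi']
    note ev' = sets_Collect_coordinates[where D = E and Phi = "\<lambda>f. \<forall>l<m. f l \<le> b", OF E Q']
        sets_Collect_coordinates[where D = E and Phi = Phi, OF E Phi]
        sets_Collect_coordinates[where D = E and Phi = "\<lambda>f. Phi f \<and> (\<forall>l<m. f l \<le> b)", OF E Phi']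
    have "\<forall>\<^sub>F n in sequentially. norm (measure M (?A n) - measure P ?A') < e"
      using 1 2
    proof eventually_elim
      case (elim n)
      have "measure M (?A n) \<le> measure M (?C n \<union> (space M - ?BM n))"
        by (rule M.finite_measure_mono) (blast, rule sets.Un[OF ev(3) sets.compl_sets[OF ev(1)]])
      also have "\<dots> \<le> measure M (?C n) + (1 - measure M (?BM n))"
        using measure_Un_le[OF ev(3)[of n] sets.compl_sets[OF ev(1)[of n]]] M.prob_compl[OF ev(1)[of n]]
        by linarith
      finally have a: "measure M (?A n) \<le> measure M (?C n) + (1 - measure M (?BM n))" .
      have a': "measure M (?C n) \<le> measure M (?A n)"
        by (rule M.finite_measure_mono[OF _ ev(2)]) blast
      have "measure P ?A' \<le> measure P (?C' \<union> (space P - ?BP))"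
        by (rule P.finite_measure_mono) (blast, rule sets.Un[OF ev'(3) sets.compl_sets[OF ev'(1)]])
      also have "\<dots> \<le> measure P ?C' + (1 - measure P ?BP)"
        using measure_Un_le[OF ev'(3) sets.compl_sets[OF ev'(1)]] P.prob_compl[OF ev'(1)]
        by linarith
      finally have c: "measure P ?A' \<le> measure P ?C' + (1 - measure P ?BP)" .
      have c': "measure P ?C' \<le> measure P ?A'"
        by (rule P.finite_measure_mono[OF _ ev'(2)]) blast
      show ?case using elim a a' b c c' unfolding dist_real_def real_norm_def by linarith
    qed
    then show "\<exists>no. \<forall>n\<ge>no. norm (measure M (?A n) - measure P ?A') < e"
      by (simp add: eventually_sequentially)
  qed
qed

section \<open>Multinomial law of the cell counts\<close>

context uniform_sample
begin

lemma prob_cnt_indep_last: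
  fixes I :: "nat \<Rightarrow> real set"
  assumes I: "\<And>l. I l \<in> sets borel" and J: "J \<in> sets borel"
  shows "prob {\<omega>\<in>space M. (\<forall>l<m. cnt Y n (I l) \<omega> = j l) \<and> Y (Suc n) \<omega> \<in> J} =
    prob {\<omega>\<in>space M. \<forall>l<m. cnt Y n (I l) \<omega> = j l} * prob {\<omega>\<in>space M. Y (Suc n) \<omega> \<in> J}"
proof -
  let ?N = "PiM {1..n} (\<lambda>_. borel :: real measure)" and ?N' = "PiM {Suc n} (\<lambda>_. borel :: real measure)"
  let ?R = "\<lambda>\<omega>. restrict (\<lambda>i. Y i \<omega>) {1..n}" and ?R' = "\<lambda>\<omega>. restrict (\<lambda>i. Y i \<omega>) {Suc n}"
  have ind: "indep_var ?N ?R ?N' ?R'"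
    by (rule indep_var_restrict[OF indep]) auto
  \<comment> \<open>The counts of the first n observations are re-expressed on the coordinate
    projections, hence as functions of the restricted vector, which is independent of observation n
    + 1.\<close>
  let ?A = "{f\<in>space ?N. \<forall>l\<in>{..<m}. cnt (\<lambda>i f. f i) n (I l) f = j l}" and ?B = "{f\<in>space ?N'. f (Suc n) \<in> J}"
  have "{f\<in>space ?N. cnt (\<lambda>i f. f i) n (I l) f = j l} \<in> sets ?N" for l
  proof -
    have "cnt (\<lambda>i f. f i) n (I l) \<in> measurable ?N (count_space UNIV)"
      by (rule measurable_cnt) (rule measurable_component_singleton, assumption, rule I)
    from measurable_sets[OF this, of "{j l}"] show ?thesis
      by (simp add: vimage_def Int_def conj_commute)
  qed
  then have A: "?A \<in> sets ?N" by (intro sets.sets_Collect_finite_All) auto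
  have B: "?B \<in> sets ?N'"
    using measurable_sets[OF measurable_component_singleton[of "Suc n" "{Suc n}" "\<lambda>_. borel :: real measure"] J]
    by (simp add: vimage_def Int_def conj_commute)
  have r: "cnt (\<lambda>i f. f i) n S (?R \<omega>) = cnt Y n S \<omega>" for S \<omega>
    unfolding cnt_def by (rule arg_cong[where f = card]) auto
  have 1: "(\<lambda>x. (?R x, ?R' x)) -` (?A \<times> ?B) \<inter> space M =
      {\<omega>\<in>space M. (\<forall>l<m. cnt Y n (I l) \<omega> = j l) \<and> Y (Suc n) \<omega> \<in> J}"
    by (auto simp: r space_PiM simp del: One_nat_def)
  have 2: "?R -` ?A \<inter> space M = {\<omega>\<in>space M. \<forall>l<m. cnt Y n (I l) \<omega> = j l}"
    by (auto simp: r space_PiM simp del: One_nat_def)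
  have 3: "?R' -` ?B \<inter> space M = {\<omega>\<in>space M. Y (Suc n) \<omega> \<in> J}"
    by (auto simp: space_PiM)
  show ?thesis using indep_varD[OF ind A B] unfolding 1 2 3 .
qed

text \<open>Induction on n, conditioning on the cell of the last observation; the coefficients
  combine by Pascal's rule. The multinomial coefficient is split into the falling factorial of n and
  the reciprocal factorials: this form vanishes by itself when the counts exceed n, and it converges
  factor by factor to Poisson weights.\<close>

lemma multinomial:
  assumes I: "\<And>l. I l \<in> sets borel" and disj: "disjoint_family_on I {..<m}"
    and p: "\<And>i l. i \<ge> 1 \<Longrightarrow> l < m \<Longrightarrow> prob {\<omega>\<in>space M. Y i \<omega> \<in> I l} = p"
  shows "prob {\<omega>\<in>space M. \<forall>l<m. cnt Y n (I l) \<omega> = j l} =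
    (\<Prod>l<m. p ^ j l / fact (j l)) * (fact (\<Sum>l<m. j l) * real (n choose (\<Sum>l<m. j l))) *
    (1 - real m * p) ^ (n - (\<Sum>l<m. j l))"
proof (induction n arbitrary: j)
  case 0
  show ?case
  proof (cases "\<forall>l<m. j l = 0")
    case True
    then show ?thesis by (simp add: prob_space)
  next
    case False
    then obtain l where l: "l < m" "j l > 0" by auto
    then have "(\<Sum>l<m. j l) > 0" using member_le_sum[of l "{..<m}" j] by simp
    then have 1: "0 choose (\<Sum>l<m. j l) = 0" by (simp add: binomial_eq_0)
    have 2: "{\<omega>\<in>space M. \<forall>l<m. cnt Y 0 (I l) \<omega> = j l} = {}" using False by auto
    show ?thesis unfolding 1 2 by simp
  qed
next
  case (Suc n)
  define k where "k = (\<Sum>l<m. j l)"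
  define w where "w = (\<Prod>l<m. p ^ j l / fact (j l))"
  \<comment> \<open>The cells that can hold the last observation. \<open>A l\<close> says that cell
    l does, \<open>B\<close> that none of the m cells does.\<close>
  define L where "L = {l\<in>{..<m}. j l > 0}"
  define A where "A l = {\<omega>\<in>space M. (\<forall>l'<m. cnt Y n (I l') \<omega> = (j(l := j l - 1)) l') \<and> Y (Suc n) \<omega> \<in> I l}" for l
  define U where "U = (\<Union>l<m. I l)"
  define B where "B = {\<omega>\<in>space M. (\<forall>l<m. cnt Y n (I l) \<omega> = j l) \<and> Y (Suc n) \<omega> \<in> - U}"
  have U: "U \<in> sets borel" unfolding U_def by (rule sets.finite_UN[OF finite_lessThan I])
  have Ys: "{\<omega>\<in>space M. Y (Suc n) \<omega> \<in> S} \<in> events" if "S \<in> sets borel" for S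
  proof -
    have "Y (Suc n) -` S \<inter> space M = {\<omega>\<in>space M. Y (Suc n) \<omega> \<in> S}" by auto
    then show ?thesis using measurable_sets[OF meas[of "Suc n"] that] by simp
  qed
  have ev: "{\<omega>\<in>space M. (\<forall>l<m. cnt Y n (I l) \<omega> = f l) \<and> Y (Suc n) \<omega> \<in> S} \<in> events"
    if "S \<in> sets borel" for f S
  proof -
    have "{\<omega>\<in>space M. \<forall>l<m. cnt Y n (I l) \<omega> = f l} \<in> events"
      by (rule sets_Collect_coordinates[where D = "\<lambda>\<omega> l. cnt Y n (I l) \<omega>" and Phi = "\<lambda>g. \<forall>l<m. g l = f l" and m = m])
        (rule meas_cnt[OF I], simp)
    from sets.Int[OF this Ys[OF that]]
    show ?thesis by (rule back_subst[of "\<lambda>A. A \<in> events"]) auto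
  qed
  have eq: "{\<omega>\<in>space M. \<forall>l<m. cnt Y (Suc n) (I l) \<omega> = j l} = (\<Union>l\<in>L. A l) \<union> B"
  proof (intro equalityI subsetI)
    fix \<omega> assume \<omega>: "\<omega> \<in> {\<omega>\<in>space M. \<forall>l<m. cnt Y (Suc n) (I l) \<omega> = j l}"
    show "\<omega> \<in> (\<Union>l\<in>L. A l) \<union> B"
    proof (cases "Y (Suc n) \<omega> \<in> U")
      case True
      then obtain l where l: "l < m" "Y (Suc n) \<omega> \<in> I l" by (auto simp: U_def)
      have "Y (Suc n) \<omega> \<notin> I l'" if "l' < m" "l' \<noteq> l" for l'
        using disj l that by (force simp: disjoint_family_on_def)
      then have "\<omega> \<in> A l" "l \<in> L" using \<omega> l by (auto simp: A_def L_def cnt_Suc split: if_splits)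
      then show ?thesis by blast
    next
      case False
      then show ?thesis using \<omega> by (auto simp: B_def U_def cnt_Suc)
    qed
  next
    fix \<omega> assume "\<omega> \<in> (\<Union>l\<in>L. A l) \<union> B"
    then show "\<omega> \<in> {\<omega>\<in>space M. \<forall>l<m. cnt Y (Suc n) (I l) \<omega> = j l}"
    proof
      assume "\<omega> \<in> (\<Union>l\<in>L. A l)"
      then obtain l where l: "l < m" "j l > 0" "\<omega> \<in> A l" by (auto simp: L_def)
      have "Y (Suc n) \<omega> \<notin> I l'" if "l' < m" "l' \<noteq> l" for l'
        using disj l that by (force simp: disjoint_family_on_def A_def)
      then show ?thesis using l by (auto simp: A_def cnt_Suc)
    next
      assume "\<omega> \<in> B" then show ?thesis by (auto simp: B_def U_def cnt_Suc)
    qed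
  qed
  have A: "A l \<in> events" for l unfolding A_def by (rule ev[OF I])
  have B: "B \<in> events" unfolding B_def by (rule ev[OF borel_comp[OF U]])
  have finL: "finite L" by (simp add: L_def)
  have "prob {\<omega>\<in>space M. \<forall>l<m. cnt Y (Suc n) (I l) \<omega> = j l} = prob (\<Union>l\<in>L. A l) + prob B"
    unfolding eq
  proof (rule finite_measure_Union)
    show "(\<Union>l\<in>L. A l) \<in> events" using A finL by (intro sets.finite_UN)
    show "B \<in> events" by (rule B)
    show "(\<Union>l\<in>L. A l) \<inter> B = {}" by (auto simp: A_def B_def U_def L_def)
  qed
  also have "prob (\<Union>l\<in>L. A l) = (\<Sum>l\<in>L. prob (A l))"
  proof (rule finite_measure_finite_Union[OF finL])
    show "A ` L \<subseteq> events" using A by auto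
    have "A a \<inter> A b = {}" if "a \<in> L" "b \<in> L" "a \<noteq> b" for a b
    proof -
      have "I a \<inter> I b = {}" using disj that by (simp add: disjoint_family_on_def L_def)
      then show ?thesis unfolding A_def by blast
    qed
    then show "disjoint_family_on A L" by (simp add: disjoint_family_on_def)
  qed
  also have "prob B = w * (fact k * real (n choose k)) * (1 - real m * p) ^ (n - k) * (1 - real m * p)"
  proof -
    have "prob {\<omega>\<in>space M. Y (Suc n) \<omega> \<in> U} = (\<Sum>l<m. prob {\<omega>\<in>space M. Y (Suc n) \<omega> \<in> I l})"
    proof -
      have "{\<omega>\<in>space M. Y (Suc n) \<omega> \<in> U} = (\<Union>l<m. {\<omega>\<in>space M. Y (Suc n) \<omega> \<in> I l})" by (auto simp: U_def)
      then show ?thesis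
        by (simp only:) (rule finite_measure_finite_Union, simp, use Ys[OF I] in blast,
          use disj in \<open>fastforce simp: disjoint_family_on_def\<close>)
    qed
    then have "prob {\<omega>\<in>space M. Y (Suc n) \<omega> \<in> U} = real m * p" using p by simp
    moreover have "{\<omega>\<in>space M. Y (Suc n) \<omega> \<in> - U} = space M - {\<omega>\<in>space M. Y (Suc n) \<omega> \<in> U}" by auto
    ultimately have "prob {\<omega>\<in>space M. Y (Suc n) \<omega> \<in> - U} = 1 - real m * p"
      using prob_compl[OF Ys[OF U]] by simp
    then show ?thesis unfolding B_def k_def w_def
      by (subst prob_cnt_indep_last[OF I borel_comp[OF U]]) (simp add: Suc.IH)
  qed
  also have "(\<Sum>l\<in>L. prob (A l)) = (\<Sum>l\<in>L. real (j l) * (w * (fact (k - 1) * real (n choose (k - 1))) * (1 - real m * p) ^ (n - (k - 1))))"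
  proof (intro sum.cong refl)
    fix l assume l: "l \<in> L"
    let ?j = "j(l := j l - 1)"
    have s: "(\<Sum>l<m. ?j l) = k - 1"
    proof -
      have "(\<Sum>l'<m. ?j l') = ?j l + (\<Sum>l'\<in>{..<m}-{l}. ?j l')" using l by (intro sum.remove) (auto simp: L_def)
      moreover have "k = j l + (\<Sum>l'\<in>{..<m}-{l}. j l')" unfolding k_def using l by (intro sum.remove) (auto simp: L_def)
      ultimately show ?thesis using l by (simp add: L_def)
    qed
    have pr: "(\<Prod>l<m. p ^ ?j l / fact (?j l)) * p = real (j l) * w"
    proof -
      define R where "R = (\<Prod>l\<in>{..<m}-{l}. p ^ j l / fact (j l))"
      obtain i where i: "j l = Suc i" using l by (auto simp: L_def gr0_conv_Suc)
      have "(\<Prod>l<m. p ^ ?j l / fact (?j l)) = p ^ ?j l / fact (?j l) * (\<Prod>l\<in>{..<m}-{l}. p ^ ?j l / fact (?j l))"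
        using l by (intro prod.remove) (auto simp: L_def)
      also have "(\<Prod>l\<in>{..<m}-{l}. p ^ ?j l / fact (?j l)) = R"
        unfolding R_def by (intro prod.cong) auto
      finally have 1: "(\<Prod>l<m. p ^ ?j l / fact (?j l)) = p ^ i / fact i * R" using i by simp
      have "w = p ^ j l / fact (j l) * R"
        unfolding w_def R_def using l by (intro prod.remove) (auto simp: L_def)
      then have 2: "w = p ^ Suc i / (real (Suc i) * fact i) * R" unfolding i by simp
      show ?thesis unfolding 1 unfolding 2 unfolding i by simp
    qed
    have "prob (A l) = prob {\<omega>\<in>space M. \<forall>l'<m. cnt Y n (I l') \<omega> = ?j l'} * prob {\<omega>\<in>space M. Y (Suc n) \<omega> \<in> I l}"
      unfolding A_def by (rule prob_cnt_indep_last[OF I I])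
    also have "\<dots> = (\<Prod>l<m. p ^ ?j l / fact (?j l)) * p * (fact (k - 1) * real (n choose (k - 1))) * (1 - real m * p) ^ (n - (k - 1))"
      using l unfolding Suc.IH s by (subst p) (auto simp: L_def)
    finally show "prob (A l) = real (j l) * (w * (fact (k - 1) * real (n choose (k - 1))) * (1 - real m * p) ^ (n - (k - 1)))"
      unfolding pr by simp
  qed
  also have "\<dots> = real k * (w * (fact (k - 1) * real (n choose (k - 1))) * (1 - real m * p) ^ (n - (k - 1)))"
  proof -
    have "(\<Sum>l\<in>L. real (j l)) = (\<Sum>l<m. real (j l))" by (rule sum.mono_neutral_left) (auto simp: L_def)
    then show ?thesis by (simp add: sum_distrib_right[symmetric] k_def)
  qed
  also have "\<dots> + w * (fact k * real (n choose k)) * (1 - real m * p) ^ (n - k) * (1 - real m * p) =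
     w * (fact k * real (Suc n choose k)) * (1 - real m * p) ^ (Suc n - k)"
  proof (cases k)
    case 0 then show ?thesis by simp
  next
    case (Suc i)
    \<comment> \<open>For i >= n the exponent \<open>n - Suc i\<close> is truncated, but then the
      binomial coefficient is 0.\<close>
    have "real (n choose Suc i) * ((1 - real m * p) ^ (n - Suc i) * (1 - real m * p)) =
       real (n choose Suc i) * (1 - real m * p) ^ (n - i)"
    proof (cases "Suc i \<le> n")
      case True
      then have "n - i = Suc (n - Suc i)" by simp
      then show ?thesis by simp
    next
      case False
      then have "n choose Suc i = 0" by simp
      then show ?thesis by simp
    qed
    then have "w * (fact (Suc i) * (real (n choose Suc i) * ((1 - real m * p) ^ (n - Suc i) * (1 - real m * p)))) =
       w * (fact (Suc i) * (real (n choose Suc i) * (1 - real m * p) ^ (n - i)))" by (simp only:)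
    then show ?thesis unfolding Suc by (simp only: mult.assoc) (simp add: ring_distribs)
  qed
  finally show ?case by (simp add: w_def k_def)
qed

end

section \<open>The Poisson process on a grid\<close>

text \<open>The first cell extends to the left of \<open>0\<close>, so that the first \<open>k\<close> cells exhaust
  \<open>{..k h}\<close> exactly and not only up to a null event.\<close>
definition cell :: "real \<Rightarrow> nat \<Rightarrow> real set" where
  "cell h l = (if l = 0 then {..h} else {real l * h<..real (Suc l) * h})"

lemma cell_borel: "cell h l \<in> sets borel"
  using [[simproc add: measurable]] by (simp add: cell_def)

lemma cell_subset: "h \<ge> 0 \<Longrightarrow> cell h l \<subseteq> {..real (Suc l) * h}"
  by (auto simp: cell_def)

lemma disjoint_cell_atMost:
  assumes "h \<ge> 0" "k < l" shows "cell h k \<inter> cell h l = {}"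
proof -
  have "real (Suc k) * h \<le> real l * h" using assms by (intro mult_right_mono) auto
  moreover have "cell h l \<subseteq> {real l * h<..}" using assms by (auto simp: cell_def)
  ultimately show ?thesis using cell_subset[OF assms(1), of k] by fastforce
qed

lemma disjoint_cells: "h \<ge> 0 \<Longrightarrow> disjoint_family_on (cell h) L"
  unfolding disjoint_family_on_def using disjoint_cell_atMost by (metis Int_commute linorder_neqE_nat)

lemma UN_cell: "h \<ge> 0 \<Longrightarrow> (\<Union>l<Suc k. cell h l) = {..real (Suc k) * h}"
proof (induction k)
  case (Suc k)
  have "real (Suc k) * h \<le> real (Suc (Suc k)) * h" using Suc.prems by (intro mult_right_mono) auto
  moreover have "(\<Union>l<Suc (Suc k). cell h l) = (\<Union>l<Suc k. cell h l) \<union> cell h (Suc k)"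
    by (auto simp: lessThan_Suc)
  moreover have "cell h (Suc k) = {real (Suc k) * h<..real (Suc (Suc k)) * h}" by (simp add: cell_def)
  ultimately show ?case using Suc by auto
qed (auto simp: cell_def lessThan_Suc)

lemma cnt_grid:
  assumes "h \<ge> 0" "k \<ge> 1"
  shows "cnt Y n {..real k * h} \<omega> = (\<Sum>l<k. cnt Y n (cell h l) \<omega>)"
proof -
  obtain k' where "k = Suc k'" using assms by (cases k) auto
  then show ?thesis using UN_cell[OF assms(1), of k'] cnt_UN[OF _ disjoint_cells[OF assms(1)], of "{..<k}" Y n \<omega>] by simp
qed

lemma (in uniform_sample) prob_cell:
  assumes "h \<ge> 0" "real (Suc l) * h \<le> 1" "i \<ge> 1"
  shows "prob {\<omega>\<in>space M. Y i \<omega> \<in> cell h l} = h"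
proof (cases "l = 0")
  case True then show ?thesis using unif[of i h] assms by (simp add: cell_def)
next
  case False
  have "real l * h \<le> real (Suc l) * h" using assms by (intro mult_right_mono) auto
  then show ?thesis using prob_interval[of i "real l * h" "real (Suc l) * h"] assms False
    by (simp add: cell_def algebra_simps)
qed

lemma falling_factorial_tendsto:
  "(\<lambda>n. fact k * real (n choose k) / real n ^ k) \<longlonglongrightarrow> 1"
proof -
  have "(\<lambda>n. \<Prod>i<k. (real n - real i) / real n) \<longlonglongrightarrow> (\<Prod>i<k. 1)"
    by (intro tendsto_prod) real_asymp
  moreover have "fact k * real (n choose k) / real n ^ k = (\<Prod>i<k. (real n - real i) / real n)" for n
    using gbinomial_mult_fact[of k "real n"]
    by (simp add: binomial_gbinomial prod_dividef atLeast0LessThan)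
  ultimately show ?thesis by simp
qed

text \<open>The power with exponent n - k is split into an n-th power, tending to exp (-m tau), and
  a k-th power, tending to 1. The factor n^(-k) from the cell probabilities normalises the falling
  factorial.\<close>

lemma multinomial_tendsto:
  fixes j :: "nat \<Rightarrow> nat"
  assumes tau: "\<tau> > 0"
  shows "(\<lambda>n. (\<Prod>l<m. (\<tau> / real n) ^ j l / fact (j l)) *
      (fact (\<Sum>l<m. j l) * real (n choose (\<Sum>l<m. j l))) * (1 - real m * (\<tau> / real n)) ^ (n - (\<Sum>l<m. j l)))
    \<longlonglongrightarrow> (\<Prod>l<m. \<tau> ^ j l / fact (j l) * exp (- \<tau>))"
proof -
  define k where "k = (\<Sum>l<m. j l)"
  define W where "W = (\<Prod>l<m. \<tau> ^ j l / fact (j l))"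
  have b: "(\<lambda>n. 1 - real m * (\<tau> / real n)) \<longlonglongrightarrow> 1" by real_asymp
  have e: "(\<lambda>n. (1 + (- (real m * \<tau>)) / real n) ^ n) \<longlonglongrightarrow> exp (- (real m * \<tau>))"
    by (rule tendsto_exp_limit_sequentially)
  have "(\<lambda>n. W * (fact k * real (n choose k) / real n ^ k) *
      ((1 + (- (real m * \<tau>)) / real n) ^ n / (1 - real m * (\<tau> / real n)) ^ k))
    \<longlonglongrightarrow> W * 1 * (exp (- (real m * \<tau>)) / 1 ^ k)"
    by (intro tendsto_mult tendsto_const tendsto_divide tendsto_power falling_factorial_tendsto e b) simp
  moreover have "\<forall>\<^sub>F n in sequentially. W * (fact k * real (n choose k) / real n ^ k) *
      ((1 + (- (real m * \<tau>)) / real n) ^ n / (1 - real m * (\<tau> / real n)) ^ k) =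
      (\<Prod>l<m. (\<tau> / real n) ^ j l / fact (j l)) *
      (fact k * real (n choose k)) * (1 - real m * (\<tau> / real n)) ^ (n - k)"
    using order_tendstoD(1)[OF b zero_less_one] eventually_ge_at_top[of k] eventually_gt_at_top[of 0]
  proof eventually_elim
    case (elim n)
    have "(\<Prod>l<m. (\<tau> / real n) ^ j l / fact (j l)) = (\<Prod>l<m. \<tau> ^ j l / fact (j l) / real n ^ j l)"
      by (simp add: power_divide mult.commute)
    also have "\<dots> = W / (\<Prod>l<m. real n ^ j l)" by (simp only: W_def prod_dividef)
    also have "(\<Prod>l<m. real n ^ j l) = real n ^ k" by (simp add: k_def power_sum)
    finally have 1: "(\<Prod>l<m. (\<tau> / real n) ^ j l / fact (j l)) = W / real n ^ k" .
    have 2: "(1 - real m * (\<tau> / real n)) ^ (n - k) = (1 - real m * (\<tau> / real n)) ^ n / (1 - real m * (\<tau> / real n)) ^ k"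
      using elim by (intro power_diff) auto
    show ?case using 1 2 by simp
  qed
  ultimately have "(\<lambda>n. (\<Prod>l<m. (\<tau> / real n) ^ j l / fact (j l)) *
      (fact k * real (n choose k)) * (1 - real m * (\<tau> / real n)) ^ (n - k)) \<longlonglongrightarrow>
      W * 1 * (exp (- (real m * \<tau>)) / 1 ^ k)"
    by (rule Lim_transform_eventually)
  also have "W * 1 * (exp (- (real m * \<tau>)) / 1 ^ k) = (\<Prod>l<m. \<tau> ^ j l / fact (j l) * exp (- \<tau>))"
    by (simp only: prod.distrib W_def prod_constant card_lessThan exp_of_nat_mult[symmetric]) simp
  finally show ?thesis by (simp only: k_def)
qed

locale poisson_process = prob_space P for P :: "'b measure" +
  fixes N :: "real \<Rightarrow> 'b \<Rightarrow> nat"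
  assumes spp: "standard_poisson_process P N"
begin

lemma meas_N: "t \<ge> 0 \<Longrightarrow> N t \<in> measurable P (count_space UNIV)"
  and N_0: "\<omega> \<in> space P \<Longrightarrow> N 0 \<omega> = 0"
  and N_mono: "\<omega> \<in> space P \<Longrightarrow> 0 \<le> t \<Longrightarrow> t \<le> u \<Longrightarrow> N t \<omega> \<le> N u \<omega>"
  and N_right_cont: "\<omega> \<in> space P \<Longrightarrow> 0 \<le> t \<Longrightarrow> continuous (at_right t) (\<lambda>u. real (N u \<omega>))"
  and indep_increments: "0 \<le> T 0 \<Longrightarrow> (\<And>i. i < n \<Longrightarrow> T i \<le> T (Suc i)) \<Longrightarrow>
    indep_vars (\<lambda>_. count_space UNIV) (\<lambda>i \<omega>. N (T (Suc i)) \<omega> - N (T i) \<omega>) {..<n}"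
  and distr_increment: "0 \<le> a \<Longrightarrow> a < b \<Longrightarrow>
    distr P (count_space UNIV) (\<lambda>\<omega>. N b \<omega> - N a \<omega>) = measure_pmf (poisson_pmf (b - a))"
  using spp by (auto simp: standard_poisson_process_def mono_on_def)

definition inc :: "real \<Rightarrow> nat \<Rightarrow> 'b \<Rightarrow> nat" where
  "inc \<tau> l \<omega> = N (real (Suc l) * \<tau>) \<omega> - N (real l * \<tau>) \<omega>"

lemma indep_inc: "\<tau> \<ge> 0 \<Longrightarrow> indep_vars (\<lambda>_. count_space UNIV) (inc \<tau>) {..<n}"
  using indep_increments[of "\<lambda>i. real i * \<tau>" n] by (simp add: inc_def[abs_def] mult_right_mono)

lemma meas_inc: "\<tau> \<ge> 0 \<Longrightarrow> inc \<tau> l \<in> measurable P (count_space UNIV)"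
  using indep_inc[of \<tau> "Suc l"] by (auto simp: indep_vars_def)

lemma prob_increment:
  assumes "0 \<le> a" "a < b"
  shows "prob {\<omega>\<in>space P. N b \<omega> - N a \<omega> \<in> A} = measure (measure_pmf (poisson_pmf (b - a))) A"
proof -
  have m: "(\<lambda>\<omega>. N b \<omega> - N a \<omega>) \<in> measurable P (count_space UNIV)"
    using indep_increments[of "\<lambda>i. if i = 0 then a else b" 1] assms by (auto simp: indep_vars_def)
  show ?thesis unfolding distr_increment[OF assms, symmetric]
    using m by (subst measure_distr) (auto intro!: arg_cong[where f = prob])
qed

lemma prob_inc:
  assumes "\<tau> > 0"
  shows "prob {\<omega>\<in>space P. inc \<tau> l \<omega> = d} = \<tau> ^ d / fact d * exp (- \<tau>)"
proof -
  have "real l * \<tau> < real (Suc l) * \<tau>" using assms by simp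
  from prob_increment[OF _ this, of "{d}"] show ?thesis using assms
    by (simp add: inc_def measure_pmf_single algebra_simps)
qed

lemma prob_incs:
  assumes "\<tau> > 0"
  shows "prob {\<omega>\<in>space P. \<forall>l<m. inc \<tau> l \<omega> = j l} = (\<Prod>l<m. \<tau> ^ j l / fact (j l) * exp (- \<tau>))"
proof (cases "m = 0")
  case False
  have "prob (\<Inter>l\<in>{..<m}. inc \<tau> l -` {j l} \<inter> space P) = (\<Prod>l\<in>{..<m}. prob (inc \<tau> l -` {j l} \<inter> space P))"
    using assms False by (intro indep_varsD_finite[OF indep_inc]) auto
  moreover have "(\<Inter>l\<in>{..<m}. inc \<tau> l -` {j l} \<inter> space P) = {\<omega>\<in>space P. \<forall>l<m. inc \<tau> l \<omega> = j l}"
    using False by auto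
  moreover have "inc \<tau> l -` {j l} \<inter> space P = {\<omega>\<in>space P. inc \<tau> l \<omega> = j l}" for l by auto
  ultimately show ?thesis using prob_inc[OF assms] by simp
qed (simp add: prob_space)

lemma N_grid:
  assumes "\<tau> \<ge> 0" "\<omega> \<in> space P"
  shows "N (real k * \<tau>) \<omega> = (\<Sum>l<k. inc \<tau> l \<omega>)"
proof (induction k)
  case (Suc k)
  have "N (real k * \<tau>) \<omega> \<le> N (real (Suc k) * \<tau>) \<omega>"
    using assms by (intro N_mono mult_right_mono) auto
  then show ?case using Suc by (simp add: inc_def)
qed (use N_0 assms in simp)

lemma prob_indep_last_inc:
  assumes tau: "\<tau> > 0" and Phi: "\<forall>f g. (\<forall>l<m. f l = g l) \<longrightarrow> Phi f = Phi g"
  shows "prob {\<omega>\<in>space P. Phi (\<lambda>l. inc \<tau> l \<omega>) \<and> inc \<tau> m \<omega> = d} =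
    prob {\<omega>\<in>space P. Phi (\<lambda>l. inc \<tau> l \<omega>)} * (\<tau> ^ d / fact d * exp (- \<tau>))"
proof -
  let ?C = "\<lambda>_. count_space UNIV :: nat measure"
  let ?N = "PiM {..<m} ?C" and ?N' = "PiM {m} ?C"
  let ?R = "\<lambda>\<omega>. restrict (\<lambda>i. inc \<tau> i \<omega>) {..<m}" and ?R' = "\<lambda>\<omega>. restrict (\<lambda>i. inc \<tau> i \<omega>) {m}"
  have ind: "indep_var ?N ?R ?N' ?R'"
    by (rule indep_var_restrict[OF indep_inc[of \<tau> "Suc m"]]) (use tau in auto)
  let ?A = "{f\<in>space ?N. Phi f}" and ?B = "{f\<in>space ?N'. f m \<in> {d}}"
  have A: "?A \<in> sets ?N"
    by (rule sets_Collect_coordinates[where D = "\<lambda>f. f" and Phi = Phi, OF _ Phi])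
      (rule measurable_component_singleton, simp)
  have "(\<lambda>f. f m) -` {d} \<inter> space ?N' \<in> sets ?N'"
    by (rule measurable_sets[OF measurable_component_singleton]) auto
  moreover have "(\<lambda>f. f m) -` {d} \<inter> space ?N' = ?B" by auto
  ultimately have B: "?B \<in> sets ?N'" by simp
  have r: "Phi (?R \<omega>) = Phi (\<lambda>l. inc \<tau> l \<omega>)" for \<omega> by (rule Phi[rule_format]) simp
  have 1: "(\<lambda>x. (?R x, ?R' x)) -` (?A \<times> ?B) \<inter> space P =
      {\<omega>\<in>space P. Phi (\<lambda>l. inc \<tau> l \<omega>) \<and> inc \<tau> m \<omega> = d}"
    by (auto simp: r space_PiM)
  have 2: "?R -` ?A \<inter> space P = {\<omega>\<in>space P. Phi (\<lambda>l. inc \<tau> l \<omega>)}"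
    by (auto simp: r space_PiM)
  have 3: "?R' -` ?B \<inter> space P = {\<omega>\<in>space P. inc \<tau> m \<omega> = d}"
    by (auto simp: space_PiM)
  show ?thesis using indep_varD[OF ind A B] unfolding 1 2 3 prob_inc[OF tau] .
qed

end

section \<open>Ballot formula for the Poisson process on a grid\<close>

lemma binomial_convolution:
  fixes x y :: real
  shows "(\<Sum>i\<le>q. x ^ i / fact i * (y ^ (q - i) / fact (q - i))) = (x + y) ^ q / fact q"
proof -
  have "(x + y) ^ q / fact q = (\<Sum>i\<le>q. real (q choose i) * x ^ i * y ^ (q - i) / fact q)"
    by (simp add: binomial_ring sum_divide_distrib)
  also have "\<dots> = (\<Sum>i\<le>q. x ^ i / fact i * (y ^ (q - i) / fact (q - i)))"
    by (intro sum.cong refl) (simp add: binomial_fact)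
  finally show ?thesis by simp
qed

text \<open>Splitting 1 - i/m leaves a binomial sum and one weighted by i. In the latter i x^i / i!
  = x x^(i-1) / (i-1)! shifts the index, and for x = m tau the prefactor x/m = tau = (x + tau)/(m +
  1) restores the power q.\<close>

lemma ballot_convolution:
  fixes \<tau> :: real
  assumes m: "m \<ge> 1"
  shows "(\<Sum>i\<le>q. (1 - real i / real m) * ((real m * \<tau>) ^ i / fact i) * (\<tau> ^ (q - i) / fact (q - i))) =
    (1 - real q / real (Suc m)) * ((real (Suc m) * \<tau>) ^ q / fact q)"
proof -
  define x where "x = real m * \<tau>"
  have xt: "x + \<tau> = real (Suc m) * \<tau>" by (simp add: x_def algebra_simps)
  have 1: "(\<Sum>i\<le>q. real i * (x ^ i / fact i) * (\<tau> ^ (q - i) / fact (q - i))) =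
      real m * (real q / real (Suc m) * ((x + \<tau>) ^ q / fact q))"
  proof (cases q)
    case (Suc p)
    have "(\<Sum>i\<le>Suc p. real i * (x ^ i / fact i) * (\<tau> ^ (Suc p - i) / fact (Suc p - i))) =
      (\<Sum>i\<le>p. real (Suc i) * (x ^ Suc i / fact (Suc i)) * (\<tau> ^ (p - i) / fact (p - i)))"
      by (subst sum.atMost_Suc_shift) simp
    also have "\<dots> = (\<Sum>i\<le>p. x * (x ^ i / fact i * (\<tau> ^ (p - i) / fact (p - i))))"
    proof (intro sum.cong refl)
      fix i
      have "real (Suc i) * (x ^ Suc i / fact (Suc i)) = x * (x ^ i / fact i)"
        by (simp add: fact_Suc del: of_nat_Suc)
      then show "real (Suc i) * (x ^ Suc i / fact (Suc i)) * (\<tau> ^ (p - i) / fact (p - i)) =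
        x * (x ^ i / fact i * (\<tau> ^ (p - i) / fact (p - i)))" by simp
    qed
    also have "\<dots> = x * ((x + \<tau>) ^ p / fact p)"
      by (simp only: sum_distrib_left[symmetric] binomial_convolution)
    also have "\<dots> = real m * (real (Suc p) / real (Suc m) * ((x + \<tau>) ^ Suc p / fact (Suc p)))"
      unfolding xt by (simp add: x_def divide_simps)
    finally show ?thesis unfolding Suc .
  qed simp
  have "(\<Sum>i\<le>q. (1 - real i / real m) * (x ^ i / fact i) * (\<tau> ^ (q - i) / fact (q - i))) =
     (\<Sum>i\<le>q. x ^ i / fact i * (\<tau> ^ (q - i) / fact (q - i))) -
     (\<Sum>i\<le>q. real i * (x ^ i / fact i) * (\<tau> ^ (q - i) / fact (q - i))) / real m"
    by (simp add: sum_divide_distrib sum_subtractf[symmetric] algebra_simps)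
  also have "\<dots> = (1 - real q / real (Suc m)) * ((x + \<tau>) ^ q / fact q)"
    unfolding 1 binomial_convolution using m by (simp add: left_diff_distrib diff_divide_distrib)
  finally show ?thesis unfolding xt[symmetric] x_def[symmetric] .
qed

context poisson_process
begin

lemma prob_N_eq:
  assumes "t > 0" shows "prob {\<omega>\<in>space P. N t \<omega> = q} = t ^ q / fact q * exp (- t)"
proof -
  have "{\<omega>\<in>space P. N t \<omega> - N 0 \<omega> \<in> {q}} = {\<omega>\<in>space P. N t \<omega> = q}" using N_0 by auto
  then show ?thesis using prob_increment[of 0 t "{q}"] assms by (simp add: measure_pmf_single)
qed

lemma sets_N [measurable]: "t \<ge> 0 \<Longrightarrow> {\<omega>\<in>space P. Q (N t \<omega>)} \<in> events"
proof -
  assume "t \<ge> 0"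
  have "N t -` {x. Q x} \<inter> space P \<in> events" by (rule measurable_sets[OF meas_N]) (use \<open>t \<ge> 0\<close> in auto)
  moreover have "N t -` {x. Q x} \<inter> space P = {\<omega>\<in>space P. Q (N t \<omega>)}" by auto
  ultimately show ?thesis by simp
qed

text \<open>Conditioning on the last increment gives a recursion in \<open>m\<close>, which the right-hand side solves
  by the binomial theorem (\<open>ballot_convolution\<close>).\<close>
lemma ballot:
  assumes tau: "\<tau> > 0" and "m \<ge> 1" "q \<le> m"
  shows "prob {\<omega>\<in>space P. (\<forall>k\<in>{1..m}. N (real k * \<tau>) \<omega> < k) \<and> N (real m * \<tau>) \<omega> = q} =
    (1 - real q / real m) * ((real m * \<tau>) ^ q / fact q * exp (- (real m * \<tau>)))"
proof -
  define Psi where "Psi m i f \<longleftrightarrow> (\<forall>k\<in>{1..m}. (\<Sum>l<k. f l) < k) \<and> (\<Sum>l<m. f l) = i"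
    for m i :: nat and f :: "nat \<Rightarrow> nat"
  define Ev where "Ev m i = {\<omega>\<in>space P. Psi m i (\<lambda>l. inc \<tau> l \<omega>)}" for m i
  have Psi: "\<forall>f g. (\<forall>l<m. f l = g l) \<longrightarrow> Psi m i f = Psi m i g" for m i
  proof (intro allI impI)
    fix f g :: "nat \<Rightarrow> nat" assume *: "\<forall>l<m. f l = g l"
    have "(\<Sum>l<k. f l) = (\<Sum>l<k. g l)" if "k \<le> m" for k
      using * that by (intro sum.cong) auto
    then show "Psi m i f = Psi m i g" by (auto simp: Psi_def)
  qed
  have "prob (Ev m q) = (1 - real q / real m) * ((real m * \<tau>) ^ q / fact q * exp (- (real m * \<tau>)))"
    using assms(2,3)
  proof (induction m arbitrary: q rule: dec_induct)
    case base
    show ?case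
    proof (cases "q = 0")
      case True
      have "Ev 1 0 = {\<omega>\<in>space P. inc \<tau> 0 \<omega> = 0}" by (auto simp: Ev_def Psi_def)
      then show ?thesis using prob_inc[OF tau, of 0 0] True by simp
    next
      case False
      then have "q = 1" using base by simp
      moreover have "Ev 1 1 = {}" by (auto simp: Ev_def Psi_def)
      ultimately show ?thesis by simp
    qed
  next
    case (step m)
    show ?case
    \<comment> \<open>For q = m + 1 the constraint at k = m + 1 contradicts the final value, and the
      factor 1 - q/(m + 1) is 0.\<close>
    proof (cases "q = Suc m")
      case True
      have "\<not> Psi (Suc m) (Suc m) f" for f
      proof
        assume *: "Psi (Suc m) (Suc m) f"
        then have "\<forall>k\<in>{1..Suc m}. (\<Sum>l<k. f l) < k" unfolding Psi_def by (rule conjunct1)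
        from bspec[OF this, of "Suc m"] have "(\<Sum>l<Suc m. f l) < Suc m" by simp
        then show False using * by (simp add: Psi_def)
      qed
      then have "Ev (Suc m) (Suc m) = {}" by (simp add: Ev_def)
      then show ?thesis using True by simp
    next
      case False
      then have q: "q \<le> m" using step by simp
      \<comment> \<open>Splits by the value i reached after m steps. Since q <= m, the constraint at
        step m + 1 follows from the final value.\<close>
      define A where "A i = {\<omega>\<in>space P. Psi m i (\<lambda>l. inc \<tau> l \<omega>) \<and> inc \<tau> m \<omega> = q - i}" for i
      have A: "A i \<in> events" for i
      proof -
        have D: "\<forall>f g. (\<forall>l<Suc m. f l = g l) \<longrightarrow> (Psi m i f \<and> f m = q - i) = (Psi m i g \<and> g m = q - i)"
        proof (intro allI impI)
          fix f g :: "nat \<Rightarrow> nat" assume "\<forall>l<Suc m. f l = g l"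
          then show "(Psi m i f \<and> f m = q - i) = (Psi m i g \<and> g m = q - i)"
            using Psi[rule_format, of m f g i] by auto
        qed
        show ?thesis unfolding A_def
          by (rule sets_Collect_coordinates[where D = "\<lambda>\<omega> l. inc \<tau> l \<omega>" and m = "Suc m" and
            Phi = "\<lambda>f. Psi m i f \<and> f m = q - i", OF _ D]) (rule meas_inc, use tau in simp)
      qed
      have "Ev (Suc m) q = (\<Union>i\<in>{..q}. A i)"
      proof (intro equalityI subsetI)
        fix \<omega> assume "\<omega> \<in> Ev (Suc m) q"
        then have "\<omega> \<in> A (\<Sum>l<m. inc \<tau> l \<omega>)" "(\<Sum>l<m. inc \<tau> l \<omega>) \<le> q"
          by (auto simp: Ev_def A_def Psi_def)
        then show "\<omega> \<in> (\<Union>i\<in>{..q}. A i)" by auto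
      next
        fix \<omega> assume "\<omega> \<in> (\<Union>i\<in>{..q}. A i)"
        then obtain i where i: "i \<le> q" "\<omega> \<in> A i" by auto
        then have "(\<Sum>l<Suc m. inc \<tau> l \<omega>) = q" by (auto simp: A_def Psi_def)
        then show "\<omega> \<in> Ev (Suc m) q" using i q by (auto simp: Ev_def A_def Psi_def le_Suc_eq)
      qed
      moreover have "disjoint_family_on A {..q}" by (auto simp: disjoint_family_on_def A_def Psi_def)
      ultimately have "prob (Ev (Suc m) q) = (\<Sum>i\<le>q. prob (A i))"
        using A by (simp only:) (intro finite_measure_finite_Union, auto)
      also have "\<dots> = (\<Sum>i\<le>q. exp (- (real (Suc m) * \<tau>)) * ((1 - real i / real m) *
          ((real m * \<tau>) ^ i / fact i) * (\<tau> ^ (q - i) / fact (q - i))))"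
      proof (intro sum.cong refl)
        fix i assume i: "i \<in> {..q}"
        have e: "exp (- (real (Suc m) * \<tau>)) = exp (- (real m * \<tau>)) * exp (- \<tau>)"
          by (simp add: exp_add[symmetric] algebra_simps)
        have "prob (A i) = prob (Ev m i) * (\<tau> ^ (q - i) / fact (q - i) * exp (- \<tau>))"
          unfolding A_def Ev_def by (rule prob_indep_last_inc[OF tau Psi])
        also have "prob (Ev m i) = (1 - real i / real m) * ((real m * \<tau>) ^ i / fact i * exp (- (real m * \<tau>)))"
          using i q by (intro step.IH) auto
        finally show "prob (A i) = exp (- (real (Suc m) * \<tau>)) * ((1 - real i / real m) *
          ((real m * \<tau>) ^ i / fact i) * (\<tau> ^ (q - i) / fact (q - i)))"
          unfolding e by (simp only: mult_ac)
      qed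
      also have "\<dots> = exp (- (real (Suc m) * \<tau>)) * ((1 - real q / real (Suc m)) * ((real (Suc m) * \<tau>) ^ q / fact q))"
        using step by (simp only: sum_distrib_left[symmetric] ballot_convolution)
      finally show ?thesis by simp
    qed
  qed
  moreover have "{\<omega>\<in>space P. (\<forall>k\<in>{1..m}. N (real k * \<tau>) \<omega> < k) \<and> N (real m * \<tau>) \<omega> = q} = Ev m q"
    using N_grid tau by (auto simp: Ev_def Psi_def)
  ultimately show ?thesis by simp
qed

text \<open>Sum of \<open>ballot\<close> over q < m. The Poisson weights satisfy q p(q) = m tau
  p(q-1), so the sum weighted by q/m is tau times the mass up to m - 2; completing it to m - 1 costs
  tau p(m-1) = p(m), the last summand.\<close>

lemma prob_ballot:
  assumes tau: "\<tau> > 0" and m: "m \<ge> 1"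
  shows "prob {\<omega>\<in>space P. \<forall>k\<in>{1..m}. N (real k * \<tau>) \<omega> < k} =
    (1 - \<tau>) * prob {\<omega>\<in>space P. N (real m * \<tau>) \<omega> < m} + prob {\<omega>\<in>space P. N (real m * \<tau>) \<omega> = m}"
proof -
  obtain r where r: "m = Suc r" using m by (cases m) auto
  define \<mu> where "\<mu> = real m * \<tau>"
  have mu: "\<mu> > 0" using tau m by (simp add: \<mu>_def)
  define p where "p q = prob {\<omega>\<in>space P. N \<mu> \<omega> = q}" for q
  have p: "p q = \<mu> ^ q / fact q * exp (- \<mu>)" for q unfolding p_def by (rule prob_N_eq[OF mu])
  let ?E = "\<lambda>q. {\<omega>\<in>space P. (\<forall>k\<in>{1..m}. N (real k * \<tau>) \<omega> < k) \<and> N (real m * \<tau>) \<omega> = q}"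
  have E: "?E q \<in> events" for q
  proof -
    have a: "{\<omega>\<in>space P. \<forall>k\<in>{1..m}. N (real k * \<tau>) \<omega> < k} \<in> events"
      using tau by (intro sets.sets_Collect_finite_All sets_N) auto
    have b: "{\<omega>\<in>space P. N (real m * \<tau>) \<omega> = q} \<in> events" using tau by (intro sets_N) auto
    show ?thesis by (rule sets.sets_Collect_conj[OF b a])
  qed
  have "{\<omega>\<in>space P. \<forall>k\<in>{1..m}. N (real k * \<tau>) \<omega> < k} = (\<Union>q\<in>{..r}. ?E q)"
  proof -
    have "N (real m * \<tau>) \<omega> \<le> r" if "\<forall>k\<in>{1..m}. N (real k * \<tau>) \<omega> < k" for \<omega>
      using bspec[OF that, of m] m r by simp
    then show ?thesis by auto
  qed
  then have "prob {\<omega>\<in>space P. \<forall>k\<in>{1..m}. N (real k * \<tau>) \<omega> < k} = (\<Sum>q\<le>r. prob (?E q))"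
    using E by (simp only:) (intro finite_measure_finite_Union, auto simp: disjoint_family_on_def)
  also have "\<dots> = (\<Sum>q\<le>r. (1 - real q / real m) * p q)"
    using ballot[OF tau m] r by (intro sum.cong refl) (simp add: p \<mu>_def)
  also have "\<dots> = (\<Sum>q\<le>r. p q) - (\<Sum>q\<le>r. real q / real m * p q)"
    by (simp add: sum_subtractf[symmetric] left_diff_distrib)
  also have "(\<Sum>q\<le>r. real q / real m * p q) = (\<Sum>q<r. \<tau> * p q)"
  proof -
    have "(\<Sum>q\<le>r. real q / real m * p q) = (\<Sum>q<r. real (Suc q) / real m * p (Suc q))"
      by (subst sum.atMost_shift) simp
    also have "\<dots> = (\<Sum>q<r. \<tau> * p q)"
    proof (intro sum.cong refl)
      fix q
      have "real (Suc q) * p (Suc q) = \<mu> * p q"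
        unfolding p by (simp add: fact_Suc del: of_nat_Suc)
      then have "real (Suc q) / real m * p (Suc q) = \<mu> * p q / real m" by simp
      also have "\<dots> = \<tau> * p q" using m by (simp add: \<mu>_def)
      finally show "real (Suc q) / real m * p (Suc q) = \<tau> * p q" .
    qed
    finally show ?thesis .
  qed
  also have "\<dots> = \<tau> * (\<Sum>q\<le>r. p q) - \<tau> * p r"
    by (simp add: lessThan_Suc_atMost[symmetric] sum_distrib_left distrib_left)
  also have "\<tau> * p r = p m"
  proof -
    have "real m * p m = \<mu> * p r" unfolding p r by (simp add: fact_Suc del: of_nat_Suc)
    then show ?thesis using m by (simp add: \<mu>_def)
  qed
  also have "(\<Sum>q\<le>r. p q) = prob {\<omega>\<in>space P. N \<mu> \<omega> < m}"
  proof -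
    have "{\<omega>\<in>space P. N \<mu> \<omega> < m} = (\<Union>q\<in>{..r}. {\<omega>\<in>space P. N \<mu> \<omega> = q})"
      using r by auto
    then show ?thesis unfolding p_def using mu
      by (simp only:) (intro finite_measure_finite_Union[symmetric], auto simp: disjoint_family_on_def intro!: sets_N)
  qed
  finally show ?thesis by (simp add: p_def \<mu>_def algebra_simps)
qed

end

section \<open>Poisson limit of the sample counts on a grid\<close>

locale sample_and_poisson = S: uniform_sample M Y + poisson_process P N
  for M :: "'a measure" and Y and P :: "'b measure" and N
begin

text \<open>A condition on the values at m grid points is one on m increments, whose multinomial law
  converges to that of independent Poisson variables.\<close>

lemma grid_convergence:
  assumes tau: "\<tau> > 0" and Psi: "\<forall>f g. (\<forall>k\<in>{1..m}. f k = g k) \<longrightarrow> Psi f = Psi g"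
  shows "(\<lambda>n. measure M {\<omega>\<in>space M. Psi (\<lambda>k. cnt Y n {..real k * \<tau> / real n} \<omega>)}) \<longlonglongrightarrow>
    measure P {\<omega>\<in>space P. Psi (\<lambda>k. N (real k * \<tau>) \<omega>)}"
proof -
  define Phi where "Phi f = Psi (\<lambda>k. \<Sum>l<k. f l)" for f
  have Phi: "\<forall>f g. (\<forall>l<m. f l = g l) \<longrightarrow> Phi f = Phi g"
    unfolding Phi_def using Psi by (intro allI impI Psi[rule_format] sum.cong) auto
  have "(\<lambda>n. measure M {\<omega>\<in>space M. Phi (\<lambda>l. cnt Y n (cell (\<tau> / real n) l) \<omega>)}) \<longlonglongrightarrow>
    measure P {\<omega>\<in>space P. Phi (\<lambda>l. inc \<tau> l \<omega>)}"
  proof (rule coordinates_convergence[OF S.prob_space_axioms prob_space_axioms _ _ _ Phi])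
    show "(\<lambda>\<omega>. cnt Y n (cell (\<tau> / real n) l) \<omega>) \<in> measurable M (count_space UNIV)" for n l
      by (rule S.meas_cnt[OF cell_borel])
    show "(\<lambda>\<omega>. inc \<tau> l \<omega>) \<in> measurable P (count_space UNIV)" for l
      using tau by (intro meas_inc) simp
    fix j :: "nat \<Rightarrow> nat"
    show "(\<lambda>n. measure M {\<omega>\<in>space M. \<forall>l<m. cnt Y n (cell (\<tau> / real n) l) \<omega> = j l}) \<longlonglongrightarrow>
      measure P {\<omega>\<in>space P. \<forall>l<m. inc \<tau> l \<omega> = j l}"
    proof (rule Lim_transform_eventually)
      show "(\<lambda>n. (\<Prod>l<m. (\<tau> / real n) ^ j l / fact (j l)) *
        (fact (\<Sum>l<m. j l) * real (n choose (\<Sum>l<m. j l))) * (1 - real m * (\<tau> / real n)) ^ (n - (\<Sum>l<m. j l)))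
        \<longlonglongrightarrow> measure P {\<omega>\<in>space P. \<forall>l<m. inc \<tau> l \<omega> = j l}"
        unfolding prob_incs[OF tau] by (rule multinomial_tendsto[OF tau])
      have "\<forall>\<^sub>F n in sequentially. real m * \<tau> \<le> real n" by real_asymp
      then show "\<forall>\<^sub>F n in sequentially. (\<Prod>l<m. (\<tau> / real n) ^ j l / fact (j l)) *
        (fact (\<Sum>l<m. j l) * real (n choose (\<Sum>l<m. j l))) * (1 - real m * (\<tau> / real n)) ^ (n - (\<Sum>l<m. j l)) =
        measure M {\<omega>\<in>space M. \<forall>l<m. cnt Y n (cell (\<tau> / real n) l) \<omega> = j l}"
        using eventually_gt_at_top[of 0]
      proof eventually_elim
        case (elim n)
        have h: "\<tau> / real n \<ge> 0" using tau by simp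
        have "S.prob {\<omega>\<in>space M. Y i \<omega> \<in> cell (\<tau> / real n) l} = \<tau> / real n" if "i \<ge> 1" "l < m" for i l
        proof (rule S.prob_cell[OF h])
          have "real (Suc l) * \<tau> \<le> real m * \<tau>" using that tau by (intro mult_right_mono) auto
          then show "real (Suc l) * (\<tau> / real n) \<le> 1" using elim by (simp add: divide_simps)
        qed fact
        then show ?case using S.multinomial[OF cell_borel disjoint_cells[OF h], of m "\<tau> / real n" n j] by simp
      qed
    qed
  qed
  moreover have "Phi (\<lambda>l. cnt Y n (cell (\<tau> / real n) l) \<omega>) = Psi (\<lambda>k. cnt Y n {..real k * \<tau> / real n} \<omega>)" for n \<omega>
    unfolding Phi_def
    using cnt_grid[of "\<tau> / real n" _ Y n \<omega>] tau by (intro Psi[rule_format]) (auto simp del: One_nat_def)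
  moreover have "Phi (\<lambda>l. inc \<tau> l \<omega>) = Psi (\<lambda>k. N (real k * \<tau>) \<omega>)" if "\<omega> \<in> space P" for \<omega>
    unfolding Phi_def using N_grid[of \<tau> \<omega>] tau that by simp
  ultimately show ?thesis by (simp cong: conj_cong)
qed

text \<open>The Chernoff bound for the sample is uniform in n and so passes to the limit. This is
  why Poisson estimates live in a locale that also contains a sample.\<close>

lemma prob_N_ge:
  assumes tau: "0 < \<tau>" "\<tau> < 1"
  shows "prob {\<omega>\<in>space P. m \<le> N (real m * \<tau>) \<omega>} \<le> chernoff_rate \<tau> ^ m"
proof (cases "m = 0")
  case False
  have "(\<lambda>n. measure M {\<omega>\<in>space M. m \<le> cnt Y n {..real m * \<tau> / real n} \<omega>}) \<longlonglongrightarrow>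
    prob {\<omega>\<in>space P. m \<le> N (real m * \<tau>) \<omega>}"
    using grid_convergence[OF tau(1), where Psi = "\<lambda>f. m \<le> f m" and m = m] False by simp
  then show ?thesis
    by (rule LIMSEQ_le_const2) (use S.prob_cnt_ge[OF tau] in blast)
qed (simp add: prob_le_1)

lemma prob_N_le:
  assumes q: "1 < q"
  shows "prob {\<omega>\<in>space P. N (real m * q) \<omega> \<le> m} \<le> chernoff_rate q ^ m"
proof (cases "m = 0")
  case False
  have "(\<lambda>n. measure M {\<omega>\<in>space M. cnt Y n {..real m * q / real n} \<omega> \<le> m}) \<longlonglongrightarrow>
    prob {\<omega>\<in>space P. N (real m * q) \<omega> \<le> m}"
    using grid_convergence[where \<tau> = q and Psi = "\<lambda>f. f m \<le> m" and m = m] q False by simp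
  then show ?thesis
    by (rule LIMSEQ_le_const2) (use S.prob_cnt_le[OF q, of m] in \<open>blast intro: less_le_trans[OF lessI]\<close>)
qed (simp add: prob_le_1)

text \<open>Since tau < 1, the event N(m tau) < m becomes certain as m grows and equality becomes
  negligible; \<open>prob_ballot\<close> then leaves 1 - tau.\<close>

lemma prob_ballot_limit:
  assumes tau: "0 < \<tau>" "\<tau> < 1"
  shows "prob {\<omega>\<in>space P. \<forall>k\<ge>1. N (real k * \<tau>) \<omega> < k} = 1 - \<tau>"
proof -
  define A where "A m = {\<omega>\<in>space P. \<forall>k\<in>{1..m}. N (real k * \<tau>) \<omega> < k}" for m
  have rt: "(\<lambda>m. chernoff_rate \<tau> ^ m) \<longlonglongrightarrow> 0"
    using chernoff_rate_pos[of \<tau>] chernoff_rate_less_1[of \<tau>] tau by (intro LIMSEQ_power_zero) auto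
  have ge: "(\<lambda>m. prob {\<omega>\<in>space P. m \<le> N (real m * \<tau>) \<omega>}) \<longlonglongrightarrow> 0"
    by (rule real_tendsto_sandwich[OF _ _ tendsto_const rt]) (auto simp: prob_N_ge[OF tau])
  have eq0: "(\<lambda>m. prob {\<omega>\<in>space P. N (real m * \<tau>) \<omega> = m}) \<longlonglongrightarrow> 0"
  proof (rule real_tendsto_sandwich[OF _ _ tendsto_const ge])
    have "prob {\<omega>\<in>space P. N (real m * \<tau>) \<omega> = m} \<le> prob {\<omega>\<in>space P. m \<le> N (real m * \<tau>) \<omega>}" for m
      using tau by (intro finite_measure_mono sets_N) auto
    then show "\<forall>\<^sub>F m in sequentially. prob {\<omega>\<in>space P. N (real m * \<tau>) \<omega> = m} \<le> prob {\<omega>\<in>space P. m \<le> N (real m * \<tau>) \<omega>}"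
      by simp
  qed simp
  have "prob {\<omega>\<in>space P. N (real m * \<tau>) \<omega> < m} = 1 - prob {\<omega>\<in>space P. m \<le> N (real m * \<tau>) \<omega>}" for m
  proof -
    have "{\<omega>\<in>space P. N (real m * \<tau>) \<omega> < m} = space P - {\<omega>\<in>space P. m \<le> N (real m * \<tau>) \<omega>}" by auto
    then show ?thesis using tau by (simp only:) (intro prob_compl sets_N, simp)
  qed
  then have "(\<lambda>m. prob {\<omega>\<in>space P. N (real m * \<tau>) \<omega> < m}) \<longlonglongrightarrow> 1 - 0"
    using tendsto_diff[OF tendsto_const ge, of 1] by simp
  then have "(\<lambda>m. (1 - \<tau>) * prob {\<omega>\<in>space P. N (real m * \<tau>) \<omega> < m} + prob {\<omega>\<in>space P. N (real m * \<tau>) \<omega> = m})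
    \<longlonglongrightarrow> (1 - \<tau>) * (1 - 0) + 0"
    by (intro tendsto_add tendsto_mult tendsto_const eq0)
  then have "(\<lambda>m. prob (A m)) \<longlonglongrightarrow> (1 - \<tau>) * (1 - 0) + 0"
    by (rule Lim_transform_eventually)
      (use eventually_ge_at_top[of 1] in eventually_elim, simp add: A_def prob_ballot[OF tau(1)] del: One_nat_def)
  moreover have "(\<lambda>m. prob (A m)) \<longlonglongrightarrow> prob (\<Inter>m. A m)"
  proof (rule finite_Lim_measure_decseq)
    have "A m \<in> events" for m unfolding A_def
      using tau by (intro sets.sets_Collect_finite_All sets_N) auto
    then show "range A \<subseteq> events" by auto
    show "decseq A" by (auto simp: decseq_def A_def)
  qed
  ultimately have "prob (\<Inter>m. A m) = (1 - \<tau>) * (1 - 0) + 0" by (rule LIMSEQ_unique[rotated])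
  moreover have "(\<Inter>m. A m) = {\<omega>\<in>space P. \<forall>k\<ge>1. N (real k * \<tau>) \<omega> < k}"
  proof (intro equalityI subsetI)
    fix \<omega> assume *: "\<omega> \<in> (\<Inter>m. A m)"
    have "N (real k * \<tau>) \<omega> < k" if "k \<ge> 1" for k
    proof -
      have "\<omega> \<in> A k" using * by blast
      then show ?thesis using that by (simp add: A_def)
    qed
    moreover have "\<omega> \<in> A 0" using * by blast
    then have "\<omega> \<in> space P" by (simp add: A_def)
    ultimately show "\<omega> \<in> {\<omega>\<in>space P. \<forall>k\<ge>1. N (real k * \<tau>) \<omega> < k}" by simp
  qed (auto simp: A_def)
  ultimately show ?thesis by simp
qed

end

declare [[simproc add: measurable]]

section \<open>Suprema along Poisson paths\<close>

context poisson_process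
begin

text \<open>Integer values at distance less than 1 are equal, so right continuity means local
  constancy to the right.\<close>

lemma N_right_const:
  assumes "\<omega> \<in> space P" "t \<ge> 0"
  shows "\<exists>d>0. \<forall>u. t \<le> u \<and> u < t + d \<longrightarrow> N u \<omega> = N t \<omega>"
proof -
  have "((\<lambda>u. real (N u \<omega>)) \<longlongrightarrow> real (N t \<omega>)) (at_right t)"
    using N_right_cont[OF assms] by (simp add: continuous_within)
  from tendstoD[OF this, of 1]
  obtain b where b: "b > t" "\<And>u. t < u \<Longrightarrow> u < b \<Longrightarrow> dist (real (N u \<omega>)) (real (N t \<omega>)) < 1"
    by (auto simp: eventually_at_right_field)
  have "N u \<omega> = N t \<omega>" if "t \<le> u" "u < t + (b - t)" for u
  proof (cases "u = t")
    case False
    then have "dist (real (N u \<omega>)) (real (N t \<omega>)) < 1" using that by (intro b(2)) auto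
    then show ?thesis unfolding dist_real_def by linarith
  qed simp
  moreover have "b - t > 0" using b(1) by simp
  ultimately show ?thesis by blast
qed

lemma first_jump_no_jump:
  assumes "\<And>t. t \<ge> 0 \<Longrightarrow> N t \<omega> = 0"
  shows "first_jump N \<omega> = 0"
proof -
  have "isCont (\<lambda>u. real (N u \<omega>)) t" if "t > 0" for t
  proof -
    have "\<forall>\<^sub>F u in nhds t. real (N u \<omega>) = 0"
      using eventually_nhds_in_open[of "{0<..}" t] that by (auto elim!: eventually_mono simp: assms)
    from isCont_cong[OF this] show ?thesis by simp
  qed
  then have "{t. 0 < t \<and> \<not> isCont (\<lambda>u. real (N u \<omega>)) t} = {}" by auto
  then show ?thesis by (simp only: first_jump_def Let_def simp_thms if_True)
qed

text \<open>The infimum of the times with positive count is attained, by right continuity. The path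
  vanishes before it, so it is a discontinuity and no earlier time is one: it is the infimum in
  \<open>first_jump\<close>.\<close>

lemma first_jump_le_iff:
  assumes w: "\<omega> \<in> space P" and jump: "0 \<le> t0" "1 \<le> N t0 \<omega>"
  shows "first_jump N \<omega> \<le> t \<longleftrightarrow> 0 \<le> t \<and> 1 \<le> N t \<omega>"
proof -
  define T where "T = {t. 0 \<le> t \<and> 1 \<le> N t \<omega>}"
  define \<tau> where "\<tau> = Inf T"
  have T: "T \<noteq> {}" "bdd_below T" using jump by (auto simp: T_def bdd_below_def)
  have \<tau>0: "\<tau> \<ge> 0" unfolding \<tau>_def using T by (intro cInf_greatest) (auto simp: T_def)
  obtain d where d: "d > 0" "\<And>u. \<tau> \<le> u \<Longrightarrow> u < \<tau> + d \<Longrightarrow> N u \<omega> = N \<tau> \<omega>"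
    using N_right_const[OF w \<tau>0] by blast
  have "\<exists>t\<in>T. t < \<tau> + d" using cInf_less_iff[OF T, of "\<tau> + d"] d by (simp add: \<tau>_def)
  then obtain u where u: "u \<in> T" "u < \<tau> + d" by blast
  have "\<tau> \<le> u" unfolding \<tau>_def using u T by (intro cInf_lower)
  then have N\<tau>: "1 \<le> N \<tau> \<omega>" using d(2)[of u] u by (simp add: T_def)
  have \<tau>: "\<tau> > 0" using N\<tau> N_0[OF w] \<tau>0 by (cases "\<tau> = 0") auto
  have below: "N u \<omega> = 0" if "0 \<le> u" "u < \<tau>" for u
  proof (rule ccontr)
    assume "N u \<omega> \<noteq> 0"
    then have "u \<in> T" using that by (simp add: T_def)
    then have "\<tau> \<le> u" unfolding \<tau>_def using T by (intro cInf_lower)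
    then show False using that by simp
  qed
  define J where "J = {t. 0 < t \<and> \<not> isCont (\<lambda>u. real (N u \<omega>)) t}"
  have "\<tau> \<in> J"
  proof -
    have "\<not> isCont (\<lambda>u. real (N u \<omega>)) \<tau>"
    proof
      assume "isCont (\<lambda>u. real (N u \<omega>)) \<tau>"
      then have "((\<lambda>u. real (N u \<omega>)) \<longlongrightarrow> real (N \<tau> \<omega>)) (at_left \<tau>)"
        unfolding isCont_def by (rule tendsto_within_subset) auto
      moreover have "\<forall>\<^sub>F u in at_left \<tau>. real (N u \<omega>) = 0"
        unfolding eventually_at_left_field using \<tau> below by (intro exI[of _ 0]) auto
      then have "((\<lambda>u. real (N u \<omega>)) \<longlongrightarrow> 0) (at_left \<tau>)" by (rule tendsto_eventually)
      ultimately have "real (N \<tau> \<omega>) = 0" by (intro tendsto_unique[of "at_left \<tau>"]) auto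
      then show False using N\<tau> by simp
    qed
    then show ?thesis using \<tau> by (simp add: J_def)
  qed
  moreover have "\<tau> \<le> t" if "t \<in> J" for t
  proof (rule ccontr)
    assume "\<not> \<tau> \<le> t"
    then have t: "0 < t" "t < \<tau>" using that by (auto simp: J_def)
    have "\<forall>\<^sub>F u in nhds t. real (N u \<omega>) = 0"
      using eventually_nhds_in_open[of "{0<..<\<tau>}" t] t by (auto elim!: eventually_mono simp: below)
    from isCont_cong[OF this] have "isCont (\<lambda>u. real (N u \<omega>)) t" by simp
    then show False using that by (simp add: J_def)
  qed
  ultimately have "Inf J = \<tau>" by (intro cInf_eq_minimum)
  moreover have "J \<noteq> {}" using \<open>\<tau> \<in> J\<close> by blast
  ultimately have fj: "first_jump N \<omega> = \<tau>" by (simp add: first_jump_def J_def[symmetric] Let_def)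
  show ?thesis
  proof
    assume "first_jump N \<omega> \<le> t"
    then have "\<tau> \<le> t" by (simp add: fj)
    then show "0 \<le> t \<and> 1 \<le> N t \<omega>" using \<tau>0 N\<tau> N_mono[OF w \<tau>0 \<open>\<tau> \<le> t\<close>] by simp
  next
    assume "0 \<le> t \<and> 1 \<le> N t \<omega>"
    then show "first_jump N \<omega> \<le> t" unfolding fj \<tau>_def using T by (intro cInf_lower) (auto simp: T_def)
  qed
qed

lemma jump_iff_nat:
  assumes "\<omega> \<in> space P"
  shows "(\<exists>t\<ge>0. 1 \<le> N t \<omega>) \<longleftrightarrow> (\<exists>k::nat. 1 \<le> N (real k) \<omega>)"
proof
  assume "\<exists>t\<ge>0. 1 \<le> N t \<omega>"
  then obtain t where t: "t \<ge> 0" "1 \<le> N t \<omega>" by blast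
  obtain k :: nat where "t \<le> real k" using real_arch_simple by blast
  then show "\<exists>k::nat. 1 \<le> N (real k) \<omega>" using N_mono[OF assms t(1), of "real k"] t by (intro exI[of _ k]) simp
next
  assume "\<exists>k::nat. 1 \<le> N (real k) \<omega>"
  then obtain k :: nat where "1 \<le> N (real k) \<omega>" by blast
  then show "\<exists>t\<ge>0. 1 \<le> N t \<omega>" by (intro exI[of _ "real k"]) simp
qed

text \<open>Includes the paths without jumps, where \<open>first_jump\<close> is 0. The condition
  involves countably many coordinates, as the measurability of \<open>sup_down\<close>
  requires.\<close>

lemma first_jump_le_iff':
  assumes w: "\<omega> \<in> space P"
  shows "first_jump N \<omega> \<le> t \<longleftrightarrow> 0 \<le> t \<and> (1 \<le> N t \<omega> \<or> (\<forall>k::nat. N (real k) \<omega> = 0))"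
proof (cases "\<exists>t\<ge>0. 1 \<le> N t \<omega>")
  case True
  then obtain t0 where t0: "t0 \<ge> 0" "1 \<le> N t0 \<omega>" by blast
  obtain k :: nat where "1 \<le> N (real k) \<omega>" using True jump_iff_nat[OF w] by blast
  then have "N (real k) \<omega> \<noteq> 0" by simp
  then have "\<not> (\<forall>k::nat. N (real k) \<omega> = 0)"
    by (intro notI) (erule allE[of _ k], simp)
  then show ?thesis unfolding first_jump_le_iff[OF w t0] by blast
next
  case False
  have *: "N t \<omega> = 0" if "t \<ge> 0" for t
  proof -
    have "\<not> 1 \<le> N t \<omega>" using False that by blast
    then show ?thesis by simp
  qed
  then have "first_jump N \<omega> = 0" by (rule first_jump_no_jump)
  then show ?thesis using * by simp
qed

definition sup_up :: "'b \<Rightarrow> real" where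
  "sup_up \<omega> = (SUP t\<in>{0<..}. real (N t \<omega>) / t)"

definition sup_down :: "'b \<Rightarrow> real" where
  "sup_down \<omega> = (SUP t\<in>{first_jump N \<omega>..}. t / real (N t \<omega>))"

lemma meas_N_comp: "t \<ge> 0 \<Longrightarrow> (\<lambda>\<omega>. g (N t \<omega>) :: real) \<in> borel_measurable P"
  by (rule measurable_compose[OF meas_N borel_measurable_count_space])

text \<open>The path is constant just to the right of each time, so a slightly later rational time
  does almost as well.\<close>

lemma meas_sup_up: "sup_up \<in> borel_measurable P"
proof -
  have "(\<lambda>\<omega>. SUP t\<in>{t. 0 < t}. real (N t \<omega>) / t) \<in> borel_measurable P"
  proof (rule borel_measurable_SUP_countable_dense[where R = "\<rat> \<inter> {0<..}"])
    show "countable (\<rat> \<inter> {0<..} :: real set)" using countable_rat by (intro countable_Int1)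
    show "{\<omega>\<in>space P. 0 < q} \<in> events" for q :: real by (cases "0 < q") auto
    show "(\<lambda>\<omega>. real (N q \<omega>) / q) \<in> borel_measurable P" if "q \<in> \<rat> \<inter> {0<..}" for q
      by (rule meas_N_comp[where g = "\<lambda>n. real n / q"]) (use that in auto)
    fix \<omega> x b assume w: "\<omega> \<in> space P" and x: "0 < x" and b: "b < real (N x \<omega>) / x"
    have x0: "0 \<le> x" using x by simp
    obtain d where d: "d > 0" "\<And>u. x \<le> u \<Longrightarrow> u < x + d \<Longrightarrow> N u \<omega> = N x \<omega>"
      using N_right_const[OF w x0] by blast
    have "((\<lambda>u. real (N x \<omega>) / u) \<longlongrightarrow> real (N x \<omega>) / x) (at_right x)"
      using x by (intro tendsto_intros) auto
    from order_tendstoD(1)[OF this b]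
    obtain y where y: "x < y" "\<And>u. x < u \<Longrightarrow> u < y \<Longrightarrow> b < real (N x \<omega>) / u"
      by (auto simp: eventually_at_right_field)
    obtain q where q: "q \<in> \<rat>" "x < q" "q < min y (x + d)"
      using Rats_dense_in_real[of x "min y (x + d)"] y(1) d(1) by auto
    then show "\<exists>q\<in>\<rat> \<inter> {0<..}. 0 < q \<and> b < real (N q \<omega>) / q"
      using y(2)[of q] d(2)[of q] x by (intro bexI[of _ q]) auto
  qed
  then show ?thesis by (simp add: sup_up_def[abs_def] greaterThan_def)
qed

lemma meas_sup_down: "sup_down \<in> borel_measurable P"
proof -
  have "(\<lambda>\<omega>. SUP t\<in>{t. 0 \<le> t \<and> (1 \<le> N t \<omega> \<or> (\<forall>k::nat. N (real k) \<omega> = 0))}. t / real (N t \<omega>)) \<in> borel_measurable P"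
  proof (rule borel_measurable_SUP_countable_dense[where R = "\<rat> \<inter> {0..}"])
    show "countable (\<rat> \<inter> {0..} :: real set)" using countable_rat by (intro countable_Int1)
    show "{\<omega>\<in>space P. 0 \<le> q \<and> (1 \<le> N q \<omega> \<or> (\<forall>k::nat. N (real k) \<omega> = 0))} \<in> events"
      if "q \<in> \<rat> \<inter> {0..}" for q :: real
    proof -
      have a: "{\<omega>\<in>space P. 1 \<le> N q \<omega>} \<in> events" by (rule sets_N) (use that in simp)
      have b: "{\<omega>\<in>space P. \<forall>k::nat. N (real k) \<omega> = 0} \<in> events"
        by (rule sets.sets_Collect_countable_All) (rule sets_N, simp)
      from sets.Un[OF a b] show ?thesis
        by (rule back_subst[of "\<lambda>A. A \<in> events"]) (use that in auto)
    qed
    show "(\<lambda>\<omega>. q / real (N q \<omega>)) \<in> borel_measurable P" if "q \<in> \<rat> \<inter> {0..}" for q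
      by (rule meas_N_comp[where g = "\<lambda>n. q / real n"]) (use that in auto)
    fix \<omega> x b assume w: "\<omega> \<in> space P" and b: "b < x / real (N x \<omega>)"
      and x: "0 \<le> x \<and> (1 \<le> N x \<omega> \<or> (\<forall>k::nat. N (real k) \<omega> = 0))"
    have x0: "0 \<le> x" using x by simp
    obtain d where d: "d > 0" "\<And>u. x \<le> u \<Longrightarrow> u < x + d \<Longrightarrow> N u \<omega> = N x \<omega>"
      using N_right_const[OF w x0] by blast
    obtain q where q: "q \<in> \<rat>" "x < q" "q < x + d"
      using Rats_dense_in_real[of x "x + d"] d(1) by auto
    have N: "N q \<omega> = N x \<omega>" using d(2)[of q] q by simp
    have "x / real (N x \<omega>) \<le> q / real (N q \<omega>)" unfolding N using q by (intro divide_right_mono) auto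
    then show "\<exists>q\<in>\<rat> \<inter> {0..}. (0 \<le> q \<and> (1 \<le> N q \<omega> \<or> (\<forall>k::nat. N (real k) \<omega> = 0))) \<and> b < q / real (N q \<omega>)"
      using q b x N by (intro bexI[of _ q]) auto
  qed
  moreover have "{first_jump N \<omega>..} = {t. 0 \<le> t \<and> (1 \<le> N t \<omega> \<or> (\<forall>k::nat. N (real k) \<omega> = 0))}"
    if "\<omega> \<in> space P" for \<omega> using first_jump_le_iff'[OF that] by (auto simp: atLeast_def)
  ultimately show ?thesis unfolding sup_down_def[abs_def]
    by (subst measurable_cong) auto
qed

lemma sup_up_le:
  assumes w: "\<omega> \<in> space P" and l: "l > 0" and k: "\<And>k. k \<ge> 1 \<Longrightarrow> N (real k * (1 / l)) \<omega> < k"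
  shows "sup_up \<omega> \<le> l" "bdd_above ((\<lambda>t. real (N t \<omega>) / t) ` {0<..})"
proof -
  have *: "real (N t \<omega>) / t \<le> l" if t: "t > 0" for t
  proof -
    \<comment> \<open>t lies below the grid point (j+1)/l, where the count is at most j <= t
      l.\<close>
    define j where "j = nat \<lfloor>t * l\<rfloor>"
    have tl: "0 \<le> t * l" using t l by simp
    then have j: "real j \<le> t * l" "t * l < real (Suc j)" unfolding j_def by linarith+
    have "t \<le> real (Suc j) * (1 / l)" using j l by (simp add: field_simps)
    then have "N t \<omega> \<le> N (real (Suc j) * (1 / l)) \<omega>" using t by (intro N_mono[OF w]) auto
    also have "\<dots> \<le> j" using k[of "Suc j"] by simp
    finally have "real (N t \<omega>) \<le> t * l" using j by linarith
    then show ?thesis using t by (simp add: field_simps)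
  qed
  have "(1::real) \<in> {0<..}" by simp
  then show "sup_up \<omega> \<le> l" unfolding sup_up_def using * by (intro cSUP_least) blast+
  show "bdd_above ((\<lambda>t. real (N t \<omega>) / t) ` {0<..})" using * by (auto simp: bdd_above_def)
qed

lemma less_of_sup_up_le:
  assumes bdd: "bdd_above ((\<lambda>t. real (N t \<omega>) / t) ` {0<..})"
    and l: "0 < l" "l < l'" "sup_up \<omega> \<le> l" and k: "k \<ge> 1"
  shows "N (real k * (1 / l')) \<omega> < k"
proof -
  let ?t = "real k * (1 / l')"
  have t: "?t > 0" using l k by simp
  then have "real (N ?t \<omega>) / ?t \<le> sup_up \<omega>" unfolding sup_up_def by (intro cSUP_upper bdd) simp
  then have "real (N ?t \<omega>) \<le> l * ?t" using l t by (smt (verit) divide_le_eq)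
  also have "\<dots> < l' * ?t" using l t by (intro mult_strict_right_mono) auto
  also have "\<dots> = real k" using l by simp
  finally show ?thesis by simp
qed

text \<open>If t > N(t) l, monotonicity gives N(N(t) l) <= N(t), which contradicts the grid
  condition at the index k = N(t) itself.\<close>

lemma sup_down_le:
  assumes w: "\<omega> \<in> space P" and l: "l > 0" and k: "\<And>k. k \<ge> 1 \<Longrightarrow> k < N (real k * l) \<omega>"
  shows "sup_down \<omega> \<le> l" "bdd_above ((\<lambda>t. t / real (N t \<omega>)) ` {first_jump N \<omega>..})" "1 \<le> N l \<omega>"
proof -
  show jump: "1 \<le> N l \<omega>" using k[of 1] by simp
  have *: "t / real (N t \<omega>) \<le> l" if t: "first_jump N \<omega> \<le> t" for t
  proof -
    have t: "0 \<le> t" "1 \<le> N t \<omega>" using first_jump_le_iff[OF w _ jump, of t] l t by auto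
    have "t \<le> real (N t \<omega>) * l"
    proof (rule ccontr)
      assume "\<not> ?thesis"
      then have "N (real (N t \<omega>) * l) \<omega> \<le> N t \<omega>" using l by (intro N_mono[OF w]) auto
      then show False using k[of "N t \<omega>"] t by simp
    qed
    then show ?thesis using t by (simp add: field_simps)
  qed
  show "sup_down \<omega> \<le> l" unfolding sup_down_def using * by (intro cSUP_least) auto
  show "bdd_above ((\<lambda>t. t / real (N t \<omega>)) ` {first_jump N \<omega>..})" using * by (auto simp: bdd_above_def)
qed

text \<open>The bound on t/N(t) is available from the first jump on only. At that jump the count is
  1 by simplicity, so it occurs by time l, and every grid point k l' belongs to the index
  set.\<close>

lemma less_of_sup_down_le:
  assumes w: "\<omega> \<in> space P" and bdd: "bdd_above ((\<lambda>t. t / real (N t \<omega>)) ` {first_jump N \<omega>..})"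
    and jump: "0 \<le> t0" "1 \<le> N t0 \<omega>" and simple: "N (first_jump N \<omega>) \<omega> \<le> 1"
    and l: "0 < l" "l < l'" "sup_down \<omega> \<le> l" and k: "k \<ge> 1"
  shows "k < N (real k * l') \<omega>"
proof -
  have le: "t / real (N t \<omega>) \<le> l" if "first_jump N \<omega> \<le> t" for t
  proof -
    have "t / real (N t \<omega>) \<le> sup_down \<omega>" unfolding sup_down_def using that by (intro cSUP_upper bdd) auto
    then show ?thesis using l by simp
  qed
  have "N (first_jump N \<omega>) \<omega> = 1" using first_jump_le_iff[OF w jump, of "first_jump N \<omega>"] simple by auto
  then have "first_jump N \<omega> \<le> l" using le[of "first_jump N \<omega>"] by simp
  also have "l \<le> real k * l'"
  proof -
    have "1 * l' \<le> real k * l'" using k l by (intro mult_right_mono) auto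
    then show ?thesis using l by linarith
  qed
  finally have fj: "first_jump N \<omega> \<le> real k * l'" .
  then have "real k * l' / real (N (real k * l') \<omega>) \<le> l" by (rule le)
  moreover have "1 \<le> N (real k * l') \<omega>" using fj first_jump_le_iff[OF w jump] by simp
  ultimately have "real k * l' \<le> l * real (N (real k * l') \<omega>)" by (simp add: field_simps)
  moreover have "real k * l < real k * l'" using k l by simp
  ultimately have "l * real k < l * real (N (real k * l') \<omega>)" by (simp add: mult.commute)
  then show ?thesis using l by simp
qed

lemma prob_inc_ge_2:
  assumes h: "h > 0"
  shows "prob {\<omega>\<in>space P. 2 \<le> inc h l \<omega>} \<le> h\<^sup>2"
proof -
  have m: "{\<omega>\<in>space P. Q (inc h l \<omega>)} \<in> events" for Q
  proof -
    have "inc h l -` {x. Q x} \<inter> space P \<in> events"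
      by (rule measurable_sets[OF meas_inc]) (use h in auto)
    moreover have "inc h l -` {x. Q x} \<inter> space P = {\<omega>\<in>space P. Q (inc h l \<omega>)}" by auto
    ultimately show ?thesis by simp
  qed
  have "{\<omega>\<in>space P. 2 \<le> inc h l \<omega>} = space P - ({\<omega>\<in>space P. inc h l \<omega> = 0} \<union> {\<omega>\<in>space P. inc h l \<omega> = 1})"
    by auto
  moreover have "prob ({\<omega>\<in>space P. inc h l \<omega> = 0} \<union> {\<omega>\<in>space P. inc h l \<omega> = 1}) =
     prob {\<omega>\<in>space P. inc h l \<omega> = 0} + prob {\<omega>\<in>space P. inc h l \<omega> = 1}"
    by (rule finite_measure_Union[OF m m]) auto
  ultimately have "prob {\<omega>\<in>space P. 2 \<le> inc h l \<omega>} =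
     1 - (prob {\<omega>\<in>space P. inc h l \<omega> = 0} + prob {\<omega>\<in>space P. inc h l \<omega> = 1})"
    using prob_compl[OF sets.Un[OF m m], of "\<lambda>x. x = 0" "\<lambda>x. x = 1"] by simp
  also have "\<dots> = 1 - (1 + h) * exp (- h)" unfolding prob_inc[OF h] by (simp add: algebra_simps)
  also have "\<dots> \<le> 1 - (1 + h) * (1 - h)"
    using h exp_ge_add_one_self[of "- h"] by (intro diff_left_mono mult_left_mono) auto
  also have "\<dots> = h\<^sup>2" by (simp add: algebra_simps power2_eq_square)
  finally show ?thesis .
qed

text \<open>A double first jump by time T puts two points into one cell of every mesh 1/(p+1). By
  \<open>prob_inc_ge_2\<close> and a union bound this has probability at most T/(p+1), which tends
  to 0.\<close>

lemma AE_first_jump_simple: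
  "AE \<omega> in P. (\<exists>t\<ge>0. 1 \<le> N t \<omega>) \<longrightarrow> N (first_jump N \<omega>) \<omega> \<le> 1"
proof -
  define A where "A T p = (\<Union>l<T * Suc p. {\<omega>\<in>space P. 2 \<le> inc (1 / real (Suc p)) l \<omega>})" for T p :: nat
  have m: "{\<omega>\<in>space P. 2 \<le> inc (1 / real (Suc p)) l \<omega>} \<in> events" for p l
  proof -
    have "inc (1 / real (Suc p)) l -` {2..} \<inter> space P \<in> events"
      by (rule measurable_sets[OF meas_inc]) auto
    moreover have "inc (1 / real (Suc p)) l -` {2..} \<inter> space P = {\<omega>\<in>space P. 2 \<le> inc (1 / real (Suc p)) l \<omega>}" by auto
    ultimately show ?thesis by simp
  qed
  have A: "A T p \<in> events" for T p unfolding A_def using m by (intro sets.finite_UN) auto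
  have le: "prob (A T p) \<le> real T / real (Suc p)" for T p
  proof -
    have "prob (A T p) \<le> (\<Sum>l<T * Suc p. prob {\<omega>\<in>space P. 2 \<le> inc (1 / real (Suc p)) l \<omega>})"
      unfolding A_def using m by (intro finite_measure_subadditive_finite) auto
    also have "\<dots> \<le> (\<Sum>l<T * Suc p. (1 / real (Suc p))\<^sup>2)" by (intro sum_mono prob_inc_ge_2) simp
    also have "\<dots> = real T / real (Suc p)" by (simp add: power2_eq_square del: of_nat_Suc mult_Suc_right)
    finally show ?thesis .
  qed
  have "(\<Inter>p. A T p) \<in> null_sets P" for T
  proof -
    have "prob (\<Inter>p. A T p) \<le> real T / real (Suc p)" for p
    proof -
      have "prob (\<Inter>p. A T p) \<le> prob (A T p)" using A by (intro finite_measure_mono) auto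
      then show ?thesis using le[of T p] by simp
    qed
    moreover have "(\<lambda>p. real T / real (Suc p)) \<longlonglongrightarrow> 0" by real_asymp
    ultimately have "prob (\<Inter>p. A T p) \<le> 0" by (intro LIMSEQ_le_const) auto
    then have "prob (\<Inter>p. A T p) = 0" by (simp add: measure_le_0_iff)
    moreover have "(\<Inter>p. A T p) \<in> events" using A by (intro sets.countable_INT) auto
    ultimately show ?thesis by (simp add: null_sets_def emeasure_eq_measure)
  qed
  then have "AE \<omega> in P. \<omega> \<notin> (\<Inter>p. A T p)" for T by (rule AE_not_in)
  then have "AE \<omega> in P. \<forall>T. \<omega> \<notin> (\<Inter>p. A T p)" by (simp add: AE_all_countable)
  then show ?thesis using AE_space
  proof eventually_elim
    case (elim \<omega>)
    show ?case
    proof (intro impI, rule ccontr)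
      assume "\<exists>t\<ge>0. 1 \<le> N t \<omega>"
      then obtain t0 where t0: "t0 \<ge> 0" "1 \<le> N t0 \<omega>" by blast
      assume "\<not> N (first_jump N \<omega>) \<omega> \<le> 1"
      then have two: "2 \<le> N (first_jump N \<omega>) \<omega>" by simp
      let ?s = "first_jump N \<omega>"
      have s0: "0 \<le> ?s" using first_jump_le_iff[OF elim(2) t0, of ?s] by simp
      have s: "?s > 0" using two N_0[OF elim(2)] s0 by (cases "?s = 0") auto
      obtain T :: nat where T: "?s \<le> real T" using real_arch_simple by blast
      have "\<omega> \<in> A T p" for p
      proof -
        \<comment> \<open>Rounding up and subtracting 1 puts the left end of the cell strictly
          before the jump, where the count is still 0.\<close>
        define l where "l = nat (\<lceil>?s * real (Suc p)\<rceil> - 1)"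
        have "0 < ?s * real (Suc p)" using s by simp
        then have l: "real l < ?s * real (Suc p)" "?s * real (Suc p) \<le> real (Suc l)"
          unfolding l_def by linarith+
        have "?s * real (Suc p) \<le> real T * real (Suc p)" using T by (intro mult_right_mono) auto
        then have "real l < real (T * Suc p)" using l by (simp only: of_nat_mult)
        then have lT: "l < T * Suc p" by (simp only: of_nat_less_iff)
        have 1: "real l * (1 / real (Suc p)) < ?s" "?s \<le> real (Suc l) * (1 / real (Suc p))"
          using l by (auto simp: field_simps)
        have "\<not> 1 \<le> N (real l * (1 / real (Suc p))) \<omega>"
          using first_jump_le_iff[OF elim(2) t0, of "real l * (1 / real (Suc p))"] 1 by auto
        moreover have "2 \<le> N (real (Suc l) * (1 / real (Suc p))) \<omega>"
          using N_mono[OF elim(2) s0 1(2)] two by simp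
        ultimately have "2 \<le> inc (1 / real (Suc p)) l \<omega>" by (simp add: inc_def)
        then show ?thesis unfolding A_def using lT elim(2) by blast
      qed
      then show False using elim(1) by blast
    qed
  qed
qed

end

section \<open>Grid events for the Poisson suprema\<close>

context poisson_process
begin

definition ev_up :: "real \<Rightarrow> nat \<Rightarrow> 'b set" where
  "ev_up l m = {\<omega>\<in>space P. \<forall>k\<in>{1..m}. N (real k * (1 / l)) \<omega> < k}"

definition ev_down :: "real \<Rightarrow> nat \<Rightarrow> 'b set" where
  "ev_down l m = {\<omega>\<in>space P. \<forall>k\<in>{1..m}. k < N (real k * l) \<omega>}"

lemma sets_ev_up: "l > 0 \<Longrightarrow> ev_up l m \<in> events"
  unfolding ev_up_def by (intro sets.sets_Collect_finite_All sets_N) auto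

lemma sets_ev_down: "l > 0 \<Longrightarrow> ev_down l m \<in> events"
  unfolding ev_down_def by (intro sets.sets_Collect_finite_All sets_N) auto

lemma ev_up_Suc: "ev_up l (Suc m) \<subseteq> ev_up l m" by (auto simp: ev_up_def)

lemma ev_down_Suc: "ev_down l (Suc m) \<subseteq> ev_down l m" by (auto simp: ev_down_def)

lemma INT_ev_up: "(\<Inter>m. ev_up l m) = {\<omega>\<in>space P. \<forall>k\<ge>1. N (real k * (1 / l)) \<omega> < k}"
proof (intro equalityI subsetI)
  fix \<omega> assume *: "\<omega> \<in> (\<Inter>m. ev_up l m)"
  have "N (real k * (1 / l)) \<omega> < k" if "k \<ge> 1" for k
  proof -
    have "\<omega> \<in> ev_up l k" using * by blast
    then show ?thesis using that by (simp add: ev_up_def)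
  qed
  moreover have "\<omega> \<in> ev_up l 0" using * by blast
  then have "\<omega> \<in> space P" by (simp add: ev_up_def)
  ultimately show "\<omega> \<in> {\<omega>\<in>space P. \<forall>k\<ge>1. N (real k * (1 / l)) \<omega> < k}" by simp
qed (auto simp: ev_up_def)

lemma INT_ev_down: "(\<Inter>m. ev_down l m) = {\<omega>\<in>space P. \<forall>k\<ge>1. k < N (real k * l) \<omega>}"
proof (intro equalityI subsetI)
  fix \<omega> assume *: "\<omega> \<in> (\<Inter>m. ev_down l m)"
  have "k < N (real k * l) \<omega>" if "k \<ge> 1" for k
  proof -
    have "\<omega> \<in> ev_down l k" using * by blast
    then show ?thesis using that by (simp add: ev_down_def)
  qed
  moreover have "\<omega> \<in> ev_down l 0" using * by blast
  then have "\<omega> \<in> space P" by (simp add: ev_down_def)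
  ultimately show "\<omega> \<in> {\<omega>\<in>space P. \<forall>k\<ge>1. k < N (real k * l) \<omega>}" by simp
qed (auto simp: ev_down_def)

lemma sets_INT_ev:
  assumes "l > 0" shows "(\<Inter>m. ev_up l m) \<in> events" "(\<Inter>m. ev_down l m) \<in> events"
  using sets_ev_up[OF assms] sets_ev_down[OF assms] by (auto intro!: sets.countable_INT)

lemma sup_up_le_of_ev_up:
  "l > 0 \<Longrightarrow> \<omega> \<in> space P \<Longrightarrow> (\<And>m. \<omega> \<in> ev_up l m) \<Longrightarrow> sup_up \<omega> \<le> l"
  using INT_ev_up[of l] sup_up_le(1)[of \<omega> l] by blast

lemma sup_down_le_of_ev_down:
  "l > 0 \<Longrightarrow> \<omega> \<in> space P \<Longrightarrow> (\<And>m. \<omega> \<in> ev_down l m) \<Longrightarrow> sup_down \<omega> \<le> l"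
  using INT_ev_down[of l] sup_down_le(1)[of \<omega> l] by blast

text \<open>Applied with \<open>A j\<close> the event that all grid inequalities hold at level j +
  2: almost every path lies in one of these and so has a finite supremum.\<close>

lemma AE_in_UN:
  fixes A :: "nat \<Rightarrow> 'b set"
  assumes A: "\<And>j. A j \<in> events" and le: "\<And>j. 1 - e j \<le> prob (A j)" and e: "e \<longlonglongrightarrow> 0"
  shows "AE \<omega> in P. \<exists>j. \<omega> \<in> A j"
proof -
  have UA: "(\<Union>j. A j) \<in> events" using A by (intro sets.countable_UN) auto
  have "1 - e j \<le> prob (\<Union>j. A j)" for j
  proof -
    have "prob (A j) \<le> prob (\<Union>j. A j)" using UA by (intro finite_measure_mono) auto
    then show ?thesis using le[of j] by simp
  qed
  moreover have "(\<lambda>j. 1 - e j) \<longlonglongrightarrow> 1 - 0" by (intro tendsto_diff tendsto_const e)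
  ultimately have "1 \<le> prob (\<Union>j. A j)" by (intro LIMSEQ_le_const2[of "\<lambda>j. 1 - e j"]) auto
  then have "prob (\<Union>j. A j) = 1" using prob_le_1[of "\<Union>j. A j"] by (intro antisym)
  from AE_prob_1[OF this] show ?thesis by simp
qed

end

context sample_and_poisson
begin

lemma prob_INT_ev_up: "l > 1 \<Longrightarrow> prob (\<Inter>m. ev_up l m) = 1 - 1 / l"
  unfolding INT_ev_up using prob_ballot_limit[of "1 / l"] by simp

text \<open>Union bound over all k >= 1 with a geometric series. The bound is informative for large
  l only and is used along l = j + 2.\<close>

lemma prob_INT_ev_down:
  assumes l: "l > 1"
  shows "prob (\<Inter>m. ev_down l m) \<ge> 1 - chernoff_rate l / (1 - chernoff_rate l)"
proof -
  let ?B = "{\<omega>\<in>space P. \<exists>k\<ge>1. N (real k * l) \<omega> \<le> k}"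
  have m: "{\<omega>\<in>space P. N (real k * l) \<omega> \<le> k} \<in> events" for k :: nat
    by (rule sets_N) (use l in simp)
  have r: "0 \<le> chernoff_rate l" "chernoff_rate l < 1"
    using l chernoff_rate_pos[of l] chernoff_rate_less_1[of l] by auto
  have B: "?B \<in> events"
  proof -
    have "{\<omega>\<in>space P. \<exists>k\<in>{1..}. N (real k * l) \<omega> \<le> k} \<in> events"
      by (rule sets.sets_Collect_countable_Ex'[OF m]) simp
    then show ?thesis unfolding Bex_def atLeast_iff .
  qed
  have eq: "space P - ?B = (\<Inter>m. ev_down l m)"
    unfolding INT_ev_down set_eq_iff Diff_iff mem_Collect_eq by (meson not_le)
  have "prob ?B \<le> chernoff_rate l ^ 1 / (1 - chernoff_rate l)"
    by (rule prob_ex_le_geometric[where E = "\<lambda>k \<omega>. N (real k * l) \<omega> \<le> k", OF r m prob_N_le[OF l]])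
  then show ?thesis using prob_compl[OF B] unfolding eq power_one_right by linarith
qed

text \<open>The supremum of an unbounded set is a junk value, so boundedness comes first: almost
  every path satisfies the grid conditions at some level j + 2. Only then does an upper bound on
  \<open>sup_up\<close> constrain the path.\<close>

lemma AE_ev_up_of_sup_up_le:
  "AE \<omega> in P. \<forall>l l' m. 0 < l \<longrightarrow> l < l' \<longrightarrow> sup_up \<omega> \<le> l \<longrightarrow> \<omega> \<in> ev_up l' m"
proof -
  have "AE \<omega> in P. \<exists>j::nat. \<omega> \<in> (\<Inter>m. ev_up (real j + 2) m)"
  proof (rule AE_in_UN)
    show "(\<Inter>m. ev_up (real j + 2) m) \<in> events" for j :: nat by (rule sets_INT_ev) simp
    show "1 - 1 / (real j + 2) \<le> prob (\<Inter>m. ev_up (real j + 2) m)" for j :: nat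
      by (subst prob_INT_ev_up) auto
    show "(\<lambda>j. 1 / (real j + 2)) \<longlonglongrightarrow> 0" by real_asymp
  qed
  then show ?thesis using AE_space
  proof eventually_elim
    case (elim \<omega>)
    then obtain j :: nat where j: "\<omega> \<in> (\<Inter>m. ev_up (real j + 2) m)" by blast
    have bdd: "bdd_above ((\<lambda>t. real (N t \<omega>) / t) ` {0<..})"
    proof (rule sup_up_le(2)[OF elim(2)])
      show "real j + 2 > 0" by simp
      show "N (real k * (1 / (real j + 2))) \<omega> < k" if "k \<ge> 1" for k
        using j that unfolding INT_ev_up by blast
    qed
    show ?case
    proof (intro allI impI)
      fix l l' :: real and m assume l: "0 < l" "l < l'" "sup_up \<omega> \<le> l"
      show "\<omega> \<in> ev_up l' m"
        unfolding ev_up_def using less_of_sup_up_le[OF bdd l] elim(2) by simp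
    qed
  qed
qed

text \<open>Boundedness as for \<open>sup_up\<close>. The grid conditions also provide a jump, and
  the almost sure simplicity of the first one is what \<open>less_of_sup_down_le\<close> relies
  on.\<close>

lemma AE_ev_down_of_sup_down_le:
  "AE \<omega> in P. \<forall>l l' m. 0 < l \<longrightarrow> l < l' \<longrightarrow> sup_down \<omega> \<le> l \<longrightarrow> \<omega> \<in> ev_down l' m"
proof -
  have "AE \<omega> in P. \<exists>j::nat. \<omega> \<in> (\<Inter>m. ev_down (real j + 2) m)"
  proof (rule AE_in_UN)
    show "(\<Inter>m. ev_down (real j + 2) m) \<in> events" for j :: nat by (rule sets_INT_ev) simp
    show "1 - chernoff_rate (real j + 2) / (1 - chernoff_rate (real j + 2)) \<le> prob (\<Inter>m. ev_down (real j + 2) m)"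
      for j :: nat by (rule prob_INT_ev_down) simp
    show "(\<lambda>j. chernoff_rate (real j + 2) / (1 - chernoff_rate (real j + 2))) \<longlonglongrightarrow> 0"
      unfolding chernoff_rate_def by real_asymp
  qed
  then show ?thesis using AE_space AE_first_jump_simple
  proof eventually_elim
    case (elim \<omega>)
    then obtain j :: nat where j: "\<omega> \<in> (\<Inter>m. ev_down (real j + 2) m)" by blast
    have k: "k < N (real k * (real j + 2)) \<omega>" if "k \<ge> 1" for k
      using j that unfolding INT_ev_down by blast
    have j0: "real j + 2 > 0" by simp
    note sd = sup_down_le[OF elim(2) j0 k]
    have simple: "N (first_jump N \<omega>) \<omega> \<le> 1" using elim(3) sd(3) j0 by (meson less_imp_le)
    show ?case
    proof (intro allI impI)
      fix l l' :: real and m assume l: "0 < l" "l < l'" "sup_down \<omega> \<le> l"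
      show "\<omega> \<in> ev_down l' m"
        unfolding ev_down_def using less_of_sup_down_le[OF elim(2) sd(2) _ sd(3) simple l] j0 elim(2) by simp
    qed
  qed
qed

text \<open>For l < 1 the grid conditions require N(m/l) <= m although the mean m/l exceeds m, an
  event whose probability is geometrically small in m.\<close>

lemma null_INT_ev_up:
  assumes "0 < l" "l < 1" shows "prob (\<Inter>m. ev_up l m) = 0"
proof -
  have q: "1 < 1 / l" using assms by simp
  have "prob (\<Inter>m. ev_up l m) \<le> chernoff_rate (1 / l) ^ m" if m: "m \<ge> 1" for m
  proof -
    have "(\<Inter>m. ev_up l m) \<subseteq> {\<omega>\<in>space P. N (real m * (1 / l)) \<omega> \<le> m}"
      unfolding INT_ev_up using m by (auto intro: less_imp_le)
    then have "prob (\<Inter>m. ev_up l m) \<le> prob {\<omega>\<in>space P. N (real m * (1 / l)) \<omega> \<le> m}"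
      using assms by (intro finite_measure_mono sets_N) auto
    then show ?thesis using prob_N_le[OF q, of m] by simp
  qed
  moreover have "(\<lambda>m. chernoff_rate (1 / l) ^ m) \<longlonglongrightarrow> 0"
    using chernoff_rate_pos[of "1 / l"] chernoff_rate_less_1[of "1 / l"] assms by (intro LIMSEQ_power_zero) auto
  ultimately have "prob (\<Inter>m. ev_up l m) \<le> 0" by (intro LIMSEQ_le_const) blast+
  then show ?thesis by (simp add: measure_le_0_iff)
qed

lemma null_INT_ev_down:
  assumes "0 < l" "l < 1" shows "prob (\<Inter>m. ev_down l m) = 0"
proof -
  have "prob (\<Inter>m. ev_down l m) \<le> chernoff_rate l ^ m" if m: "m \<ge> 1" for m
  proof -
    have "(\<Inter>m. ev_down l m) \<subseteq> {\<omega>\<in>space P. m \<le> N (real m * l) \<omega>}"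
      unfolding INT_ev_down using m by (auto intro: less_imp_le)
    then have "prob (\<Inter>m. ev_down l m) \<le> prob {\<omega>\<in>space P. m \<le> N (real m * l) \<omega>}"
      using assms by (intro finite_measure_mono sets_N) auto
    then show ?thesis using prob_N_ge[OF assms, of m] by simp
  qed
  moreover have "(\<lambda>m. chernoff_rate l ^ m) \<longlonglongrightarrow> 0"
    using chernoff_rate_pos[of l] chernoff_rate_less_1[of l] assms by (intro LIMSEQ_power_zero) auto
  ultimately have "prob (\<Inter>m. ev_down l m) \<le> 0" by (intro LIMSEQ_le_const) blast+
  then show ?thesis by (simp add: measure_le_0_iff)
qed

section \<open>The law of sup N(t)/t\<close>

lemma sets_sup_up_le: "{\<omega>\<in>space P. sup_up \<omega> \<le> x} \<in> events"
  using meas_sup_up by (simp add: borel_measurable_iff_le)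

text \<open>From above, every level y > max x 1 gives the bound 1 - 1/y, and letting y decrease
  closes the gap. From below, for x > 1, the full grid event at level x is contained in the
  event.\<close>

lemma prob_sup_up_le: "prob {\<omega>\<in>space P. sup_up \<omega> \<le> x} = 1 - 1 / max x 1"
proof (rule antisym)
  have le: "prob {\<omega>\<in>space P. sup_up \<omega> \<le> x} \<le> 1 - 1 / y" if y: "max x 1 < y" for y
  proof -
    have "prob {\<omega>\<in>space P. sup_up \<omega> \<le> x} \<le> prob (\<Inter>m. ev_up y m)"
    proof (rule finite_measure_mono_AE)
      show "AE \<omega> in P. \<omega> \<in> {\<omega>\<in>space P. sup_up \<omega> \<le> x} \<longrightarrow> \<omega> \<in> (\<Inter>m. ev_up y m)"
        using AE_ev_up_of_sup_up_le
      proof eventually_elim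
        case (elim \<omega>)
        have "0 < max x 1" "sup_up \<omega> \<le> x \<Longrightarrow> sup_up \<omega> \<le> max x 1" by auto
        then show ?case using elim y by blast
      qed
      show "(\<Inter>m. ev_up y m) \<in> events" using y by (intro sets_INT_ev) simp
    qed
    then show ?thesis using prob_INT_ev_up[of y] y by simp
  qed
  have "((\<lambda>y. 1 - 1 / y) \<longlongrightarrow> 1 - 1 / max x 1) (at_right (max x 1))"
    by (intro tendsto_intros) auto
  then show "prob {\<omega>\<in>space P. sup_up \<omega> \<le> x} \<le> 1 - 1 / max x 1"
    by (rule tendsto_lowerbound) (use le in \<open>auto simp: eventually_at_right_less intro: eventually_mono[OF eventually_at_right_less]\<close>)
  show "1 - 1 / max x 1 \<le> prob {\<omega>\<in>space P. sup_up \<omega> \<le> x}"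
  proof (cases "x > 1")
    case True
    have "(\<Inter>m. ev_up x m) \<subseteq> {\<omega>\<in>space P. sup_up \<omega> \<le> x}"
    proof
      fix \<omega> assume *: "\<omega> \<in> (\<Inter>m. ev_up x m)"
      then have "\<omega> \<in> space P" unfolding INT_ev_up by simp
      then show "\<omega> \<in> {\<omega>\<in>space P. sup_up \<omega> \<le> x}" using sup_up_le_of_ev_up[of x \<omega>] * True by auto
    qed
    then have "prob (\<Inter>m. ev_up x m) \<le> prob {\<omega>\<in>space P. sup_up \<omega> \<le> x}"
      using sets_sup_up_le by (intro finite_measure_mono)
    then show ?thesis using prob_INT_ev_up[OF True] True by simp
  qed simp
qed

lemma distr_sup_up:
  fixes Q :: "'c measure"
  assumes Q: "prob_space Q" and U: "U \<in> borel_measurable Q"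
    and unif: "distr Q borel U = uniform_measure lborel {0<..<1}"
  shows "distr P borel sup_up = distr Q borel (\<lambda>\<omega>. 1 / U \<omega>)"
proof (rule cdf_unique)
  interpret Q: prob_space Q by fact
  have V: "(\<lambda>\<omega>. 1 / U \<omega>) \<in> borel_measurable Q"
    by (rule borel_measurable_divide[OF borel_measurable_const U])
  show "real_distribution (distr P borel sup_up)" by (rule real_distribution_distr[OF meas_sup_up])
  show "real_distribution (distr Q borel (\<lambda>\<omega>. 1 / U \<omega>))" by (rule Q.real_distribution_distr[OF V])
  show "cdf (distr P borel sup_up) = cdf (distr Q borel (\<lambda>\<omega>. 1 / U \<omega>))"
  proof
    fix x
    have "cdf (distr P borel sup_up) x = prob (sup_up -` {..x} \<inter> space P)"
      unfolding cdf_def by (rule measure_distr[OF meas_sup_up]) simp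
    also have "sup_up -` {..x} \<inter> space P = {\<omega>\<in>space P. sup_up \<omega> \<le> x}" by auto
    finally have 1: "cdf (distr P borel sup_up) x = 1 - 1 / max x 1" by (simp only: prob_sup_up_le)
    have "(\<lambda>u::real. 1 / u) \<in> borel_measurable borel"
      by (intro borel_measurable_divide borel_measurable_const measurable_ident_sets) simp
    from measurable_sets[OF this, of "{..x}"] have B: "{u::real. 1 / u \<le> x} \<in> sets borel"
      by (simp add: vimage_def)
    have "cdf (distr Q borel (\<lambda>\<omega>. 1 / U \<omega>)) x = Q.prob ((\<lambda>\<omega>. 1 / U \<omega>) -` {..x} \<inter> space Q)"
      unfolding cdf_def by (rule measure_distr[OF V]) simp
    also have "(\<lambda>\<omega>. 1 / U \<omega>) -` {..x} \<inter> space Q = U -` {u. 1 / u \<le> x} \<inter> space Q" by auto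
    also have "Q.prob (U -` {u. 1 / u \<le> x} \<inter> space Q) = measure (distr Q borel U) {u. 1 / u \<le> x}"
      by (rule measure_distr[OF U B, symmetric])
    also have "\<dots> = measure lborel ({0<..<1} \<inter> {u. 1 / u \<le> x}) / measure lborel {0<..<1::real}"
      unfolding unif using B by (intro measure_uniform_measure) auto
    also have "{0<..<1} \<inter> {u::real. 1 / u \<le> x} = (if x > 1 then {1 / x..<1} else {})"
    proof (cases "x > 1")
      case True
      have "u \<in> {0<..<1} \<inter> {u. 1 / u \<le> x} \<longleftrightarrow> u \<in> {1 / x..<1}" for u
      proof (cases "0 < u")
        case u: True
        then have "1 / u \<le> x \<longleftrightarrow> 1 / x \<le> u" using True by (simp add: field_simps)
        then show ?thesis using u by auto
      next
        case False
        moreover have "0 < 1 / x" using True by simp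
        ultimately have "\<not> 1 / x \<le> u" by linarith
        then show ?thesis using False by simp
      qed
      then have "{0<..<1} \<inter> {u::real. 1 / u \<le> x} = {1 / x..<1}" by (rule set_eqI)
      then show ?thesis using True by simp
    next
      case False
      have "1 < 1 / u" if "0 < u" "u < 1" for u :: real using that by simp
      then show ?thesis using False by fastforce
    qed
    also have "measure lborel \<dots> / measure lborel {0<..<1::real} = 1 - 1 / max x 1"
      by (cases "x > 1") auto
    finally show "cdf (distr P borel sup_up) x = cdf (distr Q borel (\<lambda>\<omega>. 1 / U \<omega>)) x" using 1 by simp
  qed
qed

lemma eq_in_dist_sup_up:
  fixes Q :: "'c measure"
  assumes Q: "prob_space Q" and U: "U \<in> borel_measurable Q"
    and unif: "distr Q borel U = uniform_measure lborel {0<..<1}"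
  shows "eq_in_dist P (\<lambda>\<omega>. 1 / s * sup_up \<omega> powr s) Q (\<lambda>\<omega>. 1 / (s * U \<omega> powr s))"
proof -
  let ?g = "\<lambda>v::real. 1 / s * v powr s"
  have g: "?g \<in> borel_measurable borel" by measurable
  have V: "(\<lambda>\<omega>. 1 / U \<omega>) \<in> borel_measurable Q"
    by (rule borel_measurable_divide[OF borel_measurable_const U])
  have eq: "(\<lambda>\<omega>. 1 / (s * U \<omega> powr s)) = (\<lambda>\<omega>. ?g (1 / U \<omega>))" by (simp add: powr_divide)
  have "distr P borel (\<lambda>\<omega>. ?g (sup_up \<omega>)) = distr (distr P borel sup_up) borel ?g"
    using distr_distr[OF g meas_sup_up] by (simp add: comp_def)
  moreover have "distr Q borel (\<lambda>\<omega>. ?g (1 / U \<omega>)) = distr (distr Q borel (\<lambda>\<omega>. 1 / U \<omega>)) borel ?g"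
    using distr_distr[OF g V] by (simp add: comp_def)
  ultimately have "distr P borel (\<lambda>\<omega>. ?g (sup_up \<omega>)) = distr Q borel (\<lambda>\<omega>. ?g (1 / U \<omega>))"
    by (simp only: distr_sup_up[OF Q U unif])
  moreover have "(\<lambda>\<omega>. ?g (sup_up \<omega>)) \<in> borel_measurable P" by (rule measurable_compose[OF meas_sup_up g])
  moreover have "(\<lambda>\<omega>. ?g (1 / U \<omega>)) \<in> borel_measurable Q" by (rule measurable_compose[OF V g])
  ultimately show ?thesis unfolding eq_in_dist_def eq by blast
qed

end

section \<open>The goodness-of-fit statistics\<close>

lemma cnt_transform:
  assumes "s \<ge> 1 \<or> s < 0" "0 < x" "x < 1"
  shows "cnt (\<lambda>i \<omega>. F_dist s (X i \<omega>)) n {..F_dist s x} \<omega> = cnt X n {..x} \<omega>"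
  unfolding cnt_def by (rule arg_cong[where f = card]) (auto simp: F_dist_le_iff[OF assms])

lemma emp_cdf_eq_cnt: "emp_cdf X n \<omega> x = real (cnt X n {..x} \<omega>) / real n"
proof -
  have "(\<Sum>i = 1..n. indicator {..x} (X i \<omega>)) = real (cnt X n {..x} \<omega>)"
    by (induction n) (auto simp: cnt_Suc indicator_def)
  then show ?thesis by (simp add: emp_cdf_def)
qed

lemma uniform_sample_F_dist:
  assumes M: "prob_space M" and s: "s \<ge> 1 \<or> s < 0" and iid: "iid_with_cdf M X (F_dist s)"
  shows "uniform_sample M (\<lambda>i \<omega>. F_dist s (X i \<omega>))"
proof -
  interpret prob_space M by fact
  have ind: "indep_vars (\<lambda>_. borel) X {1..}" and cdf: "\<And>i. i \<ge> 1 \<Longrightarrow> cdf (distr M borel (X i)) = F_dist s"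
    using iid by (auto simp: iid_with_cdf_def)
  have F: "F_dist s \<in> borel_measurable borel" by (rule borel_measurable_mono[OF F_dist_mono[OF s]])
  have X: "X i \<in> borel_measurable M" if "i \<ge> 1" for i using ind that by (auto simp: indep_vars_def)
  have FX: "(\<lambda>\<omega>. F_dist s (X i \<omega>)) \<in> borel_measurable M" if "i \<ge> 1" for i
    by (rule measurable_compose[OF X[OF that] F])
  have ev: "{\<omega>\<in>space M. F_dist s (X i \<omega>) \<le> y} \<in> events" if "i \<ge> 1" for i y
    using FX[OF that] by (simp add: borel_measurable_iff_le)
  have mid: "prob {\<omega>\<in>space M. F_dist s (X i \<omega>) \<le> y} = y" if i: "i \<ge> 1" and y: "0 < y" "y < 1" for i y
  proof -
    obtain x where x: "0 < x" "x < 1" "F_dist s x = y" using F_dist_surj[OF s y] by blast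
    have "{\<omega>\<in>space M. F_dist s (X i \<omega>) \<le> y} = X i -` {..x} \<inter> space M"
      using F_dist_le_iff[OF s x(1,2)] x(3) by auto
    then have "prob {\<omega>\<in>space M. F_dist s (X i \<omega>) \<le> y} = measure (distr M borel (X i)) {..x}"
      using measure_distr[OF X[OF i], of "{..x}"] by simp
    also have "\<dots> = F_dist s x" using cdf[OF i] by (simp add: cdf_def fun_eq_iff)
    finally show ?thesis using x by simp
  qed
  show ?thesis
  proof
    show "indep_vars (\<lambda>_. borel) (\<lambda>i \<omega>. F_dist s (X i \<omega>)) {1..}"
      by (rule indep_vars_compose2[OF ind, where Y = "\<lambda>_. F_dist s" and N = "\<lambda>_. borel"]) (rule F)
    show "F_dist s (X i \<omega>) \<in> {0..1}" for i \<omega> using F_dist_range[OF s] by auto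
    show "prob {\<omega>\<in>space M. F_dist s (X i \<omega>) \<le> y} = y" if i: "1 \<le> i" and y: "0 \<le> y" "y \<le> 1" for i y
    proof -
      consider "y = 0" | "y = 1" | "0 < y" "y < 1" using y by linarith
      then show ?thesis
      proof cases
        case 1
        \<comment> \<open>The value 0 is attained on the whole negative axis, so y = 0 is reached
          through small positive levels instead of by inversion.\<close>
        have "prob {\<omega>\<in>space M. F_dist s (X i \<omega>) \<le> 0} \<le> 0"
        proof (rule dense_ge)
          fix z :: real assume z: "0 < z"
          have "prob {\<omega>\<in>space M. F_dist s (X i \<omega>) \<le> 0} \<le> prob {\<omega>\<in>space M. F_dist s (X i \<omega>) \<le> min z (1 / 2)}"
            using z by (intro finite_measure_mono ev[OF i]) auto
          also have "\<dots> = min z (1 / 2)" using z by (intro mid[OF i]) auto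
          finally show "prob {\<omega>\<in>space M. F_dist s (X i \<omega>) \<le> 0} \<le> z" by simp
        qed
        then show ?thesis using 1 by (simp add: measure_le_0_iff)
      next
        case 2
        have "{\<omega>\<in>space M. F_dist s (X i \<omega>) \<le> 1} = space M" using F_dist_range[OF s] by auto
        then show ?thesis using 2 prob_space by simp
      next
        case 3 then show ?thesis by (rule mid[OF i])
      qed
    qed
  qed
qed

lemma order_stat_first_le_iff:
  assumes "n \<ge> 1" shows "order_stat X n 1 \<omega> \<le> x \<longleftrightarrow> 1 \<le> cnt X n {..x} \<omega>"
proof -
  define xs where "xs = map (\<lambda>i. X i \<omega>) [1..<Suc n]"
  have xs: "xs \<noteq> []" "set xs = (\<lambda>i. X i \<omega>) ` {1..n}"
    using assms by (simp_all add: xs_def atLeastLessThanSuc_atLeastAtMost del: upt_Suc)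
  have "sort xs ! 0 \<le> x \<longleftrightarrow> (\<exists>y\<in>set xs. y \<le> x)"
  proof
    assume "sort xs ! 0 \<le> x"
    moreover have "sort xs ! 0 \<in> set xs" using nth_mem[of 0 "sort xs"] xs(1) by simp
    ultimately show "\<exists>y\<in>set xs. y \<le> x" by blast
  next
    assume "\<exists>y\<in>set xs. y \<le> x"
    then obtain y where y: "y \<in> set (sort xs)" "y \<le> x" by auto
    from y(1) obtain k where k: "k < length (sort xs)" "sort xs ! k = y" unfolding in_set_conv_nth by blast
    have "sort xs ! 0 \<le> sort xs ! k" using k by (intro sorted_nth_mono) auto
    then show "sort xs ! 0 \<le> x" using k y by simp
  qed
  also have "\<dots> \<longleftrightarrow> {i\<in>{1..n}. X i \<omega> \<in> {..x}} \<noteq> {}" using xs(2) by auto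
  also have "\<dots> \<longleftrightarrow> 1 \<le> cnt X n {..x} \<omega>" unfolding cnt_def by (simp add: Suc_le_eq card_gt_0_iff)
  finally show ?thesis by (simp add: order_stat_def xs_def)
qed

text \<open>Together with \<open>order_stat_first_le_iff\<close> it turns the index set of the
  statistic for s < 1 into 0 < count < n, free of sorting.\<close>

lemma less_order_stat_last_iff:
  assumes "n \<ge> 1" shows "x < order_stat X n n \<omega> \<longleftrightarrow> cnt X n {..x} \<omega> < n"
proof -
  define xs where "xs = map (\<lambda>i. X i \<omega>) [1..<Suc n]"
  have xs: "length xs = n" "set xs = (\<lambda>i. X i \<omega>) ` {1..n}"
    by (simp_all add: xs_def atLeastLessThanSuc_atLeastAtMost del: upt_Suc)
  have "x < sort xs ! (n - 1) \<longleftrightarrow> (\<exists>y\<in>set xs. x < y)"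
  proof
    assume "x < sort xs ! (n - 1)"
    moreover have "sort xs ! (n - 1) \<in> set xs" using nth_mem[of "n - 1" "sort xs"] xs(1) assms by simp
    ultimately show "\<exists>y\<in>set xs. x < y" by blast
  next
    assume "\<exists>y\<in>set xs. x < y"
    then obtain y where y: "y \<in> set (sort xs)" "x < y" by auto
    from y(1) obtain k where k: "k < length (sort xs)" "sort xs ! k = y" unfolding in_set_conv_nth by blast
    have "sort xs ! k \<le> sort xs ! (n - 1)" using k xs(1) by (intro sorted_nth_mono) auto
    then show "x < sort xs ! (n - 1)" using k y by simp
  qed
  also have "\<dots> \<longleftrightarrow> \<not> (\<forall>i\<in>{1..n}. X i \<omega> \<le> x)" using xs(2) by (auto simp: not_le)
  also have "\<dots> \<longleftrightarrow> cnt X n {..x} \<omega> < n"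
  proof -
    have "(\<forall>i\<in>{1..n}. X i \<omega> \<le> x) \<longleftrightarrow> {i\<in>{1..n}. X i \<omega> \<in> {..x}} = {1..n}" by auto
    also have "\<dots> \<longleftrightarrow> card {i\<in>{1..n}. X i \<omega> \<in> {..x}} = card {1..n}"
    proof
      assume "card {i\<in>{1..n}. X i \<omega> \<in> {..x}} = card {1..n}"
      then show "{i\<in>{1..n}. X i \<omega> \<in> {..x}} = {1..n}" by (intro card_subset_eq) auto
    qed simp
    finally show ?thesis using cnt_le[of X n "{..x}" \<omega>] by (auto simp: cnt_def)
  qed
  finally show ?thesis by (simp add: order_stat_def xs_def)
qed

lemma S_stat_ge_1:
  "s \<ge> 1 \<Longrightarrow> S_stat s X n \<omega> = (SUP x\<in>{0<..<1}. K s (real (cnt X n {..x} \<omega>) / real n) x)"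
  by (simp add: S_stat_def emp_cdf_eq_cnt)

lemma S_stat_less_1:
  assumes "s < 1" "n \<ge> 1"
  shows "S_stat s X n \<omega> = (SUP x\<in>{x. 0 < cnt X n {..x} \<omega> \<and> cnt X n {..x} \<omega> < n}. K s (real (cnt X n {..x} \<omega>) / real n) x)"
proof -
  have "{order_stat X n 1 \<omega>..<order_stat X n n \<omega>} = {x. 0 < cnt X n {..x} \<omega> \<and> cnt X n {..x} \<omega> < n}"
    using order_stat_first_le_iff[OF assms(2), of X \<omega>] less_order_stat_last_iff[OF assms(2), of _ X \<omega>]
    by (auto simp: Suc_le_eq)
  then show ?thesis using assms(1) by (simp add: S_stat_def emp_cdf_eq_cnt)
qed

section \<open>Measurability of the statistics\<close>

lemma cnt_right_const: "\<exists>d>0. \<forall>u. x \<le> u \<and> u < x + d \<longrightarrow> cnt X n {..u} \<omega> = cnt X n {..x} \<omega>"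
proof -
  let ?S = "{X i \<omega> - x |i. i \<in> {1..n} \<and> x < X i \<omega>}"
  have fin: "finite ?S" by simp
  \<comment> \<open>The least gap to an observation on the right; 1 is inserted for the case that
    there is none.\<close>
  define d where "d = Min (insert 1 ?S)"
  have d: "d > 0" unfolding d_def using fin by (subst Min_gr_iff) auto
  have "cnt X n {..u} \<omega> = cnt X n {..x} \<omega>" if u: "x \<le> u" "u < x + d" for u
  proof -
    have "\<not> X i \<omega> \<le> u" if "i \<in> {1..n}" "x < X i \<omega>" for i
    proof -
      have "d \<le> X i \<omega> - x" unfolding d_def using fin that by (intro Min_le) auto
      then show ?thesis using u by simp
    qed
    then have "{i\<in>{1..n}. X i \<omega> \<in> {..u}} = {i\<in>{1..n}. X i \<omega> \<in> {..x}}"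
      using u(1) by (intro Collect_cong) (metis atMost_iff not_le order_trans)
    then show ?thesis by (simp add: cnt_def)
  qed
  then show ?thesis using d by blast
qed

lemma tendsto_K_right:
  assumes "x \<noteq> 0" "x \<noteq> 1" shows "((\<lambda>v. K s u v) \<longlongrightarrow> K s u x) (at_right x)"
proof (cases "s = 1")
  case True
  have a: "((\<lambda>v. u * ln (u / v)) \<longlongrightarrow> u * ln (u / x)) (at_right x)"
    using assms by (cases "u = 0") (auto intro!: tendsto_intros)
  have b: "((\<lambda>v. (1 - u) * ln ((1 - u) / (1 - v))) \<longlongrightarrow> (1 - u) * ln ((1 - u) / (1 - x))) (at_right x)"
    using assms by (cases "u = 1") (auto intro!: tendsto_intros)
  show ?thesis using tendsto_add[OF a b] True by (simp add: K_def)
next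
  case False
  have "((\<lambda>v. 1 - u powr s * v powr (1 - s) - (1 - u) powr s * (1 - v) powr (1 - s)) \<longlongrightarrow>
      1 - u powr s * x powr (1 - s) - (1 - u) powr s * (1 - x) powr (1 - s)) (at_right x)"
    using assms by (intro tendsto_diff tendsto_mult tendsto_const tendsto_powr tendsto_ident_at) auto
  from tendsto_mult[OF tendsto_const[of "1 / (s * (1 - s))"] this] show ?thesis
    using False by (simp add: K_def)
qed

text \<open>x is any real number, because observations may leave (0,1) on a null event and
  measurability is needed there too. At 0 and 1, where right continuity of \<open>K\<close> may
  fail, x itself is rational; elsewhere a rational just to its right has the same count.\<close>

lemma K_cnt_dense:
  assumes b: "b < K s (real (cnt X n {..x} \<omega>) / real n) x"
  obtains q where "q \<in> \<rat>" "x \<le> q" "x < 1 \<Longrightarrow> q < 1" "cnt X n {..q} \<omega> = cnt X n {..x} \<omega>"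
    "b < K s (real (cnt X n {..q} \<omega>) / real n) q"
proof (cases "x = 0 \<or> x = 1")
  case True
  then have "x \<in> \<rat>" by auto
  then show ?thesis using that[of x] b by simp
next
  case False
  then have x: "x \<noteq> 0" "x \<noteq> 1" by auto
  obtain d where d: "d > 0" "\<forall>u. x \<le> u \<and> u < x + d \<longrightarrow> cnt X n {..u} \<omega> = cnt X n {..x} \<omega>"
    using cnt_right_const[of x X n \<omega>] by blast
  from order_tendstoD(1)[OF tendsto_K_right[OF x] b]
  obtain y where y: "x < y" "\<And>v. x < v \<Longrightarrow> v < y \<Longrightarrow> b < K s (real (cnt X n {..x} \<omega>) / real n) v"
    unfolding eventually_at_right_field by blast
  \<comment> \<open>Keeps q below 1 whenever x is, so that q stays in the index set (0,1).\<close>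
  define z where "z = (if x < 1 then 1 else x + 1)"
  have z: "x < z" by (simp add: z_def)
  obtain q where q: "q \<in> \<rat>" "x < q" "q < min z (min y (x + d))"
    using Rats_dense_in_real[of x "min z (min y (x + d))"] y(1) d(1) z by auto
  have c: "cnt X n {..q} \<omega> = cnt X n {..x} \<omega>" using d(2)[rule_format, of q] q by simp
  show ?thesis
  proof (rule that[of q])
    show "x < 1 \<Longrightarrow> q < 1" using q by (simp add: z_def)
    show "b < K s (real (cnt X n {..q} \<omega>) / real n) q" unfolding c using q by (intro y(2)) auto
  qed (use q c in auto)
qed

lemma measurable_cnt_comp:
  assumes "\<And>i. 1 \<le> i \<Longrightarrow> X i \<in> borel_measurable M"
  shows "(\<lambda>\<omega>. g (cnt X n {..a} \<omega>) :: real) \<in> borel_measurable M"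
  by (rule measurable_compose[OF measurable_cnt borel_measurable_count_space]) (use assms in auto)

lemma measurable_S_stat_ge_1:
  assumes X: "\<And>i. 1 \<le> i \<Longrightarrow> X i \<in> borel_measurable M" and s: "s \<ge> 1"
  shows "S_stat s X n \<in> borel_measurable M"
proof -
  have "(\<lambda>\<omega>. SUP x\<in>{x. 0 < x \<and> x < 1}. K s (real (cnt X n {..x} \<omega>) / real n) x) \<in> borel_measurable M"
  proof (rule borel_measurable_SUP_countable_dense[where R = "\<rat>"])
    show "countable (\<rat> :: real set)" by (rule countable_rat)
    show "{\<omega>\<in>space M. 0 < q \<and> q < 1} \<in> sets M" for q :: real by (rule sets.sets_Collect_const)
    show "(\<lambda>\<omega>. K s (real (cnt X n {..q} \<omega>) / real n) q) \<in> borel_measurable M" for q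
      by (rule measurable_cnt_comp[OF X, where g = "\<lambda>c. K s (real c / real n) q"])
    fix \<omega> x b assume x: "0 < x \<and> x < 1" and b: "b < K s (real (cnt X n {..x} \<omega>) / real n) x"
    from K_cnt_dense[OF b] obtain q where "q \<in> \<rat>" "x \<le> q" "q < 1" "b < K s (real (cnt X n {..q} \<omega>) / real n) q"
      using x by metis
    then show "\<exists>q\<in>\<rat>. (0 < q \<and> q < 1) \<and> b < K s (real (cnt X n {..q} \<omega>) / real n) q"
      using x by (intro bexI[of _ q]) auto
  qed
  then show ?thesis by (simp add: S_stat_ge_1[OF s] greaterThanLessThan_eq greaterThan_def lessThan_def Int_def cong: measurable_cong)
qed

lemma measurable_S_stat_less_1:
  assumes X: "\<And>i. 1 \<le> i \<Longrightarrow> X i \<in> borel_measurable M" and s: "s < 1"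
  shows "S_stat s X n \<in> borel_measurable M"
proof (cases "n = 0")
  case True
  \<comment> \<open>For n = 0 the order statistics are entries of an empty list, hence fixed values,
    and the statistic is constant.\<close>
  have "S_stat s X 0 = (\<lambda>\<omega>. S_stat s X 0 undefined)"
    using s by (simp add: S_stat_def order_stat_def emp_cdf_def fun_eq_iff)
  then show ?thesis using True by (metis borel_measurable_const)
next
  case False
  then have n: "n \<ge> 1" by simp
  have m: "{\<omega>\<in>space M. Q (cnt X n {..q} \<omega>)} \<in> sets M" for q Q
  proof -
    have "cnt X n {..q} -` {x. Q x} \<inter> space M \<in> sets M"
      by (rule measurable_sets[OF measurable_cnt]) (use X in auto)
    moreover have "cnt X n {..q} -` {x. Q x} \<inter> space M = {\<omega>\<in>space M. Q (cnt X n {..q} \<omega>)}" by auto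
    ultimately show ?thesis by simp
  qed
  have "(\<lambda>\<omega>. SUP x\<in>{x. 0 < cnt X n {..x} \<omega> \<and> cnt X n {..x} \<omega> < n}. K s (real (cnt X n {..x} \<omega>) / real n) x) \<in> borel_measurable M"
  proof (rule borel_measurable_SUP_countable_dense[where R = "\<rat>"])
    show "countable (\<rat> :: real set)" by (rule countable_rat)
    show "{\<omega>\<in>space M. 0 < cnt X n {..q} \<omega> \<and> cnt X n {..q} \<omega> < n} \<in> sets M" for q :: real
      by (rule m)
    show "(\<lambda>\<omega>. K s (real (cnt X n {..q} \<omega>) / real n) q) \<in> borel_measurable M" for q
      by (rule measurable_cnt_comp[OF X, where g = "\<lambda>c. K s (real c / real n) q"])
    fix \<omega> x b assume x: "0 < cnt X n {..x} \<omega> \<and> cnt X n {..x} \<omega> < n"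
      and b: "b < K s (real (cnt X n {..x} \<omega>) / real n) x"
    from K_cnt_dense[OF b] obtain q where "q \<in> \<rat>" "cnt X n {..q} \<omega> = cnt X n {..x} \<omega>"
      "b < K s (real (cnt X n {..q} \<omega>) / real n) q" by metis
    then show "\<exists>q\<in>\<rat>. (0 < cnt X n {..q} \<omega> \<and> cnt X n {..q} \<omega> < n) \<and> b < K s (real (cnt X n {..q} \<omega>) / real n) q"
      using x by (intro bexI[of _ q]) auto
  qed
  moreover have "S_stat s X n = (\<lambda>\<omega>. SUP x\<in>{x. 0 < cnt X n {..x} \<omega> \<and> cnt X n {..x} \<omega> < n}. K s (real (cnt X n {..x} \<omega>) / real n) x)"
    by (rule ext) (rule S_stat_less_1[OF s n])
  ultimately show ?thesis by simp
qed

section \<open>Linear bounds on counting functions from bounds on a grid\<close>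

lemma upper_line_of_grid:
  fixes c :: "real \<Rightarrow> nat"
  assumes mono: "\<And>x y. x \<le> y \<Longrightarrow> c x \<le> c y" and q: "q > 0" and n: "n \<ge> 1"
    and grid: "\<And>k. k \<ge> m \<Longrightarrow> c (real k * q / real n) < k" and y: "0 \<le> y" "real m * q \<le> real n * y + q"
  shows "q * real (c y) \<le> real n * y"
proof -
  \<comment> \<open>y lies below the grid point with index j + 1, where the count is at most j; the
    last premise ensures j + 1 >= m.\<close>
  define j where "j = nat \<lfloor>real n * y / q\<rfloor>"
  have "0 \<le> real n * y / q" using y q by simp
  then have j: "real j \<le> real n * y / q" "real n * y / q < real (Suc j)" unfolding j_def by linarith+
  have "real m \<le> real n * y / q + 1" using y q by (simp add: field_simps)
  then have "real m < real (Suc (Suc j))" using j by simp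
  then have m: "m \<le> Suc j" by simp
  have "y \<le> real (Suc j) * q / real n" using j q n by (simp add: field_simps)
  then have "c y \<le> c (real (Suc j) * q / real n)" by (rule mono)
  also have "\<dots> < Suc j" by (rule grid[OF m])
  finally have "real (c y) \<le> real n * y / q" using j by simp
  then show ?thesis using q by (simp add: field_simps)
qed

text \<open>The slope q2, to be thought of as close to 1, holds away from the end. Within about m
  grid steps of it only the crude slope q1 is left, but there at most m observations are
  counted.\<close>

lemma upper_line_dichotomy:
  fixes c :: "real \<Rightarrow> nat"
  assumes mono: "\<And>x y. x \<le> y \<Longrightarrow> c x \<le> c y" and q: "q1 > 0" "q2 > 0" and n: "n \<ge> 1"
    and grid1: "\<And>k. k \<ge> 1 \<Longrightarrow> c (real k * q1 / real n) < k"
    and grid2: "\<And>k. k \<ge> m \<Longrightarrow> c (real k * q2 / real n) < k" and y: "0 \<le> y"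
  shows "q2 * real (c y) \<le> real n * y \<or> (c y \<le> m \<and> q1 * real (c y) \<le> real n * y)"
proof (cases "real m * q2 \<le> real n * y + q2")
  case True
  then show ?thesis using upper_line_of_grid[OF mono q(2) n grid2 y] by blast
next
  case False
  have "q1 * real (c y) \<le> real n * y"
    using y n q by (intro upper_line_of_grid[OF mono q(1) n grid1 y]) auto
  moreover have "c y \<le> m"
  proof -
    have "y \<le> real m * q2 / real n" using False q n by (simp add: field_simps)
    then have "c y \<le> c (real m * q2 / real n)" by (rule mono)
    then show ?thesis using grid2[of m] by simp
  qed
  ultimately show ?thesis by blast
qed

text \<open>A grid point k q/n < w with k >= j would have more than j counts, against the bound to
  the left of w. For m <= j this is used at k = j with q2; for j < m it is used at k = m with q2 and
  at k = j with q1. Bounding the count strictly before w only leaves room for a jump at w.\<close>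

lemma lower_line_dichotomy:
  fixes c :: "real \<Rightarrow> nat"
  assumes n: "m < n" and j: "1 \<le> j" "j < n"
    and grid1: "\<And>k. k \<ge> 1 \<Longrightarrow> k < n \<Longrightarrow> k < c (real k * q1 / real n)"
    and grid2: "\<And>k. k \<ge> m \<Longrightarrow> k < n \<Longrightarrow> k < c (real k * q2 / real n)"
    and c: "\<And>v. v < w \<Longrightarrow> c v \<le> j"
  shows "real n * w \<le> q2 * real j \<or> (real n * w \<le> q2 * real m \<and> real n * w \<le> q1 * real j)"
proof (rule ccontr)
  assume "\<not> ?thesis"
  then have 2: "q2 * real j < real n * w" and 1: "q2 * real m < real n * w \<or> q1 * real j < real n * w" by auto
  have at: "\<not> q * real k < real n * w" if "j < c (real k * q / real n)" for k q
  proof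
    assume "q * real k < real n * w"
    then have "real k * q / real n < w" using n by (simp add: field_simps)
    from c[OF this] that show False by simp
  qed
  have jm: "\<not> m \<le> j" using at[of j q2] grid2[of j] j 2 by auto
  have "\<not> q1 * real j < real n * w" using at[of j q1] grid1[of j] j by auto
  moreover have "\<not> q2 * real m < real n * w" using at[of m q2] grid2[of m] n jm by auto
  ultimately show False using 1 by blast
qed

section \<open>Tail bounds uniform in n, and absence of ties\<close>

context uniform_sample
begin

lemma sets_cnt: "{\<omega>\<in>space M. Q (cnt Y n {..a} \<omega>)} \<in> events"
proof -
  have "cnt Y n {..a} -` {x. Q x} \<inter> space M \<in> events" by (rule measurable_sets[OF meas_cnt']) simp
  moreover have "cnt Y n {..a} -` {x. Q x} \<inter> space M = {\<omega>\<in>space M. Q (cnt Y n {..a} \<omega>)}" by auto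
  ultimately show ?thesis by simp
qed

text \<open>Markov's inequality for 2^count. The bound is free of n, so the counts at level t/n stay
  bounded in probability.\<close>

lemma prob_cnt_large:
  assumes n: "n \<ge> 1" and t: "0 \<le> t" "t \<le> real n"
  shows "prob {\<omega>\<in>space M. b \<le> cnt Y n {..t / real n} \<omega>} \<le> exp t / 2 ^ b"
proof -
  have y: "0 \<le> t / real n" "t / real n \<le> 1" using n t by auto
  have "prob {\<omega>\<in>space M. b \<le> cnt Y n {..t / real n} \<omega>} = prob {\<omega>\<in>space M. (2::real) ^ b \<le> 2 ^ cnt Y n {..t / real n} \<omega>}"
    by simp
  also have "\<dots> \<le> expectation (\<lambda>\<omega>. 2 ^ cnt Y n {..t / real n} \<omega>) / 2 ^ b"
    using y by (intro integral_Markov_inequality_measure[where A = "{}"] expectation_power_cnt) auto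
  also have "\<dots> = (1 + t / real n) ^ n / 2 ^ b" using y by (subst expectation_power_cnt) auto
  also have "\<dots> \<le> exp (t / real n) ^ n / 2 ^ b"
    using y by (intro divide_right_mono power_mono exp_ge_add_one_self) auto
  also have "exp (t / real n) ^ n = exp t" using n by (simp add: exp_of_nat_mult[symmetric])
  finally show ?thesis .
qed

lemma prob_cnt_zero:
  assumes y: "0 \<le> y" "y \<le> 1"
  shows "prob {\<omega>\<in>space M. cnt Y n {..y} \<omega> = 0} \<le> (1 - y / 2) ^ n"
proof -
  have "prob {\<omega>\<in>space M. cnt Y n {..y} \<omega> = 0} \<le> prob {\<omega>\<in>space M. 1 \<le> (1 / 2 :: real) ^ cnt Y n {..y} \<omega>}"
    by (intro finite_measure_mono sets_cnt[where Q = "\<lambda>c. 1 \<le> (1 / 2 :: real) ^ c"]) auto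
  also have "\<dots> \<le> expectation (\<lambda>\<omega>. (1 / 2) ^ cnt Y n {..y} \<omega>) / 1"
    using y by (intro integral_Markov_inequality_measure[where A = "{}"] expectation_power_cnt) auto
  also have "\<dots> = (1 - y / 2) ^ n" using y by (subst expectation_power_cnt) (auto simp: algebra_simps)
  finally show ?thesis .
qed

lemma prob_both_in_cell:
  assumes "1 \<le> i" "1 \<le> j" "i \<noteq> j" "h \<ge> 0" "real (Suc l) * h \<le> 1"
  shows "prob {\<omega>\<in>space M. Y i \<omega> \<in> cell h l \<and> Y j \<omega> \<in> cell h l} = h\<^sup>2"
proof -
  have "prob (\<Inter>k\<in>{i, j}. Y k -` cell h l \<inter> space M) = (\<Prod>k\<in>{i, j}. prob (Y k -` cell h l \<inter> space M))"
    using assms by (intro indep_varsD[OF indep] cell_borel) auto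
  moreover have "Y k -` cell h l \<inter> space M = {\<omega>\<in>space M. Y k \<omega> \<in> cell h l}" for k by auto
  moreover have "(\<Inter>k\<in>{i, j}. Y k -` cell h l \<inter> space M) = {\<omega>\<in>space M. Y i \<omega> \<in> cell h l \<and> Y j \<omega> \<in> cell h l}" by auto
  ultimately show ?thesis using assms prob_cell by (simp add: power2_eq_square)
qed

text \<open>Equal observations share a cell of every mesh, and a given pair shares one of p + 1
  cells with probability 1/(p+1).\<close>

lemma AE_distinct: "AE \<omega> in M. \<forall>i\<ge>1. \<forall>j\<ge>1. i \<noteq> j \<longrightarrow> Y i \<omega> \<noteq> Y j \<omega>"
proof -
  have "AE \<omega> in M. 1 \<le> i \<longrightarrow> 1 \<le> j \<longrightarrow> i \<noteq> j \<longrightarrow> Y i \<omega> \<noteq> Y j \<omega>" for i j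
  proof (cases "1 \<le> i \<and> 1 \<le> j \<and> i \<noteq> j")
    case ij: True
    define A where "A p l = {\<omega>\<in>space M. Y i \<omega> \<in> cell (1 / real (Suc p)) l \<and> Y j \<omega> \<in> cell (1 / real (Suc p)) l}" for p l
    have A: "A p l \<in> events" for p l
    proof -
      have Yk: "Y k -` cell (1 / real (Suc p)) l \<inter> space M \<in> events" if "1 \<le> k" for k
        by (rule measurable_sets[OF meas[OF that] cell_borel])
      have "1 \<le> i" "1 \<le> j" using ij by auto
      from sets.Int[OF Yk[OF this(1)] Yk[OF this(2)]] show ?thesis unfolding A_def by (rule back_subst[of "\<lambda>A. A \<in> events"]) auto
    qed
    define B where "B = {\<omega>\<in>space M. Y i \<omega> = Y j \<omega>}"
    have [measurable]: "Y i \<in> borel_measurable M" "Y j \<in> borel_measurable M"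
      using meas ij by auto
    have B: "B \<in> events" unfolding B_def by measurable
    have "prob B \<le> 1 / real (Suc p)" for p
    proof -
      have "B \<subseteq> (\<Union>l<Suc p. A p l)"
      proof
        fix \<omega> assume w: "\<omega> \<in> B"
        have "real (Suc p) * (1 / real (Suc p)) = 1" by simp
        then have "Y i \<omega> \<in> (\<Union>l<Suc p. cell (1 / real (Suc p)) l)"
          using range[of i \<omega>] ij w by (subst UN_cell) (auto simp: B_def)
        then show "\<omega> \<in> (\<Union>l<Suc p. A p l)" using w by (auto simp: A_def B_def)
      qed
      then have "prob B \<le> prob (\<Union>l<Suc p. A p l)"
        using A by (intro finite_measure_mono sets.finite_UN) auto
      also have "\<dots> \<le> (\<Sum>l<Suc p. prob (A p l))"
        using A by (intro finite_measure_subadditive_finite) auto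
      also have "\<dots> = (\<Sum>l<Suc p. (1 / real (Suc p))\<^sup>2)"
        unfolding A_def using ij by (intro sum.cong refl prob_both_in_cell) auto
      also have "\<dots> = 1 / real (Suc p)" by (simp add: power2_eq_square del: of_nat_Suc sum.lessThan_Suc)
      finally show ?thesis .
    qed
    moreover have "(\<lambda>p. 1 / real (Suc p)) \<longlonglongrightarrow> 0" by real_asymp
    ultimately have "prob B \<le> 0" by (intro LIMSEQ_le_const) auto
    then have "B \<in> null_sets M" using B by (simp add: null_sets_def emeasure_eq_measure measure_le_0_iff)
    then have "AE \<omega> in M. \<omega> \<notin> B" by (rule AE_not_in)
    then show ?thesis using AE_space by eventually_elim (auto simp: B_def)
  qed auto
  then have "AE \<omega> in M. \<forall>i j. 1 \<le> i \<longrightarrow> 1 \<le> j \<longrightarrow> i \<noteq> j \<longrightarrow> Y i \<omega> \<noteq> Y j \<omega>"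
    by (simp add: AE_all_countable)
  then show ?thesis by eventually_elim blast
qed

lemma upper_tail_small:
  assumes q: "0 < q" "q < 1" and e: "e > 0"
  shows "\<exists>m. \<forall>n\<ge>1. prob {\<omega>\<in>space M. \<exists>k\<ge>m. k \<le> cnt Y n {..real k * q / real n} \<omega>} \<le> e"
proof -
  have "(\<lambda>m. chernoff_rate q ^ m / (1 - chernoff_rate q)) \<longlonglongrightarrow> 0 / (1 - chernoff_rate q)"
    using q chernoff_rate_pos[of q] chernoff_rate_less_1[of q]
    by (intro tendsto_divide LIMSEQ_power_zero tendsto_const) auto
  from order_tendstoD(2)[OF this, of e] e obtain m where "chernoff_rate q ^ m / (1 - chernoff_rate q) < e"
    by (auto simp: eventually_sequentially)
  then show ?thesis using prob_upper_tail[OF q] by (intro exI[of _ m]) (meson less_imp_le order_trans)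
qed

lemma lower_tail_small:
  assumes q: "1 < q" and e: "e > 0"
  shows "\<exists>m. \<forall>n. prob {\<omega>\<in>space M. \<exists>k\<ge>m. k < n \<and> cnt Y n {..real k * q / real n} \<omega> \<le> k} \<le> e"
proof -
  have "(\<lambda>m. chernoff_rate q ^ m / (1 - chernoff_rate q)) \<longlonglongrightarrow> 0 / (1 - chernoff_rate q)"
    using q chernoff_rate_pos[of q] chernoff_rate_less_1[of q]
    by (intro tendsto_divide LIMSEQ_power_zero tendsto_const) auto
  from order_tendstoD(2)[OF this, of e] e obtain m where "chernoff_rate q ^ m / (1 - chernoff_rate q) < e"
    by (auto simp: eventually_sequentially)
  then show ?thesis using prob_lower_tail[OF q] by (intro exI[of _ m]) (meson less_imp_le order_trans)
qed

text \<open>All k >= 1 are covered by taking a small slope instead of a late starting index: this is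
  the crude slope that holds up to the end of the sample.\<close>

lemma upper_tail_small':
  assumes e: "e > 0"
  shows "\<exists>q>0. q < 1 \<and> (\<forall>n\<ge>1. prob {\<omega>\<in>space M. \<exists>k\<ge>1. k \<le> cnt Y n {..real k * q / real n} \<omega>} \<le> e)"
proof -
  have "((\<lambda>q. chernoff_rate q ^ 1 / (1 - chernoff_rate q)) \<longlongrightarrow> 0) (at_right 0)"
    unfolding chernoff_rate_def power_one_right by real_asymp
  from order_tendstoD(2)[OF this e] obtain b where b: "b > 0"
    "\<And>q. 0 < q \<Longrightarrow> q < b \<Longrightarrow> chernoff_rate q ^ 1 / (1 - chernoff_rate q) < e"
    unfolding eventually_at_right_field by blast
  define q where "q = min b 1 / 2"
  have q: "0 < q" "q < 1" "q < b" using b(1) by (auto simp: q_def min_def)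
  have "prob {\<omega>\<in>space M. \<exists>k\<ge>1. k \<le> cnt Y n {..real k * q / real n} \<omega>} \<le> e" if "n \<ge> 1" for n
    by (rule order_trans[OF prob_upper_tail[OF q(1,2) that] less_imp_le[OF b(2)[OF q(1,3)]]])
  then show ?thesis using q by blast
qed

lemma lower_tail_small':
  assumes e: "e > 0"
  shows "\<exists>q>1. \<forall>n. prob {\<omega>\<in>space M. \<exists>k\<ge>1. k < n \<and> cnt Y n {..real k * q / real n} \<omega> \<le> k} \<le> e"
proof -
  have "((\<lambda>q. chernoff_rate q ^ 1 / (1 - chernoff_rate q)) \<longlongrightarrow> 0) at_top"
    unfolding chernoff_rate_def power_one_right by real_asymp
  from eventually_conj[OF order_tendstoD(2)[OF this e] eventually_gt_at_top[of 1]]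
  obtain q where q: "q > 1" "chernoff_rate q ^ 1 / (1 - chernoff_rate q) < e"
    by (auto simp: eventually_at_top_linorder)
  have "prob {\<omega>\<in>space M. \<exists>k\<ge>1. k < n \<and> cnt Y n {..real k * q / real n} \<omega> \<le> k} \<le> e" for n
    by (rule order_trans[OF prob_lower_tail[OF q(1)] less_imp_le[OF q(2)]])
  then show ?thesis using q by blast
qed

end

lemma (in prob_space) prob_le_of_AE:
  assumes B: "B \<in> events" and C: "C \<in> events" and AE: "AE \<omega> in M. \<omega> \<in> A \<longrightarrow> \<omega> \<in> B \<or> \<omega> \<in> C"
    and e: "prob C \<le> e"
  shows "prob A \<le> prob B + e"
proof -
  have "prob A \<le> prob (B \<union> C)" using AE by (intro finite_measure_mono_AE sets.Un B C) auto
  also have "\<dots> \<le> prob B + prob C" by (rule measure_Un_le[OF B C])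
  finally show ?thesis using e by simp
qed

section \<open>The sample with distribution function \<open>F_dist\<close>\<close>

locale gof_sample = prob_space M for M :: "'a measure" +
  fixes X :: "nat \<Rightarrow> 'a \<Rightarrow> real" and s :: real
  assumes s: "s \<ge> 1 \<or> s < 0" and iid: "iid_with_cdf M X (F_dist s)"
begin

abbreviation "Y \<equiv> \<lambda>i \<omega>. F_dist s (X i \<omega>)"

sublocale U: uniform_sample M Y by (rule uniform_sample_F_dist[OF prob_space_axioms s iid])

sublocale R: uniform_sample M "\<lambda>i \<omega>. 1 - Y i \<omega>" by (rule U.reflect)

lemma X_measurable: "1 \<le> i \<Longrightarrow> X i \<in> borel_measurable M"
  using iid by (auto simp: iid_with_cdf_def indep_vars_def)

lemma cnt_X: "0 < x \<Longrightarrow> x < 1 \<Longrightarrow> cnt X n {..x} \<omega> = cnt Y n {..F_dist s x} \<omega>"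
  using cnt_transform[OF s, of x X n \<omega>] by simp

lemma AE_X: "AE \<omega> in M. \<forall>i\<ge>1. 0 < X i \<omega> \<and> X i \<omega> < 1"
  using U.AE_in_open
proof eventually_elim
  case (elim \<omega>)
  show ?case
  proof (intro allI impI)
    fix i :: nat assume "1 \<le> i"
    then have "0 < Y i \<omega>" "Y i \<omega> < 1" using elim by auto
    then show "0 < X i \<omega> \<and> X i \<omega> < 1"
      by (cases "X i \<omega> \<le> 0"; cases "X i \<omega> = 1") (auto simp: F_dist_def split: if_splits)
  qed
qed

lemma cnt_reflect: "n - cnt Y n {..y} \<omega> \<le> cnt (\<lambda>i \<omega>. 1 - Y i \<omega>) n {..1 - y} \<omega>"
proof -
  have "cnt Y n ({..y} \<union> {y<..}) \<omega> = cnt Y n {..y} \<omega> + cnt Y n {y<..} \<omega>" by (rule cnt_Un) auto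
  moreover have "cnt Y n ({..y} \<union> {y<..}) \<omega> = n" by (rule cnt_eq_n) auto
  moreover have "cnt Y n {y<..} \<omega> \<le> cnt (\<lambda>i \<omega>. 1 - Y i \<omega>) n {..1 - y} \<omega>"
    unfolding cnt_def by (intro card_mono) auto
  ultimately show ?thesis by simp
qed

text \<open>Converse of \<open>cnt_reflect\<close>: at a level strictly below 1 - y only
  observations above y are counted, which is the form that \<open>lower_line_dichotomy\<close>
  expects.\<close>

lemma cnt_reflect_less: "v < 1 - y \<Longrightarrow> cnt (\<lambda>i \<omega>. 1 - Y i \<omega>) n {..v} \<omega> \<le> n - cnt Y n {..y} \<omega>"
proof -
  assume v: "v < 1 - y"
  have "cnt Y n ({..y} \<union> {y<..}) \<omega> = cnt Y n {..y} \<omega> + cnt Y n {y<..} \<omega>" by (rule cnt_Un) auto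
  moreover have "cnt Y n ({..y} \<union> {y<..}) \<omega> = n" by (rule cnt_eq_n) auto
  moreover have "cnt (\<lambda>i \<omega>. 1 - Y i \<omega>) n {..v} \<omega> \<le> cnt Y n {y<..} \<omega>"
    unfolding cnt_def using v by (intro card_mono) auto
  ultimately show ?thesis by simp
qed

end

section \<open>The statistic for order at least 1\<close>

lemma bdd_above_K_ge_1:
  assumes s: "s \<ge> 1" and n: "n \<ge> 1" and X: "\<And>i. i \<in> {1..n} \<Longrightarrow> 0 < X i \<omega> \<and> X i \<omega> < 1"
  shows "bdd_above ((\<lambda>x. K s (real (cnt X n {..x} \<omega>) / real n) x) ` {0<..<1})"
proof -
  obtain C where C: "C > 0" "\<And>x u. 0 < x \<Longrightarrow> x < 1 \<Longrightarrow> 0 \<le> u \<Longrightarrow> u < x \<Longrightarrow>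
    K s u x \<le> C * ((1 - u) * (((1 - u) / (1 - x)) powr s - 1))"
    using K_upper_left[OF s] by blast
  define a where "a = Min ((\<lambda>i. X i \<omega>) ` {1..n})"
  define b where "b = Max ((\<lambda>i. X i \<omega>) ` {1..n})"
  have ne: "finite ((\<lambda>i. X i \<omega>) ` {1..n})" "(\<lambda>i. X i \<omega>) ` {1..n} \<noteq> {}" using n by auto
  have "a \<in> (\<lambda>i. X i \<omega>) ` {1..n}" "b \<in> (\<lambda>i. X i \<omega>) ` {1..n}"
    unfolding a_def b_def by (rule Min_in[OF ne]) (rule Max_in[OF ne])
  then have a: "0 < a" and b: "b < 1" using X by auto
  have aX: "a \<le> X i \<omega>" and bX: "X i \<omega> \<le> b" if "i \<in> {1..n}" for i
    unfolding a_def b_def using ne that by auto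
  \<comment> \<open>If x <= u, some observation is at or before x, so F(x) is at least its value at
    the smallest one; if u < x, some observation lies beyond x, so 1 - x exceeds the distance of the
    largest one from 1.\<close>
  define B where "B = max (1 / s * (1 / F_dist s a) powr s) (C * (1 / (1 - b)) powr s)"
  have "K s (real (cnt X n {..x} \<omega>) / real n) x \<le> B" if x: "x \<in> {0<..<1}" for x
  proof -
    define u where "u = real (cnt X n {..x} \<omega>) / real n"
    have u: "0 \<le> u" "u \<le> 1" using cnt_le[of X n "{..x}" \<omega>] n by (auto simp: u_def)
    show ?thesis
    proof (cases "x \<le> u")
      case True
      then have "cnt X n {..x} \<omega> \<noteq> 0" using x
        by (cases "cnt X n {..x} \<omega> = 0") (auto simp: u_def)
      then obtain i where "i \<in> {1..n}" "X i \<omega> \<le> x" unfolding cnt_def by (auto simp: card_eq_0_iff)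
      then have "a \<le> x" using aX[of i] by simp
      then have F: "F_dist s a \<le> F_dist s x" using F_dist_mono[of s] s by (simp add: mono_def)
      have Fa: "F_dist s a > 0" using F_dist_pos[of s a] s a by simp
      have "K s u x \<le> 1 / s * (u / F_dist s x) powr s" using K_upper_right[OF s _ _ True u(2)] x by simp
      also have "\<dots> \<le> 1 / s * (1 / F_dist s a) powr s"
        using s u F Fa by (intro mult_left_mono powr_mono2 frac_le divide_nonneg_pos) auto
      finally show ?thesis by (simp add: B_def u_def)
    next
      case False
      then have "cnt X n {..x} \<omega> \<noteq> n" using x n
        by (cases "cnt X n {..x} \<omega> = n") (auto simp: u_def)
      then have "\<exists>i\<in>{1..n}. x < X i \<omega>"
        using cnt_eq_n[of n X \<omega> "{..x}"] by (meson atLeastAtMost_iff atMost_iff not_le)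
      then have "x < b" using bX by force
      have ratio: "((1 - u) / (1 - x)) powr s \<le> (1 / (1 - b)) powr s"
        using u x b \<open>x < b\<close> s by (intro powr_mono2 frac_le) auto
      have "(1 - u) * (((1 - u) / (1 - x)) powr s - 1) \<le> (1 - u) * ((1 / (1 - b)) powr s)"
        using ratio u by (intro mult_left_mono) auto
      also have "\<dots> \<le> 1 * ((1 / (1 - b)) powr s)" using u by (intro mult_right_mono) auto
      finally have "C * ((1 - u) * (((1 - u) / (1 - x)) powr s - 1)) \<le> C * (1 / (1 - b)) powr s"
        using C(1) by (intro mult_left_mono) auto
      moreover have "K s u x \<le> C * ((1 - u) * (((1 - u) / (1 - x)) powr s - 1))"
        using False x u by (intro C(2)) auto
      ultimately show ?thesis by (simp add: B_def u_def)
    qed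
  qed
  then show ?thesis unfolding bdd_above_def by blast
qed

context gof_sample
begin

text \<open>Sample analogue of \<open>ev_up\<close>: a unit of Poisson time corresponds to 1/n on
  the uniform scale.\<close>

definition emp_up :: "real \<Rightarrow> nat \<Rightarrow> nat \<Rightarrow> 'a set" where
  "emp_up l m n = {\<omega>\<in>space M. \<forall>k\<in>{1..m}. cnt Y n {..real k * (1 / l) / real n} \<omega> < k}"

lemma sets_emp_up: "emp_up l m n \<in> events"
  unfolding emp_up_def by (intro sets.sets_Collect_finite_All U.sets_cnt) auto

text \<open>If the grid condition fails at k, the point x with F(x) = k/(l' n) satisfies l' F(x) <=
  u, and by \<open>K_lower\<close> the divergence there exceeds the assumed bound. The cap b on the
  count keeps u within \<delta>.\<close>

lemma emp_up_of_S_stat_le: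
  assumes s1: "s \<ge> 1" and n: "n \<ge> 1" and l: "0 < l'"
    and \<delta>: "\<And>x u. 0 < x \<Longrightarrow> x < 1 \<Longrightarrow> u \<le> \<delta> \<Longrightarrow> l' * F_dist s x \<le> u \<Longrightarrow> 1 / s * l powr s < K s u x"
    and w: "\<omega> \<in> space M" and X: "\<forall>i\<ge>1. 0 < X i \<omega> \<and> X i \<omega> < 1"
    and S: "S_stat s X n \<omega> \<le> 1 / s * l powr s"
    and b: "real b \<le> \<delta> * real n" "cnt Y n {..real m * (1 / l') / real n} \<omega> \<le> b"
    and m: "real m * (1 / l') < real n"
  shows "\<omega> \<in> emp_up l' m n"
proof -
  have "cnt Y n {..real k * (1 / l') / real n} \<omega> < k" if k: "k \<in> {1..m}" for k
  proof (rule ccontr)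
    assume c: "\<not> cnt Y n {..real k * (1 / l') / real n} \<omega> < k"
    define y where "y = real k * (1 / l') / real n"
    have "real k * (1 / l') \<le> real m * (1 / l')" using k l by (intro mult_right_mono) auto
    then have y3: "y \<le> real m * (1 / l') / real n" unfolding y_def by (rule divide_right_mono) simp
    have "real m * (1 / l') / real n < 1"
      using divide_strict_right_mono[OF m, of "real n"] n by simp
    then have y: "0 < y" "y < 1" "y \<le> real m * (1 / l') / real n"
      using k l n y3 by (auto simp: y_def)
    obtain x where x: "0 < x" "x < 1" "F_dist s x = y" using F_dist_surj[OF s y(1,2)] by blast
    define u where "u = real (cnt X n {..x} \<omega>) / real n"
    have cx: "cnt X n {..x} \<omega> = cnt Y n {..y} \<omega>" using cnt_X[OF x(1,2)] x(3) by simp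
    have "cnt Y n {..y} \<omega> \<le> b"
      using b(2) cnt_mono[of "{..y}" "{..real m * (1 / l') / real n}" Y n \<omega>] y(3) by simp
    then have "real (cnt X n {..x} \<omega>) \<le> \<delta> * real n" using b(1) cx by linarith
    then have u1: "u \<le> \<delta>" using n by (simp add: u_def field_simps)
    have "l' * y = real k / real n" using l by (simp add: y_def)
    also have "\<dots> \<le> u" unfolding u_def cx using c by (intro divide_right_mono) (auto simp: y_def)
    finally have "1 / s * l powr s < K s u x" using \<delta>[OF x(1,2) u1] x(3) by simp
    also have "K s u x \<le> S_stat s X n \<omega>"
      unfolding S_stat_ge_1[OF s1] u_def using x X
      by (intro cSUP_upper bdd_above_K_ge_1[OF s1 n]) auto
    finally show False using S by simp
  qed
  then show ?thesis using w by (simp add: emp_up_def)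
qed

lemma prob_S_stat_upper_ge_1:
  assumes s1: "s \<ge> 1" and l: "0 < l" "l < l'" and e: "0 < e"
  shows "\<forall>\<^sub>F n in sequentially. prob {\<omega>\<in>space M. S_stat s X n \<omega> \<le> 1 / s * l powr s} \<le> prob (emp_up l' m n) + e"
proof -
  obtain \<delta> where \<delta>: "\<delta> > 0" "\<And>x u. 0 < x \<Longrightarrow> x < 1 \<Longrightarrow> u \<le> \<delta> \<Longrightarrow> l' * F_dist s x \<le> u \<Longrightarrow>
    1 / s * l powr s < K s u x" using K_lower[OF s1 l] by blast
  define t where "t = real m * (1 / l')"
  have t: "t \<ge> 0" using l by (simp add: t_def)
  have "(\<lambda>b. exp t / 2 ^ b) \<longlonglongrightarrow> 0" by real_asymp
  \<comment> \<open>Caps the number of observations up to t/n, uniformly in n, outside an event of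
    probability at most e.\<close>
  from order_tendstoD(2)[OF this, of e] e obtain b where b: "exp t / 2 ^ b < e"
    by (auto simp: eventually_sequentially)
  have "\<forall>\<^sub>F n in sequentially. real b \<le> \<delta> * real n" using \<delta>(1) by real_asymp
  moreover have "\<forall>\<^sub>F n in sequentially. t < real n" by real_asymp
  ultimately show ?thesis using eventually_ge_at_top[of 1]
  proof eventually_elim
    case (elim n)
    show ?case
    proof (rule prob_le_of_AE[OF sets_emp_up U.sets_cnt[where Q = "\<lambda>c. b \<le> c" and n = n and a = "t / real n"]])
      show "prob {\<omega>\<in>space M. b \<le> cnt Y n {..t / real n} \<omega>} \<le> e"
        using U.prob_cnt_large[of n t b] elim t b by simp
      show "AE \<omega> in M. \<omega> \<in> {\<omega>\<in>space M. S_stat s X n \<omega> \<le> 1 / s * l powr s} \<longrightarrow>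
        \<omega> \<in> emp_up l' m n \<or> \<omega> \<in> {\<omega>\<in>space M. b \<le> cnt Y n {..t / real n} \<omega>}"
        using AE_X
      proof eventually_elim
        case (elim \<omega>)
        show ?case
        proof (intro impI)
          assume *: "\<omega> \<in> {\<omega>\<in>space M. S_stat s X n \<omega> \<le> 1 / s * l powr s}"
          show "\<omega> \<in> emp_up l' m n \<or> \<omega> \<in> {\<omega>\<in>space M. b \<le> cnt Y n {..t / real n} \<omega>}"
          proof (cases "b \<le> cnt Y n {..t / real n} \<omega>")
            case True
            then show ?thesis using * by simp
          next
            case False
            have "\<omega> \<in> emp_up l' m n"
              by (rule emp_up_of_S_stat_le[OF s1 \<open>1 \<le> n\<close> _ \<delta>(2) _ elim])
                (use * l False \<open>real b \<le> \<delta> * real n\<close> \<open>t < real n\<close> in \<open>auto simp: t_def\<close>)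
            then show ?thesis by simp
          qed
        qed
      qed
    qed
  qed
qed

text \<open>For x <= u the slope l' controls u/F. For u < x the reflected sample is used: either
  (1-u)/(1-x) is at most 1/q2, with q2 so close to 1 that the divergence stays below 1/s, or it is
  at most 1/q1 while 1 - u <= m/n makes the product small. Since l > 1, the value 1/s is within the
  target.\<close>

lemma S_stat_le_of_grid_ge_1:
  assumes s1: "s \<ge> 1" and n: "n \<ge> 1" and l: "1 < l'" "l' < l"
    and C: "C > 0" "\<And>x u. 0 < x \<Longrightarrow> x < 1 \<Longrightarrow> 0 \<le> u \<Longrightarrow> u < x \<Longrightarrow>
      K s u x \<le> C * ((1 - u) * (((1 - u) / (1 - x)) powr s - 1))"
    and q: "0 < q1" "0 < q2"
    and left: "\<And>k. k \<ge> 1 \<Longrightarrow> cnt Y n {..real k * (1 / l') / real n} \<omega> < k"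
    and right1: "\<And>k. k \<ge> 1 \<Longrightarrow> cnt (\<lambda>i \<omega>. 1 - Y i \<omega>) n {..real k * q1 / real n} \<omega> < k"
    and right2: "\<And>k. k \<ge> m \<Longrightarrow> cnt (\<lambda>i \<omega>. 1 - Y i \<omega>) n {..real k * q2 / real n} \<omega> < k"
    and q2: "C * ((1 / q2) powr s - 1) \<le> 1 / s" "q2 \<le> 1"
    and big: "C * (real m / real n * (1 / q1) powr s) \<le> 1 / s"
  shows "S_stat s X n \<omega> \<le> 1 / s * l powr s"
  unfolding S_stat_ge_1[OF s1]
proof (rule cSUP_least)
  show "{0<..<1::real} \<noteq> {}" by simp
  fix x :: real assume "x \<in> {0<..<1}"
  then have x: "0 < x" "x < 1" by auto
  define y where "y = F_dist s x"
  have y: "0 < y" "y < 1" "x \<le> y"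
    using F_dist_pos[OF s x(1)] F_dist_less_1[OF s x(2)] F_dist_ge[OF s1 x] by (auto simp: y_def)
  define c where "c = cnt X n {..x} \<omega>"
  define u where "u = real c / real n"
  have cy: "c = cnt Y n {..y} \<omega>" using cnt_X[OF x] by (simp add: c_def y_def)
  have cn: "c \<le> n" unfolding c_def by (rule cnt_le)
  have u: "0 \<le> u" "u \<le> 1" using cn n by (auto simp: u_def)
  have l1: "1 / s \<le> 1 / s * l powr s" using s1 l ge_one_powr_ge_zero[of l s] by (simp add: divide_right_mono)
  have "K s u x \<le> 1 / s * l powr s"
  proof (cases "x \<le> u")
    case True
    have "1 / l' * real (cnt Y n {..y} \<omega>) \<le> real n * y"
      using l y by (intro upper_line_of_grid[where m = 1 and c = "\<lambda>y. cnt Y n {..y} \<omega>"] left n cnt_mono) auto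
    then have "u \<le> l' * y" using n l by (simp add: u_def cy field_simps)
    then have "u / y \<le> l" using y l by (smt (verit) mult_right_mono pos_divide_le_eq)
    then have "1 / s * (u / y) powr s \<le> 1 / s * l powr s"
      using u y s1 by (intro mult_left_mono powr_mono2) auto
    then show ?thesis using K_upper_right[OF s1 x True u(2)] by (simp add: y_def)
  next
    case False
    define w where "w = 1 - y"
    have w: "0 < w" using y by (simp add: w_def)
    let ?c = "cnt (\<lambda>i \<omega>. 1 - Y i \<omega>) n {..w} \<omega>"
    have "real n * (1 - u) = real (n - c)" using cn n by (simp add: u_def right_diff_distrib of_nat_diff)
    also have "\<dots> \<le> real ?c" unfolding cy w_def using cnt_reflect[of n y \<omega>] by (simp only: of_nat_le_iff)
    finally have cu: "real n * (1 - u) \<le> real ?c" .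
    \<comment> \<open>This is where \<open>F_dist_ge\<close> enters: dividing by 1 - x instead of
      the transformed distance \<open>w\<close> only lowers the ratio.\<close>
    have wx: "w \<le> 1 - x" using y by (simp add: w_def)
    have "q2 * real ?c \<le> real n * w \<or> (?c \<le> m \<and> q1 * real ?c \<le> real n * w)"
      using w q by (intro upper_line_dichotomy[where c = "\<lambda>y. cnt (\<lambda>i \<omega>. 1 - Y i \<omega>) n {..y} \<omega>"] right1 right2 n cnt_mono) auto
    then have "C * ((1 - u) * (((1 - u) / (1 - x)) powr s - 1)) \<le> 1 / s"
    proof
      assume *: "q2 * real ?c \<le> real n * w"
      have "q2 * (real n * (1 - u)) \<le> q2 * real ?c" using cu q by (intro mult_left_mono) auto
      then have "q2 * (real n * (1 - u)) \<le> real n * w" using * by simp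
      then have "real n * (q2 * (1 - u)) \<le> real n * w" by (simp only: mult.left_commute)
      then have "q2 * (1 - u) \<le> w" using n by simp
      then have "(1 - u) / (1 - x) \<le> 1 / q2" using x q wx by (simp add: field_simps)
      then have p: "((1 - u) / (1 - x)) powr s \<le> (1 / q2) powr s"
        using u x s1 by (intro powr_mono2) auto
      have p1: "1 \<le> (1 / q2) powr s" using q q2(2) s1 by (intro ge_one_powr_ge_zero) auto
      have "(1 - u) * (((1 - u) / (1 - x)) powr s - 1) \<le> (1 - u) * ((1 / q2) powr s - 1)"
        using u p by (intro mult_left_mono) auto
      also have "\<dots> \<le> 1 * ((1 / q2) powr s - 1)" using u p1 by (intro mult_right_mono) auto
      finally have "C * ((1 - u) * (((1 - u) / (1 - x)) powr s - 1)) \<le> C * ((1 / q2) powr s - 1)"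
        using C(1) by (intro mult_left_mono) auto
      then show ?thesis using q2(1) by simp
    next
      assume *: "?c \<le> m \<and> q1 * real ?c \<le> real n * w"
      have "q1 * (real n * (1 - u)) \<le> q1 * real ?c" using cu q by (intro mult_left_mono) auto
      then have "q1 * (real n * (1 - u)) \<le> real n * w" using * by simp
      then have "real n * (q1 * (1 - u)) \<le> real n * w" by (simp only: mult.left_commute)
      then have "q1 * (1 - u) \<le> w" using n by simp
      then have "(1 - u) / (1 - x) \<le> 1 / q1" using x q wx by (simp add: field_simps)
      then have p: "((1 - u) / (1 - x)) powr s \<le> (1 / q1) powr s"
        using u x s1 by (intro powr_mono2) auto
      have "real n * (1 - u) \<le> real m" using cu * by linarith
      then have um: "1 - u \<le> real m / real n" using n by (simp add: field_simps)
      have "(1 - u) * (((1 - u) / (1 - x)) powr s - 1) \<le> (1 - u) * (1 / q1) powr s"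
        using u p by (intro mult_left_mono) auto
      also have "\<dots> \<le> real m / real n * (1 / q1) powr s" using um by (intro mult_right_mono) auto
      finally have "C * ((1 - u) * (((1 - u) / (1 - x)) powr s - 1)) \<le> C * (real m / real n * (1 / q1) powr s)"
        using C(1) by (intro mult_left_mono) auto
      then show ?thesis using big by simp
    qed
    moreover have "K s u x \<le> C * ((1 - u) * (((1 - u) / (1 - x)) powr s - 1))"
      using False x u by (intro C(2)) auto
    ultimately show ?thesis using l1 by linarith
  qed
  then show "K s (real (cnt X n {..x} \<omega>) / real n) x \<le> 1 / s * l powr s" by (simp add: u_def c_def)
qed

lemma prob_S_stat_lower_ge_1:
  assumes s1: "s \<ge> 1" and l: "1 < l'" "l' < l" and e: "0 < e"
  shows "\<exists>m. \<forall>\<^sub>F n in sequentially.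
    prob (emp_up l' m n) - e \<le> prob {\<omega>\<in>space M. S_stat s X n \<omega> \<le> 1 / s * l powr s}"
proof -
  obtain C where C: "C > 0" "\<And>x u. 0 < x \<Longrightarrow> x < 1 \<Longrightarrow> 0 \<le> u \<Longrightarrow> u < x \<Longrightarrow>
    K s u x \<le> C * ((1 - u) * (((1 - u) / (1 - x)) powr s - 1))"
    using K_upper_left[OF s1] by blast
  have e3: "e / 3 > 0" using e by simp
  have "((\<lambda>q. C * ((1 / q) powr s - 1)) \<longlongrightarrow> C * ((1 / 1) powr s - 1)) (at_left 1)"
    by (intro tendsto_intros) auto
  then have "\<forall>\<^sub>F q in at_left 1. C * ((1 / q) powr s - 1) < 1 / s"
    by (rule order_tendstoD(2)) (use s1 in simp)
  then obtain b where b: "b < 1" "\<And>q. b < q \<Longrightarrow> q < 1 \<Longrightarrow> C * ((1 / q) powr s - 1) < 1 / s"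
    unfolding eventually_at_left_field by blast
  \<comment> \<open>Close enough to 1 for the bulk bound; \<open>max b 0\<close> keeps it
    positive.\<close>
  define q2 where "q2 = (max b 0 + 1) / 2"
  have q2: "0 < q2" "q2 < 1" "b < q2" using b(1) by (auto simp: q2_def)
  have l0: "0 < 1 / l'" "1 / l' < 1" using l by auto
  \<comment> \<open>This cutoff is the m of the conclusion: beyond it the grid condition with slope
    l' fails with probability at most e/3. Two more exceptional events of this size concern the
    right end.\<close>
  obtain m1 where m1: "\<And>n. n \<ge> 1 \<Longrightarrow> prob {\<omega>\<in>space M. \<exists>k\<ge>m1. k \<le> cnt Y n {..real k * (1 / l') / real n} \<omega>} \<le> e / 3"
    using U.upper_tail_small[OF l0 e3] by blast
  obtain m2 where m2: "\<And>n. n \<ge> 1 \<Longrightarrow> prob {\<omega>\<in>space M. \<exists>k\<ge>m2. k \<le> cnt (\<lambda>i \<omega>. 1 - Y i \<omega>) n {..real k * q2 / real n} \<omega>} \<le> e / 3"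
    using R.upper_tail_small[OF q2(1,2) e3] by blast
  obtain q1 where q1: "0 < q1" "\<And>n. n \<ge> 1 \<Longrightarrow> prob {\<omega>\<in>space M. \<exists>k\<ge>1. k \<le> cnt (\<lambda>i \<omega>. 1 - Y i \<omega>) n {..real k * q1 / real n} \<omega>} \<le> e / 3"
    using R.upper_tail_small'[OF e3] by blast
  \<comment> \<open>m2 and q1 are fixed before n grows, so the weight m2/n outweighs the crude ratio
    at the right end.\<close>
  have "(\<lambda>n. C * (real m2 / real n * (1 / q1) powr s)) \<longlonglongrightarrow> 0" by real_asymp
  then have "\<forall>\<^sub>F n in sequentially. C * (real m2 / real n * (1 / q1) powr s) < 1 / s"
    by (rule order_tendstoD(2)) (use s1 in simp)
  then have "\<forall>\<^sub>F n in sequentially.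
    prob (emp_up l' m1 n) - e \<le> prob {\<omega>\<in>space M. S_stat s X n \<omega> \<le> 1 / s * l powr s}"
    using eventually_ge_at_top[of 1]
  proof eventually_elim
    case (elim n)
    let ?B1 = "{\<omega>\<in>space M. \<exists>k\<ge>m1. k \<le> cnt Y n {..real k * (1 / l') / real n} \<omega>}"
    let ?B2 = "{\<omega>\<in>space M. \<exists>k\<ge>m2. k \<le> cnt (\<lambda>i \<omega>. 1 - Y i \<omega>) n {..real k * q2 / real n} \<omega>}"
    let ?B3 = "{\<omega>\<in>space M. \<exists>k\<ge>1. k \<le> cnt (\<lambda>i \<omega>. 1 - Y i \<omega>) n {..real k * q1 / real n} \<omega>}"
    let ?S = "{\<omega>\<in>space M. S_stat s X n \<omega> \<le> 1 / s * l powr s}"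
    have B: "?B1 \<in> events" "?B2 \<in> events" "?B3 \<in> events"
      by (intro sets.sets_Collect_countable_Ex sets.sets_Collect_conj sets.sets_Collect_const U.sets_cnt R.sets_cnt)+
    have S: "?S \<in> events"
      using measurable_S_stat_ge_1[of X M s n, OF X_measurable s1] by (simp add: borel_measurable_iff_le)
    have "prob (emp_up l' m1 n) \<le> prob ?S + e"
    proof (rule prob_le_of_AE[OF S])
      show "?B1 \<union> ?B2 \<union> ?B3 \<in> events" using B by (intro sets.Un)
      have "prob (?B1 \<union> ?B2 \<union> ?B3) \<le> prob ?B1 + prob ?B2 + prob ?B3"
        using measure_Un_le[OF sets.Un[OF B(1,2)] B(3)] measure_Un_le[OF B(1,2)] by linarith
      then show "prob (?B1 \<union> ?B2 \<union> ?B3) \<le> e" using m1[OF elim(2)] m2[OF elim(2)] q1(2)[OF elim(2)] by linarith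
      have "\<omega> \<in> ?S" if w: "\<omega> \<in> emp_up l' m1 n" and nb: "\<omega> \<notin> ?B1 \<union> ?B2 \<union> ?B3" for \<omega>
      proof -
        have sp: "\<omega> \<in> space M" using w by (simp add: emp_up_def)
        have "S_stat s X n \<omega> \<le> 1 / s * l powr s"
        proof (rule S_stat_le_of_grid_ge_1[OF s1 elim(2) l C q1(1) q2(1)])
          show "cnt Y n {..real k * (1 / l') / real n} \<omega> < k" if k: "k \<ge> 1" for k
          proof (cases "k \<le> m1")
            case True then show ?thesis using w k by (simp add: emp_up_def)
          next
            case False
            have "\<not> (\<exists>k\<ge>m1. k \<le> cnt Y n {..real k * (1 / l') / real n} \<omega>)" using nb sp by blast
            then show ?thesis using False by (meson not_le less_imp_le)
          qed
          show "cnt (\<lambda>i \<omega>. 1 - Y i \<omega>) n {..real k * q1 / real n} \<omega> < k" if "k \<ge> 1" for k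
          proof -
            have "\<not> (\<exists>k\<ge>1. k \<le> cnt (\<lambda>i \<omega>. 1 - Y i \<omega>) n {..real k * q1 / real n} \<omega>)" using nb sp by blast
            then show ?thesis using that by (meson not_le)
          qed
          show "cnt (\<lambda>i \<omega>. 1 - Y i \<omega>) n {..real k * q2 / real n} \<omega> < k" if "k \<ge> m2" for k
          proof -
            have "\<not> (\<exists>k\<ge>m2. k \<le> cnt (\<lambda>i \<omega>. 1 - Y i \<omega>) n {..real k * q2 / real n} \<omega>)" using nb sp by blast
            then show ?thesis using that by (meson not_le)
          qed
          show "C * ((1 / q2) powr s - 1) \<le> 1 / s" using b(2)[OF q2(3,2)] by simp
        qed (use q2 elim in auto)
        then show ?thesis using sp by simp
      qed
      then show "AE \<omega> in M. \<omega> \<in> emp_up l' m1 n \<longrightarrow> \<omega> \<in> ?S \<or> \<omega> \<in> ?B1 \<union> ?B2 \<union> ?B3" by (intro AE_I2) blast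
    qed
    then show ?case by simp
  qed
  then show ?thesis by blast
qed

end

section \<open>The statistic for negative order\<close>

lemma cnt_pos_iff: "0 < cnt Y n A \<omega> \<longleftrightarrow> (\<exists>i\<in>{1..n}. Y i \<omega> \<in> A)"
  unfolding cnt_def by (subst card_gt_0_iff) auto

context gof_sample
begin

definition emp_down :: "real \<Rightarrow> nat \<Rightarrow> nat \<Rightarrow> 'a set" where
  "emp_down l m n = {\<omega>\<in>space M. \<forall>k\<in>{1..m}. k < cnt Y n {..real k * l / real n} \<omega>}"

lemma sets_emp_down: "emp_down l m n \<in> events"
  unfolding emp_down_def by (intro sets.sets_Collect_finite_All U.sets_cnt) auto

lemma cnt_between_open:
  assumes X: "\<And>i. i \<in> {1..n} \<Longrightarrow> 0 < X i \<omega> \<and> X i \<omega> < 1"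
    and x: "0 < cnt X n {..x} \<omega>" "cnt X n {..x} \<omega> < n"
  shows "0 < x" "x < 1"
proof -
  obtain i where "i \<in> {1..n}" "X i \<omega> \<le> x" using x(1) unfolding cnt_pos_iff by blast
  then show "0 < x" using X[of i] by simp
  have "\<exists>i\<in>{1..n}. x < X i \<omega>"
    using cnt_eq_n[of n X \<omega> "{..x}"] x(2) by (metis atLeastAtMost_iff atMost_iff less_irrefl not_le)
  then obtain j where "j \<in> {1..n}" "x < X j \<omega>" by blast
  then show "x < 1" using X[of j] by simp
qed

text \<open>On the index set the count lies between 1 and n - 1, so u and 1 - u are at least 1/n and
  the ratios in the upper bounds are at most n.\<close>

lemma bdd_above_K_neg:
  assumes r: "s = - r" "r > 0" and X: "\<And>i. i \<in> {1..n} \<Longrightarrow> 0 < X i \<omega> \<and> X i \<omega> < 1"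
  shows "bdd_above ((\<lambda>x. K s (real (cnt X n {..x} \<omega>) / real n) x) `
    {x. 0 < cnt X n {..x} \<omega> \<and> cnt X n {..x} \<omega> < n})"
proof -
  define C where "C = 1 / (r * (1 + r))"
  have C: "C > 0" using r by (simp add: C_def)
  define B where "B = 1 / (1 + r) * real n powr r + C * real n powr r"
  have "K s (real (cnt X n {..x} \<omega>) / real n) x \<le> B" if cx: "0 < cnt X n {..x} \<omega>" "cnt X n {..x} \<omega> < n" for x
  proof -
    have x: "0 < x" "x < 1" using cnt_between_open[OF X cx] by auto
    define c where "c = cnt X n {..x} \<omega>"
    define u where "u = real c / real n"
    have n: "0 < real n" using cx by simp
    have nu: "real n * u = real c" using n by (simp add: u_def)
    then have nu': "real n * (1 - u) = real n - real c" by (simp add: right_diff_distrib)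
    have "1 \<le> c" "c + 1 \<le> n" using cx by (auto simp: c_def)
    then have "1 \<le> real c" "real c + 1 \<le> real n" by linarith+
    then have u: "1 \<le> real n * u" "1 \<le> real n * (1 - u)" "0 < u" "u < 1"
      unfolding nu nu' by (auto simp: u_def)
    show ?thesis
    proof (cases "u \<le> x")
      case True
      define F where "F = F_dist s x"
      have F: "0 < F" "F < 1" using F_dist_pos[OF s x(1)] F_dist_less_1[OF s x(2)] by (auto simp: F_def)
      have Fu: "F / u \<le> real n"
      proof -
        have "F \<le> real n * u" using F u by linarith
        then show ?thesis using u by (simp add: pos_divide_le_eq)
      qed
      have xFu: "x * F / u \<le> real n"
      proof -
        have "x * (F / u) \<le> 1 * (F / u)" using x F u by (intro mult_right_mono) auto
        then show ?thesis using Fu by simp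
      qed
      have 1: "(F / u) powr r \<le> real n powr r" using F u Fu r by (intro powr_mono2) auto
      have "(x * F / u) powr r \<le> real n powr r" using F u xFu r x by (intro powr_mono2) auto
      then have 2: "max 0 ((x * F / u) powr r - 1) \<le> real n powr r" by simp
      have "K s u x \<le> 1 / (1 + r) * (F / u) powr r + C * max 0 ((x * F / u) powr r - 1)"
        using K_neg_upper_left[OF r(2) x u(3) True] r(1) by (simp add: C_def F_def)
      also have "\<dots> \<le> B" unfolding B_def using 1 2 r C by (intro add_mono mult_left_mono) auto
      finally show ?thesis by (simp add: u_def c_def)
    next
      case False
      have "(1 - x) / (1 - u) \<le> real n"
      proof -
        have "1 - x \<le> real n * (1 - u)" using x u by linarith
        then show ?thesis using u by (simp add: pos_divide_le_eq)
      qed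
      then have "((1 - x) / (1 - u)) powr r \<le> real n powr r" using x u r by (intro powr_mono2) auto
      then have "(1 - x) * (((1 - x) / (1 - u)) powr r - 1) \<le> (1 - x) * real n powr r"
        using x by (intro mult_left_mono) auto
      also have "\<dots> \<le> 1 * real n powr r" using x by (intro mult_right_mono) auto
      finally have "C * ((1 - x) * (((1 - x) / (1 - u)) powr r - 1)) \<le> C * real n powr r"
        using C by (intro mult_left_mono) auto
      moreover have "K s u x \<le> C * ((1 - x) * (((1 - x) / (1 - u)) powr r - 1))"
        using K_neg_upper_right[OF r(2) x(1) _ u(4)] False r(1) by (simp add: C_def)
      moreover have "0 \<le> 1 / (1 + r) * real n powr r" using r by simp
      ultimately show ?thesis unfolding B_def u_def c_def by linarith
    qed
  qed
  then show ?thesis unfolding bdd_above_def by blast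
qed

text \<open>A small statistic forbids l' u <= y at every level y up to F(\<delta>) with 0 < count <
  n. In the absence of ties the smallest observation has count 1 and hence lies below l'/n. The
  count is therefore positive at every grid point, the prohibition applies there, and the count
  exceeds k.\<close>

lemma emp_down_of_S_stat_le:
  assumes r: "s = - r" "r > 0" and n: "n \<ge> 2" "m < n" and l: "0 < l'"
    and \<delta>: "\<And>x u. 0 < x \<Longrightarrow> x \<le> \<delta> \<Longrightarrow> 0 < u \<Longrightarrow> u < 1 \<Longrightarrow> l' * u \<le> F_dist s x \<Longrightarrow> 1 / (1 + r) * l powr r < K s u x"
    and \<delta>01: "0 < \<delta>" "\<delta> < 1"
    and w: "\<omega> \<in> space M" and X: "\<forall>i\<ge>1. 0 < X i \<omega> \<and> X i \<omega> < 1"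
    and distinct: "\<forall>i\<ge>1. \<forall>j\<ge>1. i \<noteq> j \<longrightarrow> Y i \<omega> \<noteq> Y j \<omega>"
    and S: "S_stat s X n \<omega> \<le> 1 / (1 + r) * l powr r"
    and pos: "cnt Y n {..F_dist s \<delta>} \<omega> \<noteq> 0" and m: "real m * l' / real n \<le> F_dist s \<delta>"
  shows "\<omega> \<in> emp_down l' m n"
proof -
  have s0: "s < 1" using r by simp
  have n1: "n \<ge> 1" using n by simp
  have key: "\<not> l' * (real (cnt Y n {..y} \<omega>) / real n) \<le> y"
    if y: "0 < y" "y \<le> F_dist s \<delta>" and c: "0 < cnt Y n {..y} \<omega>" "cnt Y n {..y} \<omega> < n" for y
  proof
    assume le: "l' * (real (cnt Y n {..y} \<omega>) / real n) \<le> y"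
    have "y < 1" using y F_dist_less_1[OF s \<delta>01(2)] by simp
    then obtain x where x: "0 < x" "x < 1" "F_dist s x = y" using F_dist_surj[OF s y(1)] by blast
    have "x \<le> \<delta>" using y(2) x(3) F_dist_le_iff[OF s \<delta>01, of x] by simp
    have cx: "cnt X n {..x} \<omega> = cnt Y n {..y} \<omega>" using cnt_X[OF x(1,2)] x(3) by simp
    have "1 / (1 + r) * l powr r < K s (real (cnt X n {..x} \<omega>) / real n) x"
      using c n1 le x by (intro \<delta> \<open>x \<le> \<delta>\<close>) (auto simp: cx)
    also have "\<dots> \<le> S_stat s X n \<omega>"
      unfolding S_stat_less_1[OF s0 n1] using X c cx
      by (intro cSUP_upper bdd_above_K_neg[OF r]) auto
    finally show False using S by simp
  qed
  define y1 where "y1 = Min ((\<lambda>i. Y i \<omega>) ` {1..n})"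
  have fin: "finite ((\<lambda>i. Y i \<omega>) ` {1..n})" "(\<lambda>i. Y i \<omega>) ` {1..n} \<noteq> {}" using n by auto
  have "y1 \<in> (\<lambda>i. Y i \<omega>) ` {1..n}" unfolding y1_def by (rule Min_in[OF fin])
  then obtain i0 where i0: "i0 \<in> {1..n}" "Y i0 \<omega> = y1" by auto
  have y1_le: "y1 \<le> Y i \<omega>" if "i \<in> {1..n}" for i unfolding y1_def using fin that by auto
  have y1_pos: "0 < y1" using i0 X F_dist_pos[OF s, of "X i0 \<omega>"] by auto
  obtain i1 where "i1 \<in> {1..n}" "Y i1 \<omega> \<le> F_dist s \<delta>"
    using pos cnt_pos_iff[of Y n "{..F_dist s \<delta>}" \<omega>] by auto
  then have y1_small: "y1 \<le> F_dist s \<delta>" using y1_le[of i1] by simp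
  have "{i \<in> {1..n}. Y i \<omega> \<in> {..y1}} = {i0}"
  proof (intro equalityI subsetI)
    fix i assume i: "i \<in> {i \<in> {1..n}. Y i \<omega> \<in> {..y1}}"
    then have "Y i \<omega> = Y i0 \<omega>" using y1_le[of i] i0 by auto
    moreover have "1 \<le> i" "1 \<le> i0" using i i0 by auto
    ultimately have "i = i0" using distinct by blast
    then show "i \<in> {i0}" by simp
  qed (use i0 in auto)
  then have c1: "cnt Y n {..y1} \<omega> = 1" by (simp add: cnt_def)
  have y1: "y1 < l' / real n" using key[OF y1_pos y1_small] c1 n by (simp add: not_le)
  have "k < cnt Y n {..real k * l' / real n} \<omega>" if k: "k \<in> {1..m}" for k
  proof (rule ccontr)
    assume "\<not> ?thesis"
    then have ck: "cnt Y n {..real k * l' / real n} \<omega> \<le> k" by simp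
    define y where "y = real k * l' / real n"
    have "1 * l' \<le> real k * l'" using k l by (intro mult_right_mono) auto
    then have "l' / real n \<le> y" unfolding y_def by (intro divide_right_mono) auto
    then have yy: "y1 \<le> y" "0 < y" using y1 y1_pos by auto
    have "real k * l' \<le> real m * l'" using k l by (intro mult_right_mono) auto
    then have "y \<le> real m * l' / real n" unfolding y_def by (intro divide_right_mono) auto
    then have y2: "y \<le> F_dist s \<delta>" using m by simp
    have "1 \<le> cnt Y n {..y} \<omega>" using c1 cnt_mono[of "{..y1}" "{..y}" Y n \<omega>] yy by simp
    \<comment> \<open>A failure at k <= m < n also keeps the count below n, hence the point inside
      the index set.\<close>
    moreover have "cnt Y n {..y} \<omega> < n" using ck k n by (simp add: y_def)
    ultimately have "\<not> l' * (real (cnt Y n {..y} \<omega>) / real n) \<le> y" using yy y2 by (intro key) auto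
    moreover have "l' * (real (cnt Y n {..y} \<omega>) / real n) \<le> l' * (real k / real n)"
      using ck l by (intro mult_left_mono divide_right_mono) (auto simp: y_def)
    moreover have "l' * (real k / real n) = y" by (simp add: y_def)
    ultimately show False by simp
  qed
  then show ?thesis using w by (simp add: emp_down_def)
qed

lemma prob_S_stat_upper_neg:
  assumes r: "s = - r" "r > 0" and l: "0 < l" "l < l'" and e: "0 < e"
  shows "\<forall>\<^sub>F n in sequentially. prob {\<omega>\<in>space M. S_stat s X n \<omega> \<le> 1 / (1 + r) * l powr r} \<le> prob (emp_down l' m n) + e"
proof -
  obtain \<delta> where \<delta>: "0 < \<delta>" "\<delta> < 1" "\<And>x u. 0 < x \<Longrightarrow> x \<le> \<delta> \<Longrightarrow> 0 < u \<Longrightarrow> u < 1 \<Longrightarrow>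
    l' * u \<le> F_dist s x \<Longrightarrow> 1 / (1 + r) * l powr r < K s u x"
    using K_neg_lower[OF r(2) l] unfolding r(1) by blast
  \<comment> \<open>The exceptional event is that no observation falls at or below this level, the
    end of the range in which \<open>K_neg_lower\<close> applies.\<close>
  define \<eta> where "\<eta> = F_dist s \<delta>"
  have \<eta>: "0 < \<eta>" "\<eta> < 1" using F_dist_pos[OF s \<delta>(1)] F_dist_less_1[OF s \<delta>(2)] by (auto simp: \<eta>_def)
  have "(\<lambda>n. (1 - \<eta> / 2) ^ n) \<longlonglongrightarrow> 0" using \<eta> by (intro LIMSEQ_power_zero) auto
  then have "\<forall>\<^sub>F n in sequentially. (1 - \<eta> / 2) ^ n < e" using e by (rule order_tendstoD)
  moreover have "(\<lambda>n. real m * l' / real n) \<longlonglongrightarrow> 0" by real_asymp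
  then have "\<forall>\<^sub>F n in sequentially. real m * l' / real n < \<eta>" using \<eta>(1) by (rule order_tendstoD)
  ultimately show ?thesis using eventually_ge_at_top[of 2] eventually_gt_at_top[of m]
  proof eventually_elim
    case (elim n)
    show ?case
    proof (rule prob_le_of_AE[OF sets_emp_down U.sets_cnt[where Q = "\<lambda>c. c = 0" and n = n and a = \<eta>]])
      show "prob {\<omega>\<in>space M. cnt Y n {..\<eta>} \<omega> = 0} \<le> e"
        using U.prob_cnt_zero[of \<eta> n] elim(1) \<eta> by simp
      show "AE \<omega> in M. \<omega> \<in> {\<omega>\<in>space M. S_stat s X n \<omega> \<le> 1 / (1 + r) * l powr r} \<longrightarrow>
        \<omega> \<in> emp_down l' m n \<or> \<omega> \<in> {\<omega>\<in>space M. cnt Y n {..\<eta>} \<omega> = 0}"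
        using AE_X U.AE_distinct
      proof eventually_elim
        case w: (elim \<omega>)
        show ?case
        proof (intro impI)
          assume *: "\<omega> \<in> {\<omega>\<in>space M. S_stat s X n \<omega> \<le> 1 / (1 + r) * l powr r}"
          show "\<omega> \<in> emp_down l' m n \<or> \<omega> \<in> {\<omega>\<in>space M. cnt Y n {..\<eta>} \<omega> = 0}"
          proof (cases "cnt Y n {..\<eta>} \<omega> = 0")
            case True
            then show ?thesis using * by simp
          next
            case False
            have "\<omega> \<in> emp_down l' m n"
              by (rule emp_down_of_S_stat_le[OF r elim(3,4) _ \<delta>(3,1,2) _ w])
                (use * l False elim(2) in \<open>auto simp: \<eta>_def\<close>)
            then show ?thesis by simp
          qed
        qed
      qed
    qed
  qed
qed

text \<open>For u < x replaced by x < u, the right end is treated as for order at least 1, with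
  weight 1 - x. For u <= x the extra term is positive only if x F/u > 1. In the bulk F/u <= q2 with
  q2 close to 1 keeps the total within the target. Near 0 only F/u <= l' is known, but there x <=
  1/l', so x F/u <= 1 and the extra term is 0.\<close>

lemma S_stat_le_of_grid_neg:
  assumes r: "s = - r" "r > 0" and n: "n \<ge> 2" "m < n" and l: "1 < l'" "l' < l"
    and q: "1 < q1" "1 < q2"
    and X: "\<forall>i\<ge>1. 0 < X i \<omega> \<and> X i \<omega> < 1"
    and distinct: "\<forall>i\<ge>1. \<forall>j\<ge>1. i \<noteq> j \<longrightarrow> Y i \<omega> \<noteq> Y j \<omega>"
    and left1: "\<And>k. k \<ge> 1 \<Longrightarrow> k < n \<Longrightarrow> k < cnt Y n {..real k * l' / real n} \<omega>"
    and left2: "\<And>k. k \<ge> m \<Longrightarrow> k < n \<Longrightarrow> k < cnt Y n {..real k * q2 / real n} \<omega>"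
    and right1: "\<And>k. k \<ge> 1 \<Longrightarrow> k < n \<Longrightarrow> k < cnt (\<lambda>i \<omega>. 1 - Y i \<omega>) n {..real k * q1 / real n} \<omega>"
    and right2: "\<And>k. k \<ge> m \<Longrightarrow> k < n \<Longrightarrow> k < cnt (\<lambda>i \<omega>. 1 - Y i \<omega>) n {..real k * q2 / real n} \<omega>"
    and C: "C = 1 / (r * (1 + r))"
    and q2: "1 / (1 + r) * q2 powr r + C * (q2 powr r - 1) \<le> 1 / (1 + r) * l powr r"
      "C * (q2 powr r - 1) \<le> 1 / (1 + r)"
    and big1: "q2 * real m / real n \<le> F_dist s (1 / l')"
    and big2: "C * (q2 * real m / real n * q1 powr r) \<le> 1 / (1 + r)"
  shows "S_stat s X n \<omega> \<le> 1 / (1 + r) * l powr r"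
proof -
  have s0: "s < 1" and n1: "n \<ge> 1" using r n by auto
  have C0: "C > 0" using r by (simp add: C)
  have l1: "1 / (1 + r) \<le> 1 / (1 + r) * l powr r" using r l ge_one_powr_ge_zero[of l r] by (simp add: divide_right_mono)
  show ?thesis unfolding S_stat_less_1[OF s0 n1]
  proof (rule cSUP_least)
    \<comment> \<open>Two different observations make the index set nonempty; otherwise its supremum
      would be a junk value.\<close>
    have "Y 1 \<omega> \<noteq> Y 2 \<omega>" using distinct by simp
    then have "X 1 \<omega> \<noteq> X 2 \<omega>" by auto
    then obtain i j :: nat where ij: "i \<in> {1..n}" "j \<in> {1..n}" "X i \<omega> < X j \<omega>"
      using n that[of 1 2] that[of 2 1] by (cases "X 1 \<omega> < X 2 \<omega>") auto
    have "0 < cnt X n {..X i \<omega>} \<omega>" unfolding cnt_pos_iff using ij by blast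
    moreover have "cnt X n {..X i \<omega>} \<omega> < n"
    proof -
      have "j \<notin> {i' \<in> {1..n}. X i' \<omega> \<in> {..X i \<omega>}}" using ij(3) by simp
      then have "{i' \<in> {1..n}. X i' \<omega> \<in> {..X i \<omega>}} \<noteq> {1..n}" using ij(2) by blast
      then have "{i' \<in> {1..n}. X i' \<omega> \<in> {..X i \<omega>}} \<subset> {1..n}" by blast
      from psubset_card_mono[OF _ this] show ?thesis by (simp add: cnt_def)
    qed
    ultimately show "{x. 0 < cnt X n {..x} \<omega> \<and> cnt X n {..x} \<omega> < n} \<noteq> {}" by blast
  next
    fix x assume "x \<in> {x. 0 < cnt X n {..x} \<omega> \<and> cnt X n {..x} \<omega> < n}"
    then have cx: "0 < cnt X n {..x} \<omega>" "cnt X n {..x} \<omega> < n" by auto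
    have x: "0 < x" "x < 1" using cnt_between_open[OF _ cx] X by auto
    define y where "y = F_dist s x"
    have y: "0 < y" "y < 1" "y \<le> x"
      using F_dist_pos[OF s x(1)] F_dist_less_1[OF s x(2)] F_dist_le[OF _ x] r by (auto simp: y_def)
    define c where "c = cnt X n {..x} \<omega>"
    define u where "u = real c / real n"
    have cy: "c = cnt Y n {..y} \<omega>" using cnt_X[OF x] by (simp add: c_def y_def)
    have c: "1 \<le> c" "c < n" using cx by (auto simp: c_def)
    have u: "0 < u" "u < 1" using c by (auto simp: u_def)
    have nu: "real n * u = real c" using n by (simp add: u_def)
    have "K s u x \<le> 1 / (1 + r) * l powr r"
    proof (cases "u \<le> x")
      case True
      have Kle: "K s u x \<le> 1 / (1 + r) * (y / u) powr r + C * max 0 ((x * y / u) powr r - 1)"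
        using K_neg_upper_left[OF r(2) x u(1) True] r(1) by (simp add: C y_def)
      have "real n * y \<le> q2 * real c \<or> (real n * y \<le> q2 * real m \<and> real n * y \<le> l' * real c)"
        by (rule lower_line_dichotomy[where c = "\<lambda>y. cnt Y n {..y} \<omega>", OF n(2) c left1 left2])
          (auto simp: cy intro: cnt_mono)
      then show ?thesis
      proof
        assume "real n * y \<le> q2 * real c"
        then have "real n * y \<le> real n * (q2 * u)" using nu by (simp add: mult.left_commute)
        then have "y \<le> q2 * u" using n by simp
        then have yu: "y / u \<le> q2" using u by (simp add: pos_divide_le_eq)
        have "x * (y / u) \<le> 1 * (y / u)" using x y u by (intro mult_right_mono) auto
        then have xyu: "x * y / u \<le> q2" using yu by simp
        have 1: "(y / u) powr r \<le> q2 powr r" using yu y u r by (intro powr_mono2) auto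
        have "(x * y / u) powr r \<le> q2 powr r" using xyu x y u r by (intro powr_mono2) auto
        moreover have "1 \<le> q2 powr r" using q r by (intro ge_one_powr_ge_zero) auto
        ultimately have 2: "max 0 ((x * y / u) powr r - 1) \<le> q2 powr r - 1" by simp
        have "1 / (1 + r) * (y / u) powr r + C * max 0 ((x * y / u) powr r - 1) \<le>
          1 / (1 + r) * q2 powr r + C * (q2 powr r - 1)"
          using 1 2 C0 r by (intro add_mono mult_left_mono) auto
        then show ?thesis using Kle q2(1) by linarith
      next
        assume *: "real n * y \<le> q2 * real m \<and> real n * y \<le> l' * real c"
        then have "real n * y \<le> real n * (l' * u)" using nu by (simp add: mult.left_commute)
        then have "y \<le> l' * u" using n by simp
        then have yu: "y / u \<le> l'" using u by (simp add: pos_divide_le_eq)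
        have "y \<le> q2 * real m / real n" using * n by (simp add: field_simps)
        then have "F_dist s x \<le> F_dist s (1 / l')" using big1 by (simp add: y_def)
        then have "x \<le> 1 / l'" using F_dist_le_iff[OF s, of "1 / l'" x] l by simp
        then have "x * (y / u) \<le> 1 / l' * l'" using yu x y u l by (intro mult_mono) auto
        then have "x * y / u \<le> 1" using l by simp
        then have "(x * y / u) powr r \<le> 1" using x y u r by (intro powr_le1) auto
        then have 2: "max 0 ((x * y / u) powr r - 1) = 0" by simp
        have "(y / u) powr r \<le> l powr r" using yu y u r l by (intro powr_mono2) auto
        then have "1 / (1 + r) * (y / u) powr r \<le> 1 / (1 + r) * l powr r"
          using r by (intro mult_left_mono) auto
        then show ?thesis using Kle unfolding 2 by simp
      qed
    next
      case False
      define w where "w = 1 - y"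
      have w: "0 < w" "1 - x \<le> w" using y by (auto simp: w_def)
      have nuj: "real n * (1 - u) = real (n - c)" using c nu by (simp add: right_diff_distrib of_nat_diff)
      have "real n * w \<le> q2 * real (n - c) \<or> (real n * w \<le> q2 * real m \<and> real n * w \<le> q1 * real (n - c))"
      proof (rule lower_line_dichotomy[where c = "\<lambda>y. cnt (\<lambda>i \<omega>. 1 - Y i \<omega>) n {..y} \<omega>", OF n(2) _ _ right1 right2])
        show "1 \<le> n - c" "n - c < n" using c by auto
        show "cnt (\<lambda>i \<omega>. 1 - Y i \<omega>) n {..v} \<omega> \<le> n - c" if "v < w" for v
          using cnt_reflect_less[of v y n \<omega>] that by (simp add: w_def cy)
      qed
      then have "C * ((1 - x) * (((1 - x) / (1 - u)) powr r - 1)) \<le> 1 / (1 + r)"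
      proof
        assume "real n * w \<le> q2 * real (n - c)"
        then have "real n * w \<le> real n * (q2 * (1 - u))" by (simp only: nuj[symmetric] mult.left_commute)
        then have "w \<le> q2 * (1 - u)" using n by simp
        then have "1 - x \<le> q2 * (1 - u)" using w by simp
        then have "(1 - x) / (1 - u) \<le> q2" using u by (simp add: pos_divide_le_eq)
        then have p: "((1 - x) / (1 - u)) powr r \<le> q2 powr r" using x u r by (intro powr_mono2) auto
        have p1: "1 \<le> q2 powr r" using q r by (intro ge_one_powr_ge_zero) auto
        have "(1 - x) * (((1 - x) / (1 - u)) powr r - 1) \<le> (1 - x) * (q2 powr r - 1)"
          using x p by (intro mult_left_mono) auto
        also have "\<dots> \<le> 1 * (q2 powr r - 1)" using x p1 by (intro mult_right_mono) auto
        finally have "C * ((1 - x) * (((1 - x) / (1 - u)) powr r - 1)) \<le> C * (q2 powr r - 1)"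
          using C0 by (intro mult_left_mono) auto
        then show ?thesis using q2(2) by simp
      next
        assume *: "real n * w \<le> q2 * real m \<and> real n * w \<le> q1 * real (n - c)"
        then have "real n * w \<le> real n * (q1 * (1 - u))" by (simp only: nuj[symmetric] mult.left_commute)
        then have "w \<le> q1 * (1 - u)" using n by simp
        then have "1 - x \<le> q1 * (1 - u)" using w by simp
        then have "(1 - x) / (1 - u) \<le> q1" using u by (simp add: pos_divide_le_eq)
        then have p: "((1 - x) / (1 - u)) powr r \<le> q1 powr r" using x u r by (intro powr_mono2) auto
        have "w \<le> q2 * real m / real n" using * n by (simp add: field_simps)
        then have xm: "1 - x \<le> q2 * real m / real n" using w by simp
        have "(1 - x) * (((1 - x) / (1 - u)) powr r - 1) \<le> (1 - x) * q1 powr r"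
          using x p by (intro mult_left_mono) auto
        also have "\<dots> \<le> q2 * real m / real n * q1 powr r" using xm by (intro mult_right_mono) auto
        finally have "C * ((1 - x) * (((1 - x) / (1 - u)) powr r - 1)) \<le> C * (q2 * real m / real n * q1 powr r)"
          using C0 by (intro mult_left_mono) auto
        then show ?thesis using big2 by simp
      qed
      moreover have "K s u x \<le> C * ((1 - x) * (((1 - x) / (1 - u)) powr r - 1))"
        using K_neg_upper_right[OF r(2) x(1) _ u(2)] False r(1) by (simp add: C)
      ultimately show ?thesis using l1 by linarith
    qed
    then show "K s (real (cnt X n {..x} \<omega>) / real n) x \<le> 1 / (1 + r) * l powr r" by (simp add: u_def c_def)
  qed
qed

lemma prob_S_stat_lower_neg:
  assumes r: "s = - r" "r > 0" and l: "1 < l'" "l' < l" and e: "0 < e"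
  shows "\<exists>m. \<forall>\<^sub>F n in sequentially.
    prob (emp_down l' m n) - e \<le> prob {\<omega>\<in>space M. S_stat s X n \<omega> \<le> 1 / (1 + r) * l powr r}"
proof -
  define C where "C = 1 / (r * (1 + r))"
  have e4: "e / 4 > 0" using e by simp
  have s0: "s < 1" using r by simp
  have "((\<lambda>q. 1 / (1 + r) * q powr r + C * (q powr r - 1)) \<longlongrightarrow> 1 / (1 + r) * 1 powr r + C * (1 powr r - 1)) (at_right 1)"
    by (intro tendsto_intros) auto
  \<comment> \<open>At q = 1 the left side is 1/(1+r), strictly below the target because l > 1; so
    some q2 slightly above 1 works.\<close>
  moreover have "1 / (1 + r) * 1 powr r + C * (1 powr r - 1) < 1 / (1 + r) * l powr r"
    using r l powr_less_mono2[of r 1 l] by (simp add: divide_strict_right_mono)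
  ultimately have ev1: "\<forall>\<^sub>F q in at_right 1. 1 / (1 + r) * q powr r + C * (q powr r - 1) < 1 / (1 + r) * l powr r"
    by (rule order_tendstoD)
  have "((\<lambda>q. C * (q powr r - 1)) \<longlongrightarrow> C * (1 powr r - 1)) (at_right 1)"
    by (intro tendsto_intros) auto
  moreover have "C * (1 powr r - 1) < 1 / (1 + r)" using r by simp
  ultimately have "\<forall>\<^sub>F q in at_right 1. C * (q powr r - 1) < 1 / (1 + r)" by (rule order_tendstoD)
  from eventually_conj[OF ev1 this]
  obtain b where b: "1 < b" "\<And>q. 1 < q \<Longrightarrow> q < b \<Longrightarrow>
    1 / (1 + r) * q powr r + C * (q powr r - 1) < 1 / (1 + r) * l powr r \<and> C * (q powr r - 1) < 1 / (1 + r)"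
    unfolding eventually_at_right_field by blast
  define q2 where "q2 = (1 + b) / 2"
  have q2: "1 < q2" "q2 < b" using b(1) by (auto simp: q2_def)
  obtain m1 where m1: "\<And>n. prob {\<omega>\<in>space M. \<exists>k\<ge>m1. k < n \<and> cnt Y n {..real k * l' / real n} \<omega> \<le> k} \<le> e / 4"
    using U.lower_tail_small[OF l(1) e4] by blast
  obtain m2 where m2: "\<And>n. prob {\<omega>\<in>space M. \<exists>k\<ge>m2. k < n \<and> cnt Y n {..real k * q2 / real n} \<omega> \<le> k} \<le> e / 4"
    using U.lower_tail_small[OF q2(1) e4] by blast
  obtain m3 where m3: "\<And>n. prob {\<omega>\<in>space M. \<exists>k\<ge>m3. k < n \<and> cnt (\<lambda>i \<omega>. 1 - Y i \<omega>) n {..real k * q2 / real n} \<omega> \<le> k} \<le> e / 4"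
    using R.lower_tail_small[OF q2(1) e4] by blast
  obtain q1 where q1: "1 < q1" "\<And>n. prob {\<omega>\<in>space M. \<exists>k\<ge>1. k < n \<and> cnt (\<lambda>i \<omega>. 1 - Y i \<omega>) n {..real k * q1 / real n} \<omega> \<le> k} \<le> e / 4"
    using R.lower_tail_small'[OF e4] by blast
  \<comment> \<open>Serves the slope q2 at both ends; the cutoff \<open>m1\<close> for the slope l'
    is the one that enters the grid event.\<close>
  define m where "m = max m2 m3"
  have F0: "0 < F_dist s (1 / l')" using F_dist_pos[OF s, of "1 / l'"] l by simp
  have "(\<lambda>n. q2 * real m / real n) \<longlonglongrightarrow> 0" by real_asymp
  then have "\<forall>\<^sub>F n in sequentially. q2 * real m / real n < F_dist s (1 / l')" using F0 by (rule order_tendstoD)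
  moreover have "(\<lambda>n. C * (q2 * real m / real n * q1 powr r)) \<longlonglongrightarrow> 0" by real_asymp
  then have "\<forall>\<^sub>F n in sequentially. C * (q2 * real m / real n * q1 powr r) < 1 / (1 + r)"
    by (rule order_tendstoD(2)) (use r in simp)
  ultimately have "\<forall>\<^sub>F n in sequentially.
    prob (emp_down l' m1 n) - e \<le> prob {\<omega>\<in>space M. S_stat s X n \<omega> \<le> 1 / (1 + r) * l powr r}"
    using eventually_ge_at_top[of 2] eventually_gt_at_top[of m]
  proof eventually_elim
    case (elim n)
    let ?B1 = "{\<omega>\<in>space M. \<exists>k\<ge>m1. k < n \<and> cnt Y n {..real k * l' / real n} \<omega> \<le> k}"
    let ?B2 = "{\<omega>\<in>space M. \<exists>k\<ge>m2. k < n \<and> cnt Y n {..real k * q2 / real n} \<omega> \<le> k}"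
    let ?B3 = "{\<omega>\<in>space M. \<exists>k\<ge>m3. k < n \<and> cnt (\<lambda>i \<omega>. 1 - Y i \<omega>) n {..real k * q2 / real n} \<omega> \<le> k}"
    let ?B4 = "{\<omega>\<in>space M. \<exists>k\<ge>1. k < n \<and> cnt (\<lambda>i \<omega>. 1 - Y i \<omega>) n {..real k * q1 / real n} \<omega> \<le> k}"
    let ?S = "{\<omega>\<in>space M. S_stat s X n \<omega> \<le> 1 / (1 + r) * l powr r}"
    let ?B = "(?B1 \<union> ?B2) \<union> (?B3 \<union> ?B4)"
    have B: "?B1 \<in> events" "?B2 \<in> events" "?B3 \<in> events" "?B4 \<in> events"
      by (intro sets.sets_Collect_countable_Ex sets.sets_Collect_conj sets.sets_Collect_const U.sets_cnt R.sets_cnt)+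
    have S: "?S \<in> events"
      using measurable_S_stat_less_1[of X M s n, OF X_measurable s0] by (simp add: borel_measurable_iff_le)
    have "prob (emp_down l' m1 n) \<le> prob ?S + e"
    proof (rule prob_le_of_AE[OF S])
      show "?B \<in> events" using B by (intro sets.Un)
      have "prob ?B \<le> prob ?B1 + prob ?B2 + (prob ?B3 + prob ?B4)"
        using measure_Un_le[OF sets.Un[OF B(1,2)] sets.Un[OF B(3,4)]] measure_Un_le[OF B(1,2)] measure_Un_le[OF B(3,4)]
        by linarith
      then show "prob ?B \<le> e" using m1[of n] m2[of n] m3[of n] q1(2)[of n] by linarith
      show "AE \<omega> in M. \<omega> \<in> emp_down l' m1 n \<longrightarrow> \<omega> \<in> ?S \<or> \<omega> \<in> ?B"
        using AE_X U.AE_distinct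
      proof eventually_elim
        case w: (elim \<omega>)
        have "\<omega> \<in> ?S" if em: "\<omega> \<in> emp_down l' m1 n" and nb: "\<omega> \<notin> ?B"
        proof -
          have sp: "\<omega> \<in> space M" using em by (simp add: emp_down_def)
          have nb1: "\<not> (\<exists>k\<ge>m1. k < n \<and> cnt Y n {..real k * l' / real n} \<omega> \<le> k)"
            and nb2: "\<not> (\<exists>k\<ge>m2. k < n \<and> cnt Y n {..real k * q2 / real n} \<omega> \<le> k)"
            and nb3: "\<not> (\<exists>k\<ge>m3. k < n \<and> cnt (\<lambda>i \<omega>. 1 - Y i \<omega>) n {..real k * q2 / real n} \<omega> \<le> k)"
            and nb4: "\<not> (\<exists>k\<ge>1. k < n \<and> cnt (\<lambda>i \<omega>. 1 - Y i \<omega>) n {..real k * q1 / real n} \<omega> \<le> k)"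
            using nb sp by blast+
          have "S_stat s X n \<omega> \<le> 1 / (1 + r) * l powr r"
          proof (rule S_stat_le_of_grid_neg[OF r elim(3,4) l q1(1) q2(1) w _ _ _ _ C_def])
            show "k < cnt Y n {..real k * l' / real n} \<omega>" if k: "k \<ge> 1" "k < n" for k
            proof (cases "k \<le> m1")
              case True then show ?thesis using em k by (simp add: emp_down_def)
            next
              case False
              then show ?thesis using nb1 k by (meson not_le less_imp_le)
            qed
            show "k < cnt Y n {..real k * q2 / real n} \<omega>" if "k \<ge> m" "k < n" for k
              using nb2 that unfolding m_def max.bounded_iff by (meson not_le)
            show "k < cnt (\<lambda>i \<omega>. 1 - Y i \<omega>) n {..real k * q2 / real n} \<omega>" if "k \<ge> m" "k < n" for k
              using nb3 that unfolding m_def max.bounded_iff by (meson not_le)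
            show "k < cnt (\<lambda>i \<omega>. 1 - Y i \<omega>) n {..real k * q1 / real n} \<omega>" if "k \<ge> 1" "k < n" for k
              using nb4 that by (meson not_le)
          qed (use b(2)[OF q2] elim in auto)
          then show ?thesis using sp by simp
        qed
        then show ?case by blast
      qed
    qed
    then show ?case by simp
  qed
  then show ?thesis by blast
qed

end

section \<open>Convergence of the statistics to the Poisson suprema\<close>

lemma converges_in_dist_ge_1:
  fixes M :: "'a measure" and P :: "'b measure"
  assumes M: "prob_space M" and P: "prob_space P" and N: "standard_poisson_process P N"
    and s1: "s \<ge> 1" and iid: "iid_with_cdf M X (F_dist s)"
  shows "converges_in_dist M (S_stat s X) P (\<lambda>\<omega>. 1 / s * (SUP t\<in>{0<..}. real (N t \<omega>) / t) powr s)"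
proof -
  interpret G: gof_sample M X s using M s1 iid by (simp add: gof_sample_def gof_sample_axioms_def)
  interpret SP: sample_and_poisson M "\<lambda>i \<omega>. F_dist s (X i \<omega>)" P N
    using G.U.uniform_sample_axioms P N
    by (simp add: sample_and_poisson_def poisson_process_def poisson_process_axioms_def)
  have "converges_in_dist M (S_stat s X) P (\<lambda>\<omega>. 1 / s * SP.sup_up \<omega> powr s)"
  proof (rule converges_in_dist_of_events[where E = SP.ev_up and En = G.emp_up])
    show "S_stat s X n \<in> borel_measurable M" for n by (rule measurable_S_stat_ge_1[OF G.X_measurable s1])
    show "SP.sup_up \<in> borel_measurable P" by (rule SP.meas_sup_up)
    show "SP.ev_up l m \<in> sets P" if "l > 0" for l m by (rule SP.sets_ev_up[OF that])
    show "SP.ev_up l (Suc m) \<subseteq> SP.ev_up l m" for l m by (rule SP.ev_up_Suc)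
    show "SP.sup_up \<omega> \<le> l" if "l > 0" "\<omega> \<in> space P" "\<And>m. \<omega> \<in> SP.ev_up l m" for l \<omega>
      by (rule SP.sup_up_le_of_ev_up[OF that])
    show "AE \<omega> in P. \<forall>l l' m. 0 < l \<longrightarrow> l < l' \<longrightarrow> SP.sup_up \<omega> \<le> l \<longrightarrow> \<omega> \<in> SP.ev_up l' m"
      by (rule SP.AE_ev_up_of_sup_up_le)
    show "(\<lambda>n. measure M (G.emp_up l m n)) \<longlonglongrightarrow> measure P (SP.ev_up l m)" if "l > 0" for l m
    proof -
      have "\<forall>f g. (\<forall>k\<in>{1..m}. f k = g k) \<longrightarrow> (\<forall>k\<in>{1..m}. f k < k) = (\<forall>k\<in>{1..m}. g k < (k::nat))" by auto
      from SP.grid_convergence[OF _ this, of "1 / l"] that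
      show ?thesis unfolding G.emp_up_def SP.ev_up_def by simp
    qed
    show "\<forall>\<^sub>F n in sequentially. measure M {\<omega> \<in> space M. S_stat s X n \<omega> \<le> 1 / s * l powr s}
        \<le> measure M (G.emp_up l' m n) + e" if "0 < l" "l < l'" "0 < e" for l l' m e
      by (rule G.prob_S_stat_upper_ge_1[OF s1 that])
    show "\<exists>m. \<forall>\<^sub>F n in sequentially. measure M (G.emp_up l' m n) - e
        \<le> measure M {\<omega> \<in> space M. S_stat s X n \<omega> \<le> 1 / s * l powr s}"
      if "1 < l'" "l' < l" "0 < e" for l l' e
      by (rule G.prob_S_stat_lower_ge_1[OF s1 that])
    show "measure P (\<Inter>m. SP.ev_up l m) = 0" if "0 < l" "l < 1" for l by (rule SP.null_INT_ev_up[OF that])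
  qed (use M P s1 in auto)
  then show ?thesis by (simp only: SP.sup_up_def)
qed

lemma converges_in_dist_neg:
  fixes M :: "'a measure" and P :: "'b measure"
  assumes M: "prob_space M" and P: "prob_space P" and N: "standard_poisson_process P N"
    and s0: "s < 0" and iid: "iid_with_cdf M X (F_dist s)"
  shows "converges_in_dist M (S_stat s X) P
    (\<lambda>\<omega>. 1 / (1 - s) * (SUP t\<in>{first_jump N \<omega>..}. t / real (N t \<omega>)) powr (- s))"
proof -
  interpret G: gof_sample M X s using M s0 iid by (simp add: gof_sample_def gof_sample_axioms_def)
  interpret SP: sample_and_poisson M "\<lambda>i \<omega>. F_dist s (X i \<omega>)" P N
    using G.U.uniform_sample_axioms P N
    by (simp add: sample_and_poisson_def poisson_process_def poisson_process_axioms_def)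
  define r where "r = - s"
  have r: "s = - r" "r > 0" using s0 by (auto simp: r_def)
  have s1: "s < 1" using s0 by simp
  have "converges_in_dist M (S_stat s X) P (\<lambda>\<omega>. 1 / (1 + r) * SP.sup_down \<omega> powr r)"
  proof (rule converges_in_dist_of_events[where E = SP.ev_down and En = G.emp_down])
    show "S_stat s X n \<in> borel_measurable M" for n by (rule measurable_S_stat_less_1[OF G.X_measurable s1])
    show "SP.sup_down \<in> borel_measurable P" by (rule SP.meas_sup_down)
    show "SP.ev_down l m \<in> sets P" if "l > 0" for l m by (rule SP.sets_ev_down[OF that])
    show "SP.ev_down l (Suc m) \<subseteq> SP.ev_down l m" for l m by (rule SP.ev_down_Suc)
    show "SP.sup_down \<omega> \<le> l" if "l > 0" "\<omega> \<in> space P" "\<And>m. \<omega> \<in> SP.ev_down l m" for l \<omega>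
      by (rule SP.sup_down_le_of_ev_down[OF that])
    show "AE \<omega> in P. \<forall>l l' m. 0 < l \<longrightarrow> l < l' \<longrightarrow> SP.sup_down \<omega> \<le> l \<longrightarrow> \<omega> \<in> SP.ev_down l' m"
      by (rule SP.AE_ev_down_of_sup_down_le)
    show "(\<lambda>n. measure M (G.emp_down l m n)) \<longlonglongrightarrow> measure P (SP.ev_down l m)" if "l > 0" for l m
    proof -
      have "\<forall>f g. (\<forall>k\<in>{1..m}. f k = g k) \<longrightarrow> (\<forall>k\<in>{1..m}. k < f k) = (\<forall>k\<in>{1..m}. (k::nat) < g k)" by auto
      from SP.grid_convergence[OF that this]
      show ?thesis unfolding G.emp_down_def SP.ev_down_def .
    qed
    show "\<forall>\<^sub>F n in sequentially. measure M {\<omega> \<in> space M. S_stat s X n \<omega> \<le> 1 / (1 + r) * l powr r}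
        \<le> measure M (G.emp_down l' m n) + e" if "0 < l" "l < l'" "0 < e" for l l' m e
      by (rule G.prob_S_stat_upper_neg[OF r that])
    show "\<exists>m. \<forall>\<^sub>F n in sequentially. measure M (G.emp_down l' m n) - e
        \<le> measure M {\<omega> \<in> space M. S_stat s X n \<omega> \<le> 1 / (1 + r) * l powr r}"
      if "1 < l'" "l' < l" "0 < e" for l l' e
      by (rule G.prob_S_stat_lower_neg[OF r that])
    show "measure P (\<Inter>m. SP.ev_down l m) = 0" if "0 < l" "l < 1" for l by (rule SP.null_INT_ev_down[OF that])
  qed (use M P r in auto)
  then show ?thesis by (simp add: SP.sup_down_def r_def)
qed

theorem proposition4p3:
  fixes M :: "'a measure" and P :: "'b measure" and Q :: "'c measure"
    and N :: "real \<Rightarrow> 'b \<Rightarrow> nat" and U :: "'c \<Rightarrow> real"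
  assumes "prob_space M" "prob_space P" "prob_space Q"
    and "standard_poisson_process P N"
    and "U \<in> borel_measurable Q"
    and "distr Q borel U = uniform_measure lborel {0<..<1}"
  shows
    "(\<forall>s X. s \<ge> 1 \<and> iid_with_cdf M X (F_dist s) \<longrightarrow>
       converges_in_dist M (S_stat s X)
         P (\<lambda>\<omega>. 1 / s * (SUP t\<in>{0<..}. real (N t \<omega>) / t) powr s) \<and>
       eq_in_dist P (\<lambda>\<omega>. 1 / s * (SUP t\<in>{0<..}. real (N t \<omega>) / t) powr s)
         Q (\<lambda>\<omega>. 1 / (s * U \<omega> powr s))) \<and>
     (\<forall>s X. s < 0 \<and> iid_with_cdf M X (F_dist s) \<longrightarrow>
       converges_in_dist M (S_stat s X)
         P (\<lambda>\<omega>. 1 / (1 - s) *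
              (SUP t\<in>{first_jump N \<omega>..}. t / real (N t \<omega>)) powr (- s)))"
proof (intro conjI allI impI; elim conjE)
  fix s X assume s: "s \<ge> 1" and iid: "iid_with_cdf M X (F_dist s)"
  show "converges_in_dist M (S_stat s X) P (\<lambda>\<omega>. 1 / s * (SUP t\<in>{0<..}. real (N t \<omega>) / t) powr s)"
    by (rule converges_in_dist_ge_1[OF assms(1,2,4) s iid])
  \<comment> \<open>The identity in law compares the Poisson process with U; the sample enters
    through the Poisson tail bounds, which were obtained as limits of binomial ones.\<close>
  interpret G: gof_sample M X s using assms(1) s iid by (simp add: gof_sample_def gof_sample_axioms_def)
  interpret SP: sample_and_poisson M "\<lambda>i \<omega>. F_dist s (X i \<omega>)" P N
    using G.U.uniform_sample_axioms assms(2,4)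
    by (simp add: sample_and_poisson_def poisson_process_def poisson_process_axioms_def)
  show "eq_in_dist P (\<lambda>\<omega>. 1 / s * (SUP t\<in>{0<..}. real (N t \<omega>) / t) powr s) Q (\<lambda>\<omega>. 1 / (s * U \<omega> powr s))"
    using SP.eq_in_dist_sup_up[OF assms(3,5,6)] by (simp only: SP.sup_up_def)
next
  fix s X assume s: "s < 0" and iid: "iid_with_cdf M X (F_dist s)"
  show "converges_in_dist M (S_stat s X) P
    (\<lambda>\<omega>. 1 / (1 - s) * (SUP t\<in>{first_jump N \<omega>..}. t / real (N t \<omega>)) powr (- s))"
    by (rule converges_in_dist_neg[OF assms(1,2,4) s iid])
qed

end
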